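(* Assume that $1\le p<\infty$ and that $X$ is a locally complete metric space equipped with a positive complete Borel measure $\mu$ such that $0<\mu(B)<\infty$ for all balls $B\subset X$. Let $\Omega\subset X$ be open. Then the following properties hold: (a) (Outer capacity) If $E\subset\Omega$ then $$\mathrm{cap}_p(E,\Omega)=\inf_{\substack{G\text{ open} \\ E\subset G\subset\Omega}}\mathrm{cap}_p(G,\Omega).$$ (b) If $K_1\supset K_2\supset\cdots$ are compact subsets of $\Omega$, then $$\mathrm{cap}_p\biggl(\bigcap_{i=1}^\infty K_i,\Omega\biggr)=\lim_{i\to\infty}\mathrm{cap}_p(K_i,\Omega).$$
   Context: Locally complete means that every point of $X$ has a complete neighbourhood. Balls are open. $\overline{\mathbf{R}}=[-\infty,\infty]$ and $\chi_A$ is the characteristic function of $A$. The sets $\Omega$ and $E$ may be unbounded. Upper gradients. A curve is a nonconstant compact rectifiable curve, parameterized by arc length $ds$. A property holds for $p$-almost every curve if there is a nonnegative $\rho\in L^p(X)$ with $\int_\gamma\rho\,ds=\infty$ for every curve $\gamma$ for which it fails. A measurable $g:X\to[0,\infty]$ is a $p$-weak upper gradient of $f:X\to\overline{\mathbf{R}}$ if for $p$-almost all curves $\gamma:[0,l_\gamma]\to X$, $|f(\gamma(0))-f(\gamma(l_\gamma))|\le\int_\gamma g\,ds$, where the left-hand side is $\infty$ if at least one of the terms is infinite. If $f$ has a $p$-weak upper gradient in $L^p_{\rm loc}(X)$, then $g_f$ denotes its minimal $p$-weak upper gradient ($g_f\le g$ a.e. for every $p$-weak upper gradient $g\in L^p_{\rm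 loc}(X)$ of $f$). $N^{1,p}(X)$ is the space of measurable $f$, defined everywhere with values in $\overline{\mathbf{R}}$, with $\|f\|_{N^{1,p}(X)}^p=\int_X|f|^p\,d\mu+\inf_g\int_X g^p\,d\mu<\infty$, infimum over all $p$-weak upper gradients $g$ of $f$. Condenser capacity. For open $\Omega$ and bounded $E\subset\Omega$, $\mathrm{cap}_p(E,\Omega)=\inf_u\int_\Omega g_u^p\,d\mu$ over $u\in N^{1,p}(X)$ with $\chi_E\le u\le\chi_\Omega$ ($=\infty$ if there is no such $u$); for unbounded $E\subset\Omega$, $\mathrm{cap}_p(E,\Omega)=\lim_{j\to\infty}\mathrm{cap}_p(E\cap B(x_0,j),\Omega)$, where $x_0\in X$ is any fixed point (the limit does not depend on it). Also $\mathrm{cap}_p(\emptyset,\emptyset)=0$. *)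

theory Defs
  imports "HOL-Analysis.Analysis"
begin

definition ennreal_rpow :: "ennreal \<Rightarrow> real \<Rightarrow> ennreal" where
  "ennreal_rpow a p = (if a = \<infinity> then \<infinity> else ennreal (enn2real a powr p))"

text \<open>The \<open>\<sigma>\<close>-algebra of a complete Borel measure is the completion of the Borel
  \<open>\<sigma>\<close>-algebra. The underlying space is the whole type.\<close>

definition complete_borel_measure :: "'a::metric_space measure \<Rightarrow> bool" where
  "complete_borel_measure M \<longleftrightarrow> (\<exists>N. sets N = sets borel \<and> M = completion N)"

subsection \<open>Curves\<close>

definition curve_length :: "(real \<Rightarrow> 'a::metric_space) \<Rightarrow> real \<Rightarrow> real \<Rightarrow> ennreal" where
  "curve_length \<gamma> a b =
    (SUP (n, t) \<in> {(n::nat, t::nat \<Rightarrow> real). mono_on {..n} t \<and> t ` {..n} \<subseteq> {a..b}}.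
      \<Sum>i<n. ennreal (dist (\<gamma> (t i)) (\<gamma> (t (Suc i)))))"

text \<open>A nonconstant compact rectifiable curve parameterized by arc length is a map on \<open>[0, l]\<close>
  with \<open>0 < l < \<infinity>\<close>; the values of \<open>\<gamma>\<close> outside \<open>[0, l]\<close> are irrelevant. The last condition makes
  the length equal to \<open>l\<close>, so that the curve is rectifiable and nonconstant.\<close>

definition arc_length_curve :: "(real \<Rightarrow> 'a::metric_space) \<Rightarrow> real \<Rightarrow> bool" where
  "arc_length_curve \<gamma> l \<longleftrightarrow>
    0 < l \<and> continuous_on {0..l} \<gamma> \<and> (\<forall>t\<in>{0..l}. curve_length \<gamma> 0 t = ennreal t)"

text \<open>The integral along \<open>\<gamma>\<close> is defined only when \<open>line_measurable\<close> holds, so every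
  use of \<open>line_integral\<close> below is accompanied by this condition.\<close>

definition line_measurable :: "('a::metric_space \<Rightarrow> ennreal) \<Rightarrow> (real \<Rightarrow> 'a) \<Rightarrow> real \<Rightarrow> bool" where
  "line_measurable \<rho> \<gamma> l \<longleftrightarrow> (\<lambda>t. \<rho> (\<gamma> t)) \<in> borel_measurable (lebesgue_on {0..l})"

definition line_integral :: "('a::metric_space \<Rightarrow> ennreal) \<Rightarrow> (real \<Rightarrow> 'a) \<Rightarrow> real \<Rightarrow> ennreal" where
  "line_integral \<rho> \<gamma> l = (\<integral>\<^sup>+ t. \<rho> (\<gamma> t) \<partial>lebesgue_on {0..l})"

definition p_almost_every_curve ::
  "'a::metric_space measure \<Rightarrow> real \<Rightarrow> ((real \<Rightarrow> 'a) \<Rightarrow> real \<Rightarrow> bool) \<Rightarrow> bool" where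
  "p_almost_every_curve M p P \<longleftrightarrow>
    (\<exists>\<rho>. \<rho> \<in> borel_measurable M \<and> (\<integral>\<^sup>+ x. ennreal_rpow (\<rho> x) p \<partial>M) < \<infinity> \<and>
      (\<forall>\<gamma> l. arc_length_curve \<gamma> l \<longrightarrow> \<not> P \<gamma> l \<longrightarrow>
        line_measurable \<rho> \<gamma> l \<and> line_integral \<rho> \<gamma> l = \<infinity>))"

subsection \<open>Weak upper gradients and the Newtonian space\<close>

text \<open>By the conventions for \<^typ>\<open>ereal\<close>, the left-hand side of the upper gradient inequality
  is \<open>\<infinity>\<close> as soon as one of the two terms is infinite.\<close>

lemma e2ennreal_abs_diff_infinite:
  fixes a b :: ereal
  assumes "\<bar>a\<bar> = \<infinity> \<or> \<bar>b\<bar> = \<infinity>"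
  shows "e2ennreal \<bar>a - b\<bar> = \<infinity>"
  using assms by (cases a; cases b) (auto simp: e2ennreal_infty)

definition weak_upper_gradient ::
  "'a::metric_space measure \<Rightarrow> real \<Rightarrow> ('a \<Rightarrow> ereal) \<Rightarrow> ('a \<Rightarrow> ennreal) \<Rightarrow> bool" where
  "weak_upper_gradient M p f g \<longleftrightarrow>
    g \<in> borel_measurable M \<and>
    p_almost_every_curve M p (\<lambda>\<gamma> l.
      line_measurable g \<gamma> l \<and> e2ennreal \<bar>f (\<gamma> 0) - f (\<gamma> l)\<bar> \<le> line_integral g \<gamma> l)"

definition Lp_loc :: "'a::metric_space measure \<Rightarrow> real \<Rightarrow> ('a \<Rightarrow> ennreal) \<Rightarrow> bool" where
  "Lp_loc M p g \<longleftrightarrow>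
    g \<in> borel_measurable M \<and>
    (\<forall>x. \<exists>r>0. (\<integral>\<^sup>+ y\<in>ball x r. ennreal_rpow (g y) p \<partial>M) < \<infinity>)"

definition is_minimal_weak_upper_gradient ::
  "'a::metric_space measure \<Rightarrow> real \<Rightarrow> ('a \<Rightarrow> ereal) \<Rightarrow> ('a \<Rightarrow> ennreal) \<Rightarrow> bool" where
  "is_minimal_weak_upper_gradient M p f g \<longleftrightarrow>
    weak_upper_gradient M p f g \<and> Lp_loc M p g \<and>
    (\<forall>h. weak_upper_gradient M p f h \<longrightarrow> Lp_loc M p h \<longrightarrow> (AE x in M. g x \<le> h x))"

text \<open>Minimality determines \<open>g\<close> up to null sets, so integrals of \<open>minimal_weak_upper_gradient\<close> do
  not depend on the choice.\<close>

definition minimal_weak_upper_gradient ::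
  "'a::metric_space measure \<Rightarrow> real \<Rightarrow> ('a \<Rightarrow> ereal) \<Rightarrow> 'a \<Rightarrow> ennreal" where
  "minimal_weak_upper_gradient M p f = (SOME g. is_minimal_weak_upper_gradient M p f g)"

text \<open>The \<open>p\<close>-th power of the norm.\<close>

definition newtonian_norm_pow :: "'a::metric_space measure \<Rightarrow> real \<Rightarrow> ('a \<Rightarrow> ereal) \<Rightarrow> ennreal" where
  "newtonian_norm_pow M p f =
    (\<integral>\<^sup>+ x. ennreal_rpow (e2ennreal \<bar>f x\<bar>) p \<partial>M) +
    (INF g\<in>{g. weak_upper_gradient M p f g}. \<integral>\<^sup>+ x. ennreal_rpow (g x) p \<partial>M)"

definition newtonian :: "'a::metric_space measure \<Rightarrow> real \<Rightarrow> ('a \<Rightarrow> ereal) set" where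
  "newtonian M p = {f. f \<in> borel_measurable M \<and> newtonian_norm_pow M p f < \<infinity>}"

subsection \<open>Condenser capacity\<close>

text \<open>The infimum of the empty set is \<open>\<infinity>\<close> in \<^typ>\<open>ennreal\<close>.\<close>

definition condenser_cap_bounded ::
  "'a::metric_space measure \<Rightarrow> real \<Rightarrow> 'a set \<Rightarrow> 'a set \<Rightarrow> ennreal" where
  "condenser_cap_bounded M p E \<Omega> =
    (INF u\<in>{u \<in> newtonian M p. \<forall>x. indicator E x \<le> u x \<and> u x \<le> indicator \<Omega> x}.
      \<integral>\<^sup>+ x\<in>\<Omega>. ennreal_rpow (minimal_weak_upper_gradient M p u x) p \<partial>M)"

text \<open>The base point \<open>x0\<close> is used only for unbounded \<open>E\<close>. There the sequence is
  nondecreasing, so the limit exists.\<close>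

definition condenser_cap ::
  "'a::metric_space measure \<Rightarrow> real \<Rightarrow> 'a \<Rightarrow> 'a set \<Rightarrow> 'a set \<Rightarrow> ennreal" where
  "condenser_cap M p x0 E \<Omega> =
    (if bounded E then condenser_cap_bounded M p E \<Omega>
     else lim (\<lambda>j::nat. condenser_cap_bounded M p (E \<inter> ball x0 (real j)) \<Omega>))"

text \<open>The convention that the capacity of \<open>({}, {})\<close> is zero is automatic.\<close>

lemma zero_newtonian: "(\<lambda>_. 0) \<in> newtonian M p"
proof -
  have "weak_upper_gradient M p (\<lambda>_. 0) (\<lambda>_. 0)"
    unfolding weak_upper_gradient_def p_almost_every_curve_def
    by (auto simp: line_measurable_def ennreal_rpow_def e2ennreal_neg intro!: exI[of _ "\<lambda>_. 0"])
  then have "(INF g\<in>{g. weak_upper_gradient M p (\<lambda>_. 0) g}. \<integral>\<^sup>+ x. ennreal_rpow (g x) p \<partial>M)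
      \<le> (\<integral>\<^sup>+ x. ennreal_rpow 0 p \<partial>M)"
    by (intro INF_lower2[of "\<lambda>_. 0"]) auto
  then show ?thesis
    by (simp add: newtonian_def newtonian_norm_pow_def ennreal_rpow_def e2ennreal_neg)
qed

lemma condenser_cap_empty: "condenser_cap M p x0 {} {} = 0"
proof -
  have "condenser_cap_bounded M p {} {} \<le>
      (\<integral>\<^sup>+ x\<in>{}. ennreal_rpow (minimal_weak_upper_gradient M p (\<lambda>_. 0) x) p \<partial>M)"
    unfolding condenser_cap_bounded_def
    by (rule INF_lower) (simp add: zero_newtonian)
  then show ?thesis
    by (simp add: condenser_cap_def)
qed

end

theory Submission
  imports Defs
begin

text \<open>
Outer regularity follows once an admissible function \<open>u\<close> can be perturbed, at small cost in energy, to
one that is at least \<open>1 - \<theta>\<close> on an open set containing \<open>E\<close>. Locally, on a complete ball \<open>D\<close>, let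
\<open>h = u\<close> on a closed set \<open>F\<close> of almost full measure on which \<open>u\<close> is lower semicontinuous, and \<open>h = 1\<close>
elsewhere; let \<open>g\<close> be a lower semicontinuous upper gradient of \<open>u\<close> that is huge outside compact sets.
Then \<open>v y\<close>, the infimum of \<open>h (c 0)\<close> plus the integral of \<open>g\<close> along \<open>c\<close> over all 1-Lipschitz paths
\<open>c\<close> in \<open>D\<close> ending at \<open>y\<close>, satisfies \<open>u \<le> v \<le> h\<close>, has upper gradient \<open>g\<close>, and is lower semicontinuous by
an Arzela--Ascoli argument together with Fatou's lemma. As \<open>v - u\<close> vanishes on \<open>F\<close>, its energy is small. The
local corrections \<open>v - u\<close>, cut off by bump functions, are glued by taking their supremum over a countable cover
of \<open>\<Omega>\<close>. For unbounded \<open>E\<close> the open sets obtained for the bounded pieces are combined by strong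
subadditivity. Part (b) is outer regularity plus compactness.
\<close>

subsection \<open>Regularity of Borel measures and integrals over intervals\<close>

text \<open>The set where an admissible \<open>u\<close> exceeds \<open>1 - \<theta>\<close> need
  not be open, and with neither properness nor doubling nor a Poincare inequality assumed, density
  of continuous functions cannot be taken for granted. Only superlevel sets matter, so a lower
  semicontinuous function above \<open>u\<close> suffices, and local completeness is what makes
  almost minimising paths converge. The correction \<open>v - u\<close> has an upper gradient
  supported on a set of small measure, so only the p-integrability of that gradient counts, never
  its size. This freedom is spent three times: the weight of the exceptional curves is added to the
  gradient of \<open>u\<close>, so that no curve remains exceptional; the sum is enlarged to a lower
  semicontinuous function; and it is made huge off compact sets. In the final energy
  \<open>u\<close> still enters with its original gradient, times a factor close to 1. Gradients are
  compared pointwise throughout, by minima along curves and infima of decreasing sequences, which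
  treats \<open>p = 1\<close> and \<open>p > 1\<close> alike.\<close>

lemma open_eq_Union_closed_incseq:
  fixes A :: "'a::metric_space set"
  assumes "open A"
  shows "\<exists>F :: nat \<Rightarrow> 'a set. (\<forall>n. closed (F n)) \<and> incseq F \<and> (\<Union>n. F n) = A"
\<comment> \<open>\<open>infdist x {}\<close> is 0 by convention, so for an empty complement the
  sets defined by the distance would all be empty.\<close>
proof (cases "A = UNIV")
  case True
  then show ?thesis by (intro exI[of _ "\<lambda>_. UNIV"]) auto
next
  case False
  define F where "F n = {x. 1 / real (Suc n) \<le> infdist x (- A)}" for n
  have "closed (F n)" for n
    unfolding F_def by (intro closed_Collect_le continuous_intros)
  moreover have "incseq F"
    unfolding F_def incseq_def
  proof safe
    fix m n :: nat and x assume "m \<le> n" "1 / real (Suc m) \<le> infdist x (- A)"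
    moreover have "1 / real (Suc n) \<le> 1 / real (Suc m)" using \<open>m \<le> n\<close> by (intro divide_left_mono) auto
    ultimately show "1 / real (Suc n) \<le> infdist x (- A)" by linarith
  qed
  moreover have "(\<Union>n. F n) = A"
  proof (intro subset_antisym subsetI)
    fix x assume "x \<in> (\<Union>n. F n)"
    then obtain n where n: "1 / real (Suc n) \<le> infdist x (- A)" by (auto simp: F_def)
    have "0 < 1 / real (Suc n)" by simp
    with n have "infdist x (- A) \<noteq> 0" by linarith
    then show "x \<in> A" using infdist_zero[of x "- A"] by blast
  next
    fix x assume "x \<in> A"
    have "closed (- A)" "- A \<noteq> {}" using assms False by auto
    then have "infdist x (- A) \<noteq> 0" using \<open>x \<in> A\<close> in_closed_iff_infdist_zero by blast
    then have "0 < infdist x (- A)" using infdist_nonneg[of x "- A"] by linarith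
    then obtain n where "1 / real (Suc n) < infdist x (- A)"
      using reals_Archimedean[of "infdist x (- A)"] by (auto simp: inverse_eq_divide)
    then show "x \<in> (\<Union>n. F n)" by (auto simp: F_def intro!: exI[of _ n])
  qed
  ultimately show ?thesis by blast
qed

text \<open>The sets with this approximation property form a \<sigma>-algebra containing the open
  sets: complements exchange the inner and the outer set, and in a countable union the infinitely
  many closed sets are cut down to finitely many by continuity from above, where finiteness of the
  measure enters.\<close>

lemma finite_borel_closed_open_approx:
  fixes N :: "'a::metric_space measure"
  assumes [simp]: "sets N = sets borel" and fin: "emeasure N UNIV \<noteq> \<infinity>"
    and A: "A \<in> sets borel" and "0 < e"
  shows "\<exists>C U. closed C \<and> open U \<and> C \<subseteq> A \<and> A \<subseteq> U \<and> emeasure N (U - C) < ennreal e"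
proof -
  have fin': "emeasure N B \<noteq> \<infinity>" for B
    using fin emeasure_space[of N B] sets_eq_imp_space_eq[OF assms(1)]
    by (metis infinity_ennreal_def space_borel top.extremum_uniqueI)
  have "A \<in> sigma_sets UNIV {S. open S}" using A by (simp add: borel_def)
  then have "\<forall>e>0. \<exists>C U. closed C \<and> open U \<and> C \<subseteq> A \<and> A \<subseteq> U \<and> emeasure N (U - C) < ennreal e"
  proof induction
    case (Basic A)
    then have A: "open A" by simp
    show ?case
    proof (intro allI impI)
      fix e :: real assume "0 < e"
      from open_eq_Union_closed_incseq[OF A] obtain F :: "nat \<Rightarrow> 'a set" where
        F: "\<And>n. closed (F n)" "incseq F" "(\<Union>n. F n) = A" by blast
      have "(\<lambda>n. emeasure N (A - F n)) \<longlonglongrightarrow> emeasure N (\<Inter>n. A - F n)"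
        using F(2) A F(1) fin'
        by (intro Lim_emeasure_decseq) (auto simp: decseq_def incseq_def borel_open borel_closed)
      moreover have e: "(\<Inter>n. A - F n) = {}" using F(3) by auto
      ultimately have "(\<lambda>n. emeasure N (A - F n)) \<longlonglongrightarrow> 0" unfolding e by simp
      then have "eventually (\<lambda>n. emeasure N (A - F n) < ennreal e) sequentially"
        using \<open>0 < e\<close> by (intro order_tendstoD) auto
      then obtain n where "emeasure N (A - F n) < ennreal e"
        using eventually_happens'[OF sequentially_bot] by blast
      with F A show "\<exists>C U. closed C \<and> open U \<and> C \<subseteq> A \<and> A \<subseteq> U \<and> emeasure N (U - C) < ennreal e"
        by (intro exI[of _ "F n"] exI[of _ A]) auto
    qed
  next
    case Empty
    then show ?case by (intro allI impI exI[of _ "{}"]) simp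
  next
    case (Compl A)
    show ?case
    proof (intro allI impI)
      fix e :: real assume "0 < e"
      with Compl.IH have "\<exists>C U. closed C \<and> open U \<and> C \<subseteq> A \<and> A \<subseteq> U \<and> emeasure N (U - C) < ennreal e"
        by simp
      then obtain C U where *: "closed C" "open U" "C \<subseteq> A" "A \<subseteq> U"
        "emeasure N (U - C) < ennreal e" by (elim exE conjE)
      have "- C - - U = U - C" by auto
      with * show "\<exists>C U. closed C \<and> open U \<and> C \<subseteq> UNIV - A \<and> UNIV - A \<subseteq> U \<and> emeasure N (U - C) < ennreal e"
        by (intro exI[of _ "- U"] exI[of _ "- C"]) (auto simp: closed_def)
    qed
  next
    case (Union A)
    show ?case
    proof (intro allI impI)
      fix e :: real assume "0 < e"
      \<comment> \<open>The errors add up to \<open>e / 2\<close>, strictly below \<open>e\<close>;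
        the strict inequality survives the passage to finitely many closed sets.\<close>
      define d where "d n = e / 2 * (1/2) ^ Suc n" for n
      have d: "0 < d n" for n using \<open>0 < e\<close> by (simp add: d_def)
      have "\<exists>C U. closed C \<and> open U \<and> C \<subseteq> A n \<and> A n \<subseteq> U \<and> emeasure N (U - C) < ennreal (d n)" for n
        using Union.IH[of n] d[of n] by simp
      then obtain C U where CU: "\<And>n. closed (C n)" "\<And>n. open (U n)" "\<And>n. C n \<subseteq> A n" "\<And>n. A n \<subseteq> U n"
        "\<And>n. emeasure N (U n - C n) < ennreal (d n)" by metis
      have [measurable]: "C n \<in> sets borel" "U n \<in> sets borel" for n using CU by (auto simp: borel_open borel_closed)
      have [measurable]: "(\<Union>n. U n - C n) \<in> sets borel" by measurable
      have sd: "(\<Sum>n. ennreal (d n)) = ennreal (e/2)"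
      proof -
        have "d sums (e/2 * 1)" unfolding d_def by (intro sums_mult power_half_series)
        then show ?thesis using d by (intro suminf_ennreal_eq) (auto intro: less_imp_le)
      qed
      have "emeasure N ((\<Union>n. U n) - (\<Union>n. C n)) \<le> emeasure N (\<Union>n. U n - C n)"
        by (intro emeasure_mono) auto
      also have "\<dots> \<le> (\<Sum>n. emeasure N (U n - C n))" by (intro emeasure_subadditive_countably) auto
      also have "\<dots> \<le> (\<Sum>n. ennreal (d n))" by (intro suminf_le) (use CU(5) in \<open>auto intro: less_imp_le\<close>)
      also have "\<dots> < ennreal e" unfolding sd using \<open>0 < e\<close> by (simp add: ennreal_less_iff)
      finally have lt: "emeasure N ((\<Union>n. U n) - (\<Union>n. C n)) < ennreal e" .
      have "(\<lambda>k. emeasure N ((\<Union>n. U n) - (\<Union>n\<in>{..<k}. C n))) \<longlonglongrightarrow> emeasure N (\<Inter>k. (\<Union>n. U n) - (\<Union>n\<in>{..<k}. C n))"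
        using fin' by (intro Lim_emeasure_decseq) (auto simp: decseq_def)
      moreover have "(\<Inter>k. (\<Union>n. U n) - (\<Union>n\<in>{..<k}. C n)) = (\<Union>n. U n) - (\<Union>n. C n)"
        by auto
      ultimately have "eventually (\<lambda>k. emeasure N ((\<Union>n. U n) - (\<Union>n\<in>{..<k}. C n)) < ennreal e) sequentially"
        using lt by (intro order_tendstoD) auto
      then obtain k where "emeasure N ((\<Union>n. U n) - (\<Union>n\<in>{..<k}. C n)) < ennreal e"
        using eventually_happens'[OF sequentially_bot] by blast
      moreover have "closed (\<Union>n\<in>{..<k}. C n)" using CU(1) by (intro closed_UN) auto
      moreover have "open (\<Union>n. U n)" using CU(2) by (intro open_UN) auto
      moreover have "(\<Union>n\<in>{..<k}. C n) \<subseteq> (\<Union>n. A n)" using CU(3) by blast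
      moreover have "(\<Union>n. A n) \<subseteq> (\<Union>n. U n)" using CU(4) by blast
      ultimately show "\<exists>C U. closed C \<and> open U \<and> C \<subseteq> \<Union> (range A) \<and> \<Union> (range A) \<subseteq> U \<and> emeasure N (U - C) < ennreal e"
        by (intro exI[of _ "\<Union>n\<in>{..<k}. C n"] exI[of _ "\<Union>n. U n"] conjI)
    qed
  qed
  then show ?thesis using \<open>0 < e\<close> by blast
qed

text \<open>A comparison on short intervals propagates to long ones when the smaller quantity is
  subadditive and the larger one superadditive: pieces of length \<open>d / 2\<close> are split off
  on the left until the rest is shorter than \<open>d\<close>.\<close>

lemma interval_chain:
  fixes \<Phi> \<Psi> :: "real \<Rightarrow> real \<Rightarrow> ennreal"
  assumes "a \<le> b" "0 < d"
    and sub: "\<And>r s t. a \<le> r \<Longrightarrow> r \<le> s \<Longrightarrow> s \<le> t \<Longrightarrow> t \<le> b \<Longrightarrow> \<Phi> r t \<le> \<Phi> r s + \<Phi> s t"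
    and sup: "\<And>r s t. a \<le> r \<Longrightarrow> r \<le> s \<Longrightarrow> s \<le> t \<Longrightarrow> t \<le> b \<Longrightarrow> \<Psi> r s + \<Psi> s t \<le> \<Psi> r t"
    and small: "\<And>s t. a \<le> s \<Longrightarrow> s \<le> t \<Longrightarrow> t \<le> b \<Longrightarrow> t - s < d \<Longrightarrow> \<Phi> s t \<le> \<Psi> s t"
  shows "\<Phi> a b \<le> \<Psi> a b"
proof -
  have "\<Phi> s b \<le> \<Psi> s b" if "a \<le> s" "s \<le> b" "b - s < real n * (d/2)" for n s
    using that
  proof (induction n arbitrary: s)
    case 0
    then show ?case using \<open>0 < d\<close> by auto
  next
    case (Suc n)
    show ?case
    proof (cases "b - s < d")
      case True
      with Suc.prems small show ?thesis by blast
    next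
      case False
      let ?m = "s + d/2"
      have m: "a \<le> ?m" "s \<le> ?m" "?m \<le> b" "b - ?m < real n * (d/2)"
        using Suc.prems False \<open>0 < d\<close> by (auto simp: algebra_simps)
      have "\<Phi> s b \<le> \<Phi> s ?m + \<Phi> ?m b" using sub m Suc.prems by blast
      also have "\<dots> \<le> \<Psi> s ?m + \<Psi> ?m b"
        using small[of s ?m] Suc.IH[of ?m] m Suc.prems \<open>0 < d\<close> by (intro add_mono) auto
      also have "\<dots> \<le> \<Psi> s b" using sup m Suc.prems by blast
      finally show ?thesis .
    qed
  qed
  moreover obtain n where "b - a < real n * (d/2)"
    using ex_less_of_nat_mult[of "d/2" "b - a"] \<open>0 < d\<close> by auto
  ultimately show ?thesis using \<open>a \<le> b\<close> by blast
qed

lemma nn_integral_Icc_add: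
  fixes f :: "real \<Rightarrow> ennreal"
  assumes [measurable]: "f \<in> borel_measurable borel" and "r \<le> s" "s \<le> t"
  shows "(\<integral>\<^sup>+x\<in>{r..s}. f x \<partial>lborel) + (\<integral>\<^sup>+x\<in>{s..t}. f x \<partial>lborel) = (\<integral>\<^sup>+x\<in>{r..t}. f x \<partial>lborel)"
proof -
  have "(\<integral>\<^sup>+x\<in>{r..s}. f x \<partial>lborel) + (\<integral>\<^sup>+x\<in>{s..t}. f x \<partial>lborel)
      = (\<integral>\<^sup>+x. f x * indicator {r..s} x + f x * indicator {s..t} x \<partial>lborel)"
    by (subst nn_integral_add) auto
  also have "\<dots> = (\<integral>\<^sup>+x\<in>{r..t}. f x \<partial>lborel)"
    using AE_lborel_singleton[of s] assms
    by (intro nn_integral_cong_AE) (auto split: split_indicator)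
  finally show ?thesis .
qed

text \<open>A 1-Lipschitz map does not increase length. For compact \<open>K\<close> the parameter
  interval is cut into short pieces: the image of a piece that meets \<open>K\<close> stays in a
  neighbourhood of \<open>K\<close> and is no longer than the piece. Shrinking the neighbourhood
  settles compact sets, inner regularity settles Borel sets. The map may be constant on intervals,
  so it cannot simply be inverted.\<close>

lemma emeasure_Lipschitz_vimage_ge:
  fixes s :: "real \<Rightarrow> real"
  assumes "mono s" and lip: "\<And>x y. \<bar>s x - s y\<bar> \<le> \<bar>x - y\<bar>" and "0 \<le> l"
    and A: "A \<in> sets borel"
  shows "emeasure lborel (A \<inter> {s 0..s l}) \<le> emeasure lborel (s -` A \<inter> {0..l})"
proof -
  have cont: "continuous_on UNIV s"
    by (rule lipschitz_on_continuous_on[of 1], rule lipschitz_onI) (use lip in \<open>auto simp: dist_real_def\<close>)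
  have [measurable]: "s \<in> borel_measurable borel" by (rule borel_measurable_continuous_onI[OF cont])
  have cpt: "emeasure lborel K \<le> emeasure lborel (s -` K \<inter> {0..l})"
    if K: "compact K" "K \<subseteq> {s 0..s l}" for K
  proof (cases "K = {}")
    case False
    have [measurable]: "K \<in> sets borel" using K by (auto intro: borel_compact)
    define V where "V n = {x. infdist x K < 1 / real (Suc n)}" for n
    have [measurable]: "V n \<in> sets borel" for n
      unfolding V_def by (intro borel_open open_Collect_less continuous_intros)
    have V_anti: "V n \<subseteq> V m" if "m \<le> n" for m n
    proof
      fix x assume "x \<in> V n"
      moreover have "1 / real (Suc n) \<le> 1 / real (Suc m)" using that by (intro divide_left_mono) auto
      ultimately show "x \<in> V m" by (simp add: V_def)
    qed
    have le: "emeasure lborel K \<le> emeasure lborel (s -` V n \<inter> {0..l})" for n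
    proof -
      have "(\<integral>\<^sup>+x\<in>{s 0..s l}. indicator K x \<partial>lborel) \<le> (\<integral>\<^sup>+x\<in>{0..l}. indicator (V n) (s x) \<partial>lborel)"
      proof (rule interval_chain[where \<Phi>="\<lambda>a b. \<integral>\<^sup>+x\<in>{s a..s b}. indicator K x \<partial>lborel" and
            \<Psi>="\<lambda>a b. \<integral>\<^sup>+x\<in>{a..b}. indicator (V n) (s x) \<partial>lborel" and d="1/real (Suc n)"])
        fix a b assume ab: "a \<le> b" "b - a < 1 / real (Suc n)"
        show "(\<integral>\<^sup>+x\<in>{s a..s b}. indicator K x \<partial>lborel) \<le> (\<integral>\<^sup>+x\<in>{a..b}. indicator (V n) (s x) \<partial>lborel)"
        proof (cases "K \<inter> {s a..s b} = {}")
          case True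
          then have "(\<integral>\<^sup>+x\<in>{s a..s b}. indicator K x \<partial>lborel) = (\<integral>\<^sup>+x. 0 \<partial>(lborel :: real measure))"
            by (intro nn_integral_cong) (auto split: split_indicator)
          then show ?thesis by simp
        next
          case False
          then obtain k where k: "k \<in> K" "s a \<le> k" "k \<le> s b" by auto
          have "s x \<in> V n" if "x \<in> {a..b}" for x
          proof -
            have "s a \<le> s x" "s x \<le> s b" using \<open>mono s\<close> that by (auto simp: mono_def)
            then have "dist (s x) k \<le> b - a"
              using k lip[of a b] ab by (auto simp: dist_real_def)
            then show ?thesis using infdist_le2[OF k(1)] ab by (force simp: V_def)
          qed
          then have V: "(\<integral>\<^sup>+x\<in>{a..b}. indicator (V n) (s x) \<partial>lborel) = (\<integral>\<^sup>+x\<in>{a..b}. 1 \<partial>lborel)"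
            by (intro nn_integral_cong) (auto split: split_indicator)
          have "(\<integral>\<^sup>+x\<in>{s a..s b}. indicator K x \<partial>lborel) \<le> (\<integral>\<^sup>+x\<in>{s a..s b}. 1 \<partial>lborel)"
            by (intro nn_integral_mono) (auto split: split_indicator)
          also have "\<dots> = ennreal (s b - s a)"
            using \<open>mono s\<close> ab by (simp add: mono_def)
          also have "\<dots> \<le> ennreal (b - a)"
            using lip[of a b] ab by (intro ennreal_leI) auto
          also have "\<dots> = (\<integral>\<^sup>+x\<in>{a..b}. indicator (V n) (s x) \<partial>lborel)"
            using ab by (simp add: V)
          finally show ?thesis .
        qed
      qed (use assms in \<open>auto simp: nn_integral_Icc_add mono_def\<close>)
      also have "(\<integral>\<^sup>+x\<in>{0..l}. indicator (V n) (s x) \<partial>lborel) = (\<integral>\<^sup>+x. indicator (s -` V n \<inter> {0..l}) x \<partial>lborel)"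
        by (intro nn_integral_cong) (auto split: split_indicator)
      also have "\<dots> = emeasure lborel (s -` V n \<inter> {0..l})"
        using measurable_sets[of s borel borel "V n"] by (intro nn_integral_indicator) auto
      also have "(\<integral>\<^sup>+x\<in>{s 0..s l}. indicator K x \<partial>lborel) = (\<integral>\<^sup>+x. indicator K x \<partial>lborel)"
        using K by (intro nn_integral_cong) (auto split: split_indicator)
      also have "\<dots> = emeasure lborel K" by simp
      finally show ?thesis .
    qed
    have "(\<lambda>n. emeasure lborel (s -` V n \<inter> {0..l})) \<longlonglongrightarrow> emeasure lborel (\<Inter>n. s -` V n \<inter> {0..l})"
    proof (intro Lim_emeasure_decseq)
      show "range (\<lambda>n. s -` V n \<inter> {0..l}) \<subseteq> sets lborel"
        using measurable_sets[of s borel borel "V _"] by auto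
      show "decseq (\<lambda>n. s -` V n \<inter> {0..l})"
        using V_anti by (fastforce simp: decseq_def)
      show "emeasure lborel (s -` V i \<inter> {0..l}) \<noteq> \<infinity>" for i
      proof -
        have "emeasure lborel (s -` V i \<inter> {0..l}) \<le> emeasure lborel {0..l}" by (intro emeasure_mono) auto
        then show ?thesis using \<open>0 \<le> l\<close> by (auto simp: top_unique)
      qed
    qed
    moreover have "(\<Inter>n. s -` V n \<inter> {0..l}) = s -` K \<inter> {0..l}"
    proof (intro subset_antisym subsetI)
      fix x assume x: "x \<in> (\<Inter>n. s -` V n \<inter> {0..l})"
      have "infdist (s x) K \<le> 0"
      proof (rule ccontr)
        assume "\<not> infdist (s x) K \<le> 0"
        then obtain n where "1 / real (Suc n) < infdist (s x) K"
          using reals_Archimedean[of "infdist (s x) K"] by (auto simp: inverse_eq_divide)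
        moreover have "s x \<in> V n" using x by auto
        ultimately show False by (simp add: V_def)
      qed
      then have "infdist (s x) K = 0" using infdist_nonneg[of "s x" K] by linarith
      then have "s x \<in> K" using in_closed_iff_infdist_zero[of K] K False compact_imp_closed by blast
      then show "x \<in> s -` K \<inter> {0..l}" using x by auto
    qed (auto simp: V_def)
    ultimately show ?thesis using le by (intro LIMSEQ_le_const) auto
  qed simp
  define N where "N = density lborel (indicator {s 0..s l} :: real \<Rightarrow> ennreal)"
  have emN: "emeasure N B = emeasure lborel (B \<inter> {s 0..s l})" if "B \<in> sets borel" for B
    unfolding N_def using that
    by (subst emeasure_density) (auto simp flip: nn_integral_indicator indicator_inter_arith simp: Int_commute intro!: nn_integral_cong split: split_indicator)
  show ?thesis
  proof (rule ennreal_le_epsilon)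
    fix e :: real assume "0 < e"
    \<comment> \<open>Lebesgue measure restricted to the image interval is finite, so closed subsets
      of \<open>A\<close> approximate it, and their traces on the interval are compact.\<close>
    have "\<exists>C U. closed C \<and> open U \<and> C \<subseteq> A \<and> A \<subseteq> U \<and> emeasure N (U - C) < ennreal e"
      using \<open>0 < e\<close> A by (intro finite_borel_closed_open_approx) (use \<open>mono s\<close> \<open>0 \<le> l\<close> in \<open>simp_all add: emN monoD\<close>, simp add: N_def)
    then obtain C U where CU: "closed C" "open U" "C \<subseteq> A" "A \<subseteq> U" "emeasure N (U - C) < ennreal e" by blast
    have [measurable]: "C \<in> sets borel" "U \<in> sets borel" using CU by auto
    have "emeasure lborel (A \<inter> {s 0..s l}) \<le> emeasure lborel (C \<inter> {s 0..s l} \<union> (U - C) \<inter> {s 0..s l})"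
      using CU A by (intro emeasure_mono) auto
    also have "\<dots> \<le> emeasure lborel (C \<inter> {s 0..s l}) + emeasure lborel ((U - C) \<inter> {s 0..s l})"
      by (intro emeasure_subadditive) auto
    also have "\<dots> \<le> emeasure lborel (s -` A \<inter> {0..l}) + ennreal e"
    proof (intro add_mono)
      have "emeasure lborel (C \<inter> {s 0..s l}) \<le> emeasure lborel (s -` (C \<inter> {s 0..s l}) \<inter> {0..l})"
        using CU by (intro cpt) (auto intro: closed_Int_compact)
      also have "\<dots> \<le> emeasure lborel (s -` A \<inter> {0..l})"
        using CU measurable_sets[of s borel borel A] A by (intro emeasure_mono) auto
      finally show "emeasure lborel (C \<inter> {s 0..s l}) \<le> emeasure lborel (s -` A \<inter> {0..l})" .
      show "emeasure lborel ((U - C) \<inter> {s 0..s l}) \<le> ennreal e"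
        using CU(5) emN[of "U - C"] by auto
    qed
    finally show "emeasure lborel (A \<inter> {s 0..s l}) \<le> emeasure lborel (s -` A \<inter> {0..l}) + ennreal e" .
  qed
qed

text \<open>The estimate for sets says that Lebesgue measure on \<open>{s 0..s l}\<close> is
  dominated by the image under \<open>s\<close> of Lebesgue measure on \<open>{0..l}\<close>;
  integrals inherit this. In the application \<open>s\<close> is the length function of a path, and
  the inequality may be strict where the speed is below 1.\<close>

lemma nn_integral_Lipschitz_substitution_le:
  fixes s :: "real \<Rightarrow> real" and F :: "real \<Rightarrow> ennreal"
  assumes "mono s" and lip: "\<And>x y. \<bar>s x - s y\<bar> \<le> \<bar>x - y\<bar>" and "0 \<le> l"
    and F[measurable]: "F \<in> borel_measurable borel"
  shows "(\<integral>\<^sup>+x\<in>{s 0..s l}. F x \<partial>lborel) \<le> (\<integral>\<^sup>+x\<in>{0..l}. F (s x) \<partial>lborel)"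
proof -
  have cont: "continuous_on UNIV s"
    by (rule lipschitz_on_continuous_on[of 1], rule lipschitz_onI) (use lip in \<open>auto simp: dist_real_def\<close>)
  have [measurable]: "s \<in> borel_measurable borel" by (rule borel_measurable_continuous_onI[OF cont])
  define N1 where "N1 = density lborel (indicator {s 0..s l} :: real \<Rightarrow> ennreal)"
  define N2 where "N2 = distr (density lborel (indicator {0..l})) (borel :: real measure) s"
  have e1: "emeasure N1 B = emeasure lborel (B \<inter> {s 0..s l})" if "B \<in> sets borel" for B
    unfolding N1_def using that
    by (subst emeasure_density) (auto simp flip: nn_integral_indicator indicator_inter_arith simp: Int_commute intro!: nn_integral_cong split: split_indicator)
  have e2: "emeasure N2 B = emeasure lborel (s -` B \<inter> {0..l})" if B: "B \<in> sets borel" for B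
  proof -
    have "s -` B \<in> sets borel" using measurable_sets[of s borel borel B] B by auto
    then show ?thesis
      unfolding N2_def using B
      by (subst emeasure_distr, auto, subst emeasure_density)
        (auto simp flip: nn_integral_indicator indicator_inter_arith simp: Int_commute intro!: nn_integral_cong split: split_indicator)
  qed
  have "N1 \<le> N2"
    using e1 e2 emeasure_Lipschitz_vimage_ge[OF assms(1-3)]
    by (subst le_measure) (auto simp: N1_def N2_def le_fun_def emeasure_notin_sets intro!: le_funI)
  then have "nn_integral N1 F \<le> nn_integral N2 F"
    by (intro nn_integral_mono_measure) (auto simp: N1_def N2_def)
  moreover have "nn_integral N1 F = (\<integral>\<^sup>+x\<in>{s 0..s l}. F x \<partial>lborel)"
    unfolding N1_def by (subst nn_integral_density) (auto simp: mult.commute)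
  moreover have "nn_integral N2 F = (\<integral>\<^sup>+x\<in>{0..l}. F (s x) \<partial>lborel)"
    unfolding N2_def by (subst nn_integral_distr, simp, simp, subst nn_integral_density) (auto simp: mult.commute)
  ultimately show ?thesis by simp
qed

subsection \<open>Curves\<close>

text \<open>Paths live on the whole real line, so no domain has to be carried along; a path on an
  interval is extended by clamping the parameter. Pauses are allowed, which keeps the class closed
  under concatenation and pointwise limits.\<close>

definition lip1 :: "(real \<Rightarrow> 'a::metric_space) \<Rightarrow> bool" where
  "lip1 c \<longleftrightarrow> (\<forall>s t. dist (c s) (c t) \<le> \<bar>s - t\<bar>)"

text \<open>The integral is taken in the parameter, not in arc length. On a 1-Lipschitz path the
  parameter runs at least as fast as arc length, so a bound by an arc length integral implies one by
  this integral.\<close>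

definition path_integral :: "('a \<Rightarrow> ennreal) \<Rightarrow> (real \<Rightarrow> 'a) \<Rightarrow> real \<Rightarrow> real \<Rightarrow> ennreal" where
  "path_integral g c a b = (\<integral>\<^sup>+t\<in>{a..b}. g (c t) \<partial>lborel)"

lemma lip1D: "lip1 c \<Longrightarrow> dist (c s) (c t) \<le> \<bar>s - t\<bar>"
  by (simp add: lip1_def)

lemma lip1_continuous: "lip1 c \<Longrightarrow> continuous_on A c"
  by (rule lipschitz_on_continuous_on[of 1], rule lipschitz_onI) (auto simp: lip1_def dist_real_def)

lemma lip1_measurable [measurable_dest]: "lip1 c \<Longrightarrow> c \<in> borel_measurable borel"
  by (intro borel_measurable_continuous_onI lip1_continuous)

lemma lip1_compose:
  assumes "lip1 c" "\<And>s t. \<bar>\<phi> s - \<phi> t\<bar> \<le> \<bar>s - t\<bar>"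
  shows "lip1 (\<lambda>t. c (\<phi> t))"
  using assms unfolding lip1_def by (meson order_trans)

lemma clamp_nonexpansive: "\<bar>max a (min b s) - max a (min b t)\<bar> \<le> \<bar>s - t\<bar>" for a b s t :: real
  by (auto simp: max_def min_def)

lemma path_integral_mono:
  "(\<And>t. a \<le> t \<Longrightarrow> t \<le> b \<Longrightarrow> g (c t) \<le> h (c t)) \<Longrightarrow> path_integral g c a b \<le> path_integral h c a b"
  unfolding path_integral_def by (intro nn_integral_mono) (auto split: split_indicator)

lemma path_integral_cong:
  "(\<And>t. a \<le> t \<Longrightarrow> t \<le> b \<Longrightarrow> g (c t) = h (d t)) \<Longrightarrow> path_integral g c a b = path_integral h d a b"
  unfolding path_integral_def by (intro nn_integral_cong) (auto split: split_indicator)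

lemma path_integral_split:
  assumes "lip1 c" "g \<in> borel_measurable borel" "r \<le> s" "s \<le> t"
  shows "path_integral g c r s + path_integral g c s t = path_integral g c r t"
  unfolding path_integral_def
  using assms by (intro nn_integral_Icc_add) (auto intro: measurable_compose lip1_measurable)

lemma path_integral_subinterval:
  "a \<le> s \<Longrightarrow> t \<le> b \<Longrightarrow> path_integral g c s t \<le> path_integral g c a b"
  unfolding path_integral_def by (intro nn_integral_mono) (auto split: split_indicator)

lemma path_integral_shift:
  assumes "lip1 c" "g \<in> borel_measurable borel"
  shows "path_integral g (\<lambda>t. c (a + t)) r s = path_integral g c (a + r) (a + s)"
proof -
  have [measurable]: "(\<lambda>t. g (c t)) \<in> borel_measurable borel"
    using assms by (auto intro: measurable_compose lip1_measurable)
  show ?thesis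
    unfolding path_integral_def
    by (subst nn_integral_real_affine[of "\<lambda>t. g (c t) * indicator {a + r..a + s} t" 1 a])
      (auto intro!: nn_integral_cong split: split_indicator)
qed

lemma path_integral_reverse:
  assumes "lip1 c" "g \<in> borel_measurable borel"
  shows "path_integral g (\<lambda>t. c (a - t)) r s = path_integral g c (a - s) (a - r)"
proof -
  have [measurable]: "(\<lambda>t. g (c t)) \<in> borel_measurable borel"
    using assms by (auto intro: measurable_compose lip1_measurable)
  show ?thesis
    unfolding path_integral_def
    by (subst nn_integral_real_affine[of "\<lambda>t. g (c t) * indicator {a - s..a - r} t" "-1" a])
      (auto intro!: nn_integral_cong split: split_indicator)
qed

lemma path_integral_add:
  assumes "lip1 c" "g \<in> borel_measurable borel" "h \<in> borel_measurable borel"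
  shows "path_integral (\<lambda>x. g x + h x) c a b = path_integral g c a b + path_integral h c a b"
proof -
  have [measurable]: "(\<lambda>t. g (c t)) \<in> borel_measurable borel" "(\<lambda>t. h (c t)) \<in> borel_measurable borel"
    using assms by (auto intro: measurable_compose lip1_measurable)
  show ?thesis
    unfolding path_integral_def by (subst nn_integral_add[symmetric]) (auto simp: distrib_right)
qed

lemma path_integral_cmult:
  assumes "lip1 c" "g \<in> borel_measurable borel"
  shows "path_integral (\<lambda>x. k * g x) c a b = k * path_integral g c a b"
proof -
  have [measurable]: "(\<lambda>t. g (c t)) \<in> borel_measurable borel"
    using assms by (auto intro: measurable_compose lip1_measurable)
  show ?thesis
    unfolding path_integral_def by (subst nn_integral_cmult[symmetric]) (auto simp: mult.assoc)
qed

lemma path_integral_const: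
  "a \<le> b \<Longrightarrow> path_integral (\<lambda>x. k) c a b = k * ennreal (b - a)"
  unfolding path_integral_def by (subst nn_integral_cmult_indicator) auto

lemma line_integral_eq_path_integral:
  assumes "lip1 c" "g \<in> borel_measurable borel"
  shows "line_integral g c l = path_integral g c 0 l"
proof -
  have [measurable]: "(\<lambda>t. g (c t)) \<in> borel_measurable borel"
    using assms by (auto intro: measurable_compose lip1_measurable)
  show ?thesis
    unfolding line_integral_def path_integral_def
    by (subst nn_integral_restrict_space) (auto simp: nn_integral_completion)
qed

lemma line_integral_cong:
  "(\<And>t. 0 \<le> t \<Longrightarrow> t \<le> l \<Longrightarrow> g (c t) = g (d t)) \<Longrightarrow> line_integral g c l = line_integral g d l"
  unfolding line_integral_def by (intro nn_integral_cong) auto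

lemma line_measurable_borel:
  assumes "continuous_on {0..l} \<gamma>" "g \<in> borel_measurable borel"
  shows "line_measurable g \<gamma> l"
proof -
  have "(\<lambda>t. g (\<gamma> t)) \<in> borel_measurable (restrict_space borel {0..l})"
    using borel_measurable_continuous_on_restrict[OF assms(1)] assms(2) by (rule measurable_compose)
  then have *: "(\<lambda>t. g (\<gamma> t) * indicator {0..l} t) \<in> borel_measurable borel"
    by (subst (asm) borel_measurable_restrict_space_iff_ennreal) auto
  show ?thesis
    unfolding line_measurable_def
    by (subst borel_measurable_restrict_space_iff_ennreal) (use * in \<open>auto intro!: measurable_completion\<close>)
qed

section \<open>Length of curves and parametrization by arc length\<close>

lemma curve_length_leI:
  assumes "\<And>n t. mono_on {..n} t \<Longrightarrow> t ` {..n} \<subseteq> {a..b} \<Longrightarrow>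
    (\<Sum>i<n. ennreal (dist (\<gamma> (t i)) (\<gamma> (t (Suc i))))) \<le> X"
  shows "curve_length \<gamma> a b \<le> X"
  unfolding curve_length_def using assms by (intro SUP_least) auto

lemma curve_length_geI:
  assumes "mono_on {..n} t" "t ` {..n} \<subseteq> {a..b}"
  shows "(\<Sum>i<n. ennreal (dist (\<gamma> (t i)) (\<gamma> (t (Suc i))))) \<le> curve_length \<gamma> a b"
  unfolding curve_length_def by (rule SUP_upper2[of "(n, t)"]) (use assms in auto)

lemma curve_length_add_step:
  assumes "a \<le> b" "b \<le> c"
  shows "curve_length \<gamma> a b + ennreal (dist (\<gamma> b) (\<gamma> c)) \<le> curve_length \<gamma> a c"
proof -
  have "curve_length \<gamma> a b + ennreal (dist (\<gamma> b) (\<gamma> c)) =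
    (SUP (n, t) \<in> {(n::nat, t::nat \<Rightarrow> real). mono_on {..n} t \<and> t ` {..n} \<subseteq> {a..b}}.
      (\<Sum>i<n. ennreal (dist (\<gamma> (t i)) (\<gamma> (t (Suc i))))) + ennreal (dist (\<gamma> b) (\<gamma> c)))"
  proof -
    have "{(n::nat, t::nat \<Rightarrow> real). mono_on {..n} t \<and> t ` {..n} \<subseteq> {a..b}} \<noteq> {}"
      using assms by (auto simp: mono_on_def intro!: exI[of _ 0] exI[of _ "\<lambda>_. a"])
    then show ?thesis
      unfolding curve_length_def case_prod_beta by (rule ennreal_SUP_add_left[symmetric])
  qed
  also have "\<dots> \<le> curve_length \<gamma> a c"
  proof -
    have *: "(\<Sum>i<n. ennreal (dist (\<gamma> (t i)) (\<gamma> (t (Suc i))))) + ennreal (dist (\<gamma> b) (\<gamma> c))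
      \<le> curve_length \<gamma> a c" if t: "mono_on {..n} t" "t ` {..n} \<subseteq> {a..b}" for n and t :: "nat \<Rightarrow> real"
    proof -
    \<comment> \<open>The points of a partition need not reach \<open>b\<close>, so both
      \<open>b\<close> and \<open>c\<close> are appended, and the step from \<open>t n\<close> to
      \<open>b\<close> is dropped from the sum.\<close>
    define t' where "t' i = (if i \<le> n then t i else if i = Suc n then b else c)" for i
    have tr: "a \<le> t i" "t i \<le> b" "t i \<le> c" if "i \<le> n" for i
    proof -
      have "t i \<in> {a..b}" using t(2) that by blast
      then show "a \<le> t i" "t i \<le> b" "t i \<le> c" using assms by auto
    qed
    have m: "mono_on {..Suc (Suc n)} t'"
      using t(1) tr assms by (auto simp: mono_on_def t'_def)
    have r: "t' ` {..Suc (Suc n)} \<subseteq> {a..c}"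
      using tr assms by (auto simp: t'_def)
    have "(\<Sum>i<n. ennreal (dist (\<gamma> (t i)) (\<gamma> (t (Suc i))))) = (\<Sum>i<n. ennreal (dist (\<gamma> (t' i)) (\<gamma> (t' (Suc i)))))"
      by (intro sum.cong) (auto simp: t'_def)
    then have "(\<Sum>i<n. ennreal (dist (\<gamma> (t i)) (\<gamma> (t (Suc i))))) + ennreal (dist (\<gamma> b) (\<gamma> c))
      \<le> (\<Sum>i<Suc (Suc n). ennreal (dist (\<gamma> (t' i)) (\<gamma> (t' (Suc i)))))"
      by (simp add: t'_def add_right_mono)
    also have "\<dots> \<le> curve_length \<gamma> a c" by (rule curve_length_geI[OF m r])
    finally show ?thesis .
    qed
    show ?thesis by (rule SUP_least) (use * in \<open>simp add: split_beta\<close>)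
  qed
  finally show ?thesis .
qed

lemma telescope_le:
  fixes x :: "nat \<Rightarrow> real"
  assumes "\<And>i. i < n \<Longrightarrow> dist (\<gamma> i) (\<gamma> (Suc i)) \<le> x (Suc i) - x i"
  shows "(\<Sum>i<n. ennreal (dist (\<gamma> i) (\<gamma> (Suc i)))) \<le> ennreal (x n - x 0)"
proof -
  have "(\<Sum>i<n. ennreal (dist (\<gamma> i) (\<gamma> (Suc i)))) = ennreal (\<Sum>i<n. dist (\<gamma> i) (\<gamma> (Suc i)))"
    by (rule sum_ennreal) auto
  also have "\<dots> \<le> ennreal (\<Sum>i<n. x (Suc i) - x i)"
    using assms by (intro ennreal_leI sum_mono) auto
  also have "(\<Sum>i<n. x (Suc i) - x i) = x n - x 0" by (rule sum_lessThan_telescope)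
  finally show ?thesis .
qed

text \<open>The part of a partition below \<open>s\<close> gives a sum bounded by the length up to
  \<open>s\<close>, the part above telescopes by the Lipschitz bound, and a step across
  \<open>s\<close> is split by the triangle inequality. With \<open>curve_length_add_step\<close> it
  follows that the length function of a path is monotone, 1-Lipschitz and controls distances along
  the path.\<close>

lemma curve_length_lip1_add:
  assumes "lip1 c" "a \<le> s" "s \<le> t"
  shows "curve_length c a t \<le> curve_length c a s + ennreal (t - s)"
proof (rule curve_length_leI)
  fix n and r :: "nat \<Rightarrow> real" assume r: "mono_on {..n} r" "r ` {..n} \<subseteq> {a..t}"
  define m where "m i = min (r i) s" for i
  define x where "x i = max (r i) s" for i
  have st: "dist (c (r i)) (c (r (Suc i))) \<le> dist (c (m i)) (c (m (Suc i))) + (x (Suc i) - x i)" if "i < n" for i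
  proof -
    have le: "r i \<le> r (Suc i)" using r(1) that by (auto simp: mono_on_def)
    consider "r (Suc i) \<le> s" | "s \<le> r i" | "r i \<le> s" "s \<le> r (Suc i)" by linarith
    then show ?thesis
    proof cases
      case 3
      have "dist (c (r i)) (c (r (Suc i))) \<le> dist (c (r i)) (c s) + dist (c s) (c (r (Suc i)))" by (rule dist_triangle)
      also have "\<dots> \<le> dist (c (r i)) (c s) + (r (Suc i) - s)" using lip1D[OF assms(1), of s "r (Suc i)"] 3 by auto
      finally show ?thesis using 3 by (simp add: m_def x_def min_absorb1 min_absorb2 max_absorb1 max_absorb2)
    qed (use lip1D[OF assms(1), of "r i" "r (Suc i)"] le in \<open>auto simp: m_def x_def\<close>)
  qed
  have xm: "x i \<le> x (Suc i)" if "i < n" for i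
  proof -
    have "r i \<le> r (Suc i)" using r(1) that by (auto simp: mono_on_def)
    then show ?thesis by (auto simp: x_def)
  qed
  have "(\<Sum>i<n. ennreal (dist (c (r i)) (c (r (Suc i))))) \<le>
      (\<Sum>i<n. ennreal (dist (c (m i)) (c (m (Suc i)))) + ennreal (x (Suc i) - x i))"
    using st xm by (intro sum_mono) (auto simp flip: ennreal_plus intro: ennreal_leI)
  also have "\<dots> = (\<Sum>i<n. ennreal (dist (c (m i)) (c (m (Suc i))))) + (\<Sum>i<n. ennreal (x (Suc i) - x i))"
    by (rule sum.distrib)
  also have "\<dots> \<le> curve_length c a s + ennreal (t - s)"
  proof (intro add_mono)
    show "(\<Sum>i<n. ennreal (dist (c (m i)) (c (m (Suc i))))) \<le> curve_length c a s"
      using r assms by (intro curve_length_geI) (auto simp: mono_on_def m_def image_subset_iff min_le_iff_disj)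
    have "(\<Sum>i<n. ennreal (x (Suc i) - x i)) = ennreal (\<Sum>i<n. x (Suc i) - x i)"
      using xm by (intro sum_ennreal) auto
    also have "(\<Sum>i<n. x (Suc i) - x i) = x n - x 0" by (rule sum_lessThan_telescope)
    also have "x n - x 0 \<le> t - s"
    proof -
      have "r n \<le> t" using r(2) by auto
      then show ?thesis using assms(3) by (auto simp: x_def)
    qed
    finally show "(\<Sum>i<n. ennreal (x (Suc i) - x i)) \<le> ennreal (t - s)" by (simp add: ennreal_leI)
  qed
  finally show "(\<Sum>i<n. ennreal (dist (c (r i)) (c (r (Suc i))))) \<le> curve_length c a s + ennreal (t - s)" .
qed

lemma curve_length_same [simp]: "curve_length \<gamma> a a = 0"
proof -
  have "curve_length \<gamma> a a \<le> 0"
  proof (rule curve_length_leI)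
    fix n and t :: "nat \<Rightarrow> real" assume "mono_on {..n} t" "t ` {..n} \<subseteq> {a..a}"
    then have "t i = a" if "i \<le> n" for i using that by (auto simp: image_subset_iff)
    then show "(\<Sum>i<n. ennreal (dist (\<gamma> (t i)) (\<gamma> (t (Suc i))))) \<le> 0" by simp
  qed
  then show ?thesis by simp
qed

text \<open>The distance of two points of the curve is at most the length between them, which is the
  difference of the times; holding the end points fixed outside \<open>[0, l]\<close> gives a path
  on the whole line.\<close>

lemma arc_length_curve_clamp:
  assumes "arc_length_curve \<gamma> l"
  shows "lip1 (\<lambda>t. \<gamma> (max 0 (min l t)))"
proof -
  have *: "dist (\<gamma> s) (\<gamma> t) \<le> t - s" if "0 \<le> s" "s \<le> t" "t \<le> l" for s t
  proof -
    have "ennreal s + ennreal (dist (\<gamma> s) (\<gamma> t)) \<le> ennreal t"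
      using curve_length_add_step[of 0 s t \<gamma>] assms that by (auto simp: arc_length_curve_def)
    then have "s + dist (\<gamma> s) (\<gamma> t) \<le> t" using that by (simp flip: ennreal_plus)
    then show ?thesis by simp
  qed
  have "0 < l" using assms by (simp add: arc_length_curve_def)
  have **: "dist (\<gamma> s) (\<gamma> t) \<le> \<bar>s - t\<bar>" if "s \<in> {0..l}" "t \<in> {0..l}" for s t
    using *[of s t] *[of t s] that by (cases "s \<le> t") (auto simp: dist_commute)
  show ?thesis
    unfolding lip1_def
  proof (intro allI)
    fix s t
    have "dist (\<gamma> (max 0 (min l s))) (\<gamma> (max 0 (min l t))) \<le> \<bar>max 0 (min l s) - max 0 (min l t)\<bar>"
      using \<open>0 < l\<close> by (intro **) auto
    also have "\<dots> \<le> \<bar>s - t\<bar>" by (rule clamp_nonexpansive)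
    finally show "dist (\<gamma> (max 0 (min l s))) (\<gamma> (max 0 (min l t))) \<le> \<bar>s - t\<bar>" .
  qed
qed

text \<open>This carries information about arc length curves over to arbitrary 1-Lipschitz paths.
  The length function is only nondecreasing, but the path is constant wherever the length is, so any
  choice of preimages gives the same curve. Distinct end points make the total length positive, as
  arc length curves are nonconstant.\<close>

lemma arc_length_reparametrization:
  assumes c: "lip1 c" and "0 \<le> l" "c 0 \<noteq> c l"
  shows "\<exists>\<gamma> L. arc_length_curve \<gamma> L \<and> \<gamma> 0 = c 0 \<and> \<gamma> L = c l \<and>
    (\<forall>g\<in>borel_measurable borel. line_integral g \<gamma> L \<le> path_integral g c 0 l)"
proof -
  define s where "s t = enn2real (curve_length c 0 t)" for t
  have fin: "curve_length c 0 t \<noteq> \<infinity>" if "0 \<le> t" for t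
    using curve_length_lip1_add[OF c, of 0 0 t] that by (auto simp: top_unique)
  then have s: "curve_length c 0 t = ennreal (s t)" if "0 \<le> t" for t
    using that unfolding s_def by (intro ennreal_enn2real[symmetric]) (auto simp: less_top)
  have s_nonneg: "0 \<le> s t" for t by (simp add: s_def)
  have s0: "s 0 = 0" by (simp add: s_def)
  have up: "s b \<le> s a + (b - a)" if "0 \<le> a" "a \<le> b" for a b
  proof -
    have "ennreal (s b) \<le> ennreal (s a + (b - a))"
      using curve_length_lip1_add[OF c, of 0 a b] that s[of a] s[of b] s_nonneg[of a] by (simp flip: ennreal_plus)
    then show ?thesis using that s_nonneg[of a] by (subst (asm) ennreal_le_iff) auto
  qed
  have low: "s a + dist (c a) (c b) \<le> s b" if "0 \<le> a" "a \<le> b" for a b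
  proof -
    have "ennreal (s a + dist (c a) (c b)) \<le> ennreal (s b)"
      using curve_length_add_step[of 0 a b c] that s[of a] s[of b] s_nonneg[of a] by (simp flip: ennreal_plus)
    then show ?thesis using s_nonneg[of b] by (subst (asm) ennreal_le_iff) auto
  qed
  \<comment> \<open>The length function clamped to \<open>[0, l]\<close> is monotone and 1-Lipschitz
    on the whole line, the form in which the change of variables is stated.\<close>
  define k where "k t = s (max 0 (min l t))" for t
  have k_eq: "k t = s t" if "t \<in> {0..l}" for t using that by (simp add: k_def)
  have mono_s: "s a \<le> s b" if "0 \<le> a" "a \<le> b" for a b
    using low[OF that] zero_le_dist[of "c a" "c b"] by linarith
  have "mono k" unfolding k_def mono_def by (auto intro!: mono_s)
  have k_lip: "\<bar>k x - k y\<bar> \<le> \<bar>x - y\<bar>" for x y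
  proof -
    have *: "\<bar>s a - s b\<bar> \<le> \<bar>a - b\<bar>" if "0 \<le> a" "0 \<le> b" for a b
      using up[of a b] up[of b a] mono_s[of a b] mono_s[of b a] that by (cases "a \<le> b") auto
    show ?thesis unfolding k_def
      by (rule order_trans[OF *]) (auto intro: clamp_nonexpansive)
  qed
  have k_cont: "continuous_on A k" for A
    by (rule lipschitz_on_continuous_on[of 1], rule lipschitz_onI) (use k_lip in \<open>auto simp: dist_real_def\<close>)
  define L where "L = s l"
  have "0 < dist (c 0) (c l)" using assms by simp
  then have "0 < L" using low[of 0 l] \<open>0 \<le> l\<close> s0 unfolding L_def by linarith
  have "\<exists>t\<in>{0..l}. s t = \<sigma>" if "\<sigma> \<in> {0..L}" for \<sigma>
  proof -
    have "\<exists>t\<ge>0. t \<le> l \<and> k t = \<sigma>"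
      using that k_eq[of 0] k_eq[of l] s0 \<open>0 \<le> l\<close> by (intro IVT' k_cont) (auto simp: L_def)
    then show ?thesis using k_eq by auto
  qed
  \<comment> \<open>An arbitrary right inverse of the length function; preimages exist by the
    intermediate value theorem.\<close>
  then obtain \<tau> where \<tau>: "\<And>\<sigma>. \<sigma> \<in> {0..L} \<Longrightarrow> \<tau> \<sigma> \<in> {0..l} \<and> s (\<tau> \<sigma>) = \<sigma>" by metis
  define \<gamma> where "\<gamma> \<sigma> = c (\<tau> \<sigma>)" for \<sigma>
  have s_range: "s t \<in> {0..L}" if "t \<in> {0..l}" for t
    using that mono_s s_nonneg by (auto simp: L_def)
  have d: "dist (c a) (c b) \<le> \<bar>s a - s b\<bar>" if "0 \<le> a" "0 \<le> b" for a b
    using low[of a b] low[of b a] that by (cases "a \<le> b") (auto simp: dist_commute)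
  have \<gamma>s: "\<gamma> (s t) = c t" if "t \<in> {0..l}" for t
  proof -
    have "dist (c (\<tau> (s t))) (c t) \<le> \<bar>s (\<tau> (s t)) - s t\<bar>"
      using \<tau>[OF s_range[OF that]] that by (intro d) auto
    then show ?thesis using \<tau>[OF s_range[OF that]] by (simp add: \<gamma>_def)
  qed
  have \<gamma>_lip: "dist (\<gamma> x) (\<gamma> y) \<le> \<bar>x - y\<bar>" if "x \<in> {0..L}" "y \<in> {0..L}" for x y
    using d[of "\<tau> x" "\<tau> y"] \<tau>[OF that(1)] \<tau>[OF that(2)] by (simp add: \<gamma>_def)
  have \<gamma>_cont: "continuous_on {0..L} \<gamma>"
    by (rule lipschitz_on_continuous_on[of 1], rule lipschitz_onI) (use \<gamma>_lip in \<open>auto simp: dist_real_def\<close>)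
  have "curve_length \<gamma> 0 \<sigma> = ennreal \<sigma>" if \<sigma>: "\<sigma> \<in> {0..L}" for \<sigma>
  proof (rule antisym)
    show "curve_length \<gamma> 0 \<sigma> \<le> ennreal \<sigma>"
    proof (rule curve_length_leI)
      fix n and t :: "nat \<Rightarrow> real" assume t: "mono_on {..n} t" "t ` {..n} \<subseteq> {0..\<sigma>}"
      have tr: "t i \<in> {0..\<sigma>}" if "i \<le> n" for i using t(2) that by auto
      have "(\<Sum>i<n. ennreal (dist (\<gamma> (t i)) (\<gamma> (t (Suc i))))) \<le> ennreal (t n - t 0)"
      proof (rule telescope_le)
        fix i assume "i < n"
        then have "t i \<le> t (Suc i)" using t(1) by (auto simp: mono_on_def)
        then show "dist (\<gamma> (t i)) (\<gamma> (t (Suc i))) \<le> t (Suc i) - t i"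
          using \<gamma>_lip[of "t i" "t (Suc i)"] tr[of i] tr[of "Suc i"] \<open>i < n\<close> \<sigma> by auto
      qed
      also have "\<dots> \<le> ennreal \<sigma>" using tr[of n] tr[of 0] by (intro ennreal_leI) auto
      finally show "(\<Sum>i<n. ennreal (dist (\<gamma> (t i)) (\<gamma> (t (Suc i))))) \<le> ennreal \<sigma>" .
    qed
    \<comment> \<open>A partition up to \<open>\<tau> \<sigma>\<close> is carried by
      \<open>s\<close> to a partition of \<open>[0, \<sigma>]\<close> with the same points in space,
      so no length is lost.\<close>
    have \<tau>\<sigma>: "\<tau> \<sigma> \<in> {0..l}" "s (\<tau> \<sigma>) = \<sigma>" using \<tau>[OF \<sigma>] by auto
    then have "ennreal \<sigma> = curve_length c 0 (\<tau> \<sigma>)" using s by simp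
    also have "\<dots> \<le> curve_length \<gamma> 0 \<sigma>"
    proof (rule curve_length_leI)
      fix n and t :: "nat \<Rightarrow> real" assume t: "mono_on {..n} t" "t ` {..n} \<subseteq> {0..\<tau> \<sigma>}"
      have tr: "0 \<le> t i" "t i \<le> \<tau> \<sigma>" if "i \<le> n" for i using t(2) that by auto
      have tl: "t i \<in> {0..l}" if "i \<le> n" for i using tr[OF that] \<tau>\<sigma> by auto
      have "(\<Sum>i<n. ennreal (dist (c (t i)) (c (t (Suc i))))) = (\<Sum>i<n. ennreal (dist (\<gamma> (s (t i))) (\<gamma> (s (t (Suc i))))))"
        using tl by (intro sum.cong) (auto simp: \<gamma>s)
      also have "\<dots> \<le> curve_length \<gamma> 0 \<sigma>"
      proof (rule curve_length_geI)
        show "mono_on {..n} (\<lambda>i. s (t i))"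
          using t(1) tr by (auto simp: mono_on_def intro!: mono_s)
        show "(\<lambda>i. s (t i)) ` {..n} \<subseteq> {0..\<sigma>}"
          using tr mono_s[of _ "\<tau> \<sigma>"] s_nonneg \<tau>\<sigma>(2) by auto
      qed
      finally show "(\<Sum>i<n. ennreal (dist (c (t i)) (c (t (Suc i))))) \<le> curve_length \<gamma> 0 \<sigma>" .
    qed
    finally show "ennreal \<sigma> \<le> curve_length \<gamma> 0 \<sigma>" .
  qed
  then have arc: "arc_length_curve \<gamma> L"
    using \<open>0 < L\<close> \<gamma>_cont by (simp add: arc_length_curve_def)
  have ends: "\<gamma> 0 = c 0" "\<gamma> L = c l"
    using \<gamma>s[of 0] \<gamma>s[of l] s0 \<open>0 \<le> l\<close> by (auto simp: L_def)
  have "line_integral g \<gamma> L \<le> path_integral g c 0 l" if g: "g \<in> borel_measurable borel" for g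
  proof -
    let ?\<delta> = "\<lambda>t. \<gamma> (max 0 (min L t))"
    have \<delta>: "lip1 ?\<delta>" by (rule arc_length_curve_clamp[OF arc])
    have [measurable]: "(\<lambda>t. g (?\<delta> t)) \<in> borel_measurable borel"
      by (rule measurable_compose[OF lip1_measurable[OF \<delta>] g])
    have "line_integral g \<gamma> L = line_integral g ?\<delta> L"
      by (rule line_integral_cong) auto
    also have "\<dots> = path_integral g ?\<delta> 0 L" using \<delta> g by (rule line_integral_eq_path_integral)
    also have "\<dots> = (\<integral>\<^sup>+x\<in>{k 0..k l}. g (?\<delta> x) \<partial>lborel)"
      using k_eq[of 0] k_eq[of l] s0 \<open>0 \<le> l\<close> by (simp add: path_integral_def L_def)
    also have "\<dots> \<le> (\<integral>\<^sup>+t\<in>{0..l}. g (?\<delta> (k t)) \<partial>lborel)"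
      using \<open>mono k\<close> k_lip \<open>0 \<le> l\<close> by (rule nn_integral_Lipschitz_substitution_le) measurable
    also have "\<dots> = path_integral g c 0 l"
      unfolding path_integral_def
    proof (intro nn_integral_cong)
      fix t
      have "?\<delta> (k t) = c t" if "t \<in> {0..l}"
        using k_eq[OF that] s_range[OF that] \<gamma>s[OF that] by simp
      then show "g (?\<delta> (k t)) * indicator {0..l} t = g (c t) * indicator {0..l} t"
        by (auto split: split_indicator)
    qed
    finally show ?thesis .
  qed
  with arc ends show ?thesis by blast
qed

subsection \<open>Functions along a curve\<close>

text \<open>The set where \<open>g\<close> is the smaller integrand and the set where
  \<open>h\<close> is smaller are approximated from inside by disjoint closed sets \<open>C\<close>
  and \<open>D\<close>, the first one compact, hence at positive distance \<open>d\<close>. An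
  interval shorter than \<open>d\<close> misses one of them: if it misses \<open>D\<close> the bound
  by \<open>g\<close> is used, otherwise the bound by \<open>h\<close>. What is left of both sets
  has small mass, and \<open>interval_chain\<close> passes to the whole interval.\<close>

lemma abs_diff_le_nn_integral_min:
  fixes F :: "real \<Rightarrow> real" and g h :: "real \<Rightarrow> ennreal"
  assumes [measurable]: "g \<in> borel_measurable borel" "h \<in> borel_measurable borel"
    and "a \<le> b"
    and fin: "(\<integral>\<^sup>+t\<in>{a..b}. g t \<partial>lborel) < \<infinity>" "(\<integral>\<^sup>+t\<in>{a..b}. h t \<partial>lborel) < \<infinity>"
    and g: "\<And>s t. a \<le> s \<Longrightarrow> s \<le> t \<Longrightarrow> t \<le> b \<Longrightarrow> ennreal \<bar>F s - F t\<bar> \<le> (\<integral>\<^sup>+x\<in>{s..t}. g x \<partial>lborel)"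
    and h: "\<And>s t. a \<le> s \<Longrightarrow> s \<le> t \<Longrightarrow> t \<le> b \<Longrightarrow> ennreal \<bar>F s - F t\<bar> \<le> (\<integral>\<^sup>+x\<in>{s..t}. h x \<partial>lborel)"
  shows "ennreal \<bar>F a - F b\<bar> \<le> (\<integral>\<^sup>+t\<in>{a..b}. min (g t) (h t) \<partial>lborel)"
proof (rule ennreal_le_epsilon)
  fix e :: real assume "0 < e"
  \<comment> \<open>The finite measure in which the approximation error is counted; its density
    dominates either integrand.\<close>
  define N where "N = density lborel (\<lambda>t. (g t + h t) * indicator {a..b} t)"
  have em: "emeasure N B = (\<integral>\<^sup>+t. (g t + h t) * indicator {a..b} t * indicator B t \<partial>lborel)" if "B \<in> sets borel" for B
    unfolding N_def using that by (subst emeasure_density) auto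
  have N: "sets N = sets borel" by (simp add: N_def)
  have "emeasure N UNIV = (\<integral>\<^sup>+t\<in>{a..b}. g t \<partial>lborel) + (\<integral>\<^sup>+t\<in>{a..b}. h t \<partial>lborel)"
    by (subst em, simp, subst nn_integral_add[symmetric]) (auto simp: distrib_right)
  then have Nfin: "emeasure N UNIV \<noteq> \<infinity>" using fin by auto
  define A where "A = {t\<in>{a..b}. g t \<le> h t}"
  define B where "B = {t\<in>{a..b}. h t < g t}"
  have [measurable]: "A \<in> sets borel" "B \<in> sets borel" unfolding A_def B_def by measurable
  have "0 < e / 2" using \<open>0 < e\<close> by simp
  obtain C U where C: "closed C" "open U" "C \<subseteq> A" "A \<subseteq> U" "emeasure N (U - C) < ennreal (e/2)"
    using finite_borel_closed_open_approx[OF N Nfin \<open>A \<in> sets borel\<close> \<open>0 < e/2\<close>] by (elim exE conjE)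
  obtain D V where D: "closed D" "open V" "D \<subseteq> B" "B \<subseteq> V" "emeasure N (V - D) < ennreal (e/2)"
    using finite_borel_closed_open_approx[OF N Nfin \<open>B \<in> sets borel\<close> \<open>0 < e/2\<close>] by (elim exE conjE)
  have [measurable]: "C \<in> sets borel" "D \<in> sets borel" "U \<in> sets borel" "V \<in> sets borel" using C D by auto
  define R where "R = (A - C) \<union> (B - D)"
  have [measurable]: "R \<in> sets borel" unfolding R_def by measurable
  have "emeasure N R \<le> emeasure N (A - C) + emeasure N (B - D)"
    unfolding R_def by (intro emeasure_subadditive) (auto simp: N)
  also have "\<dots> \<le> emeasure N (U - C) + emeasure N (V - D)"
    using C D by (intro add_mono emeasure_mono) (auto simp: N)
  also have "\<dots> \<le> ennreal (e/2) + ennreal (e/2)" using C D by (intro add_mono less_imp_le)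
  also have "\<dots> = ennreal e" using \<open>0 < e\<close> by (simp flip: ennreal_plus)
  finally have NR: "emeasure N R \<le> ennreal e" .
  have "C \<subseteq> {a..b}" using C(3) by (auto simp: A_def)
  then have "compact C"
    using C(1,3) bounded_subset[of "{a..b}" C] by (auto simp: compact_eq_bounded_closed A_def)
  have AB: "A \<inter> B = {}" by (auto simp: A_def B_def)
  then have "C \<inter> D = {}" using C(3) D(3) by blast
  obtain d where d: "0 < d" "\<And>x y. x \<in> C \<Longrightarrow> y \<in> D \<Longrightarrow> d \<le> dist x y"
    using separate_compact_closed[OF \<open>compact C\<close> D(1) \<open>C \<inter> D = {}\<close>] by blast
  \<comment> \<open>The minimum plus an error supported on the exceptional set \<open>R\<close>,
    arranged such that \<open>g \<le> \<theta>\<close> off \<open>D\<close> and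
    \<open>h \<le> \<theta>\<close> off \<open>C\<close>.\<close>
  define \<theta> where "\<theta> t = min (g t) (h t) + (g t + h t) * indicator R t" for t
  have [measurable]: "\<theta> \<in> borel_measurable borel" unfolding \<theta>_def by measurable
  have g\<theta>: "g x \<le> \<theta> x" if "x \<in> {a..b}" "x \<notin> D" for x
  proof (cases "x \<in> A")
    case True
    then show ?thesis by (simp add: \<theta>_def A_def min_def add_increasing2)
  next
    case False
    then have "x \<in> R" using that by (auto simp: R_def A_def B_def)
    then show ?thesis by (simp add: \<theta>_def add_increasing add_increasing2)
  qed
  have h\<theta>: "h x \<le> \<theta> x" if "x \<in> {a..b}" "x \<notin> C" for x
  proof (cases "x \<in> B")
    case True
    then show ?thesis by (simp add: \<theta>_def B_def min_absorb2 less_imp_le add_increasing2)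
  next
    case False
    then have "x \<in> R" using that by (auto simp: R_def A_def B_def)
    then show ?thesis by (simp add: \<theta>_def add_increasing)
  qed
  have "ennreal \<bar>F a - F b\<bar> \<le> (\<integral>\<^sup>+t\<in>{a..b}. \<theta> t \<partial>lborel)"
  proof (rule interval_chain[where \<Phi>="\<lambda>s t. ennreal \<bar>F s - F t\<bar>" and d=d and
        \<Psi>="\<lambda>s t. \<integral>\<^sup>+x\<in>{s..t}. \<theta> x \<partial>lborel"])
    fix s t assume st: "a \<le> s" "s \<le> t" "t \<le> b" "t - s < d"
    show "ennreal \<bar>F s - F t\<bar> \<le> (\<integral>\<^sup>+x\<in>{s..t}. \<theta> x \<partial>lborel)"
    proof (cases "{s..t} \<inter> D = {}")
      case True
      then have "g x \<le> \<theta> x" if "x \<in> {s..t}" for x using that st by (intro g\<theta>) auto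
      then have "(\<integral>\<^sup>+x\<in>{s..t}. g x \<partial>lborel) \<le> (\<integral>\<^sup>+x\<in>{s..t}. \<theta> x \<partial>lborel)"
        by (intro nn_integral_mono) (auto split: split_indicator)
      with g[of s t] st show ?thesis by (meson order_trans)
    next
      case False
      then obtain y where y: "y \<in> D" "s \<le> y" "y \<le> t" by auto
      have "x \<notin> C" if "x \<in> {s..t}" for x
        using d(2)[of x y] y that st by (auto simp: dist_real_def)
      then have "h x \<le> \<theta> x" if "x \<in> {s..t}" for x using that st by (intro h\<theta>) auto
      then have "(\<integral>\<^sup>+x\<in>{s..t}. h x \<partial>lborel) \<le> (\<integral>\<^sup>+x\<in>{s..t}. \<theta> x \<partial>lborel)"
        by (intro nn_integral_mono) (auto split: split_indicator)
      with h[of s t] st show ?thesis by (meson order_trans)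
    qed
  next
    fix r s t
    show "ennreal \<bar>F r - F t\<bar> \<le> ennreal \<bar>F r - F s\<bar> + ennreal \<bar>F s - F t\<bar>"
      by (simp flip: ennreal_plus add: ennreal_leI)
  qed (use \<open>a \<le> b\<close> d in \<open>auto simp: nn_integral_Icc_add\<close>)
  also have "(\<integral>\<^sup>+t\<in>{a..b}. \<theta> t \<partial>lborel) = (\<integral>\<^sup>+t. min (g t) (h t) * indicator {a..b} t +
      (g t + h t) * indicator {a..b} t * indicator R t \<partial>lborel)"
    unfolding \<theta>_def by (intro nn_integral_cong) (auto split: split_indicator)
  also have "\<dots> = (\<integral>\<^sup>+t\<in>{a..b}. min (g t) (h t) \<partial>lborel) + emeasure N R"
    by (subst nn_integral_add) (auto simp: em)
  also have "\<dots> \<le> (\<integral>\<^sup>+t\<in>{a..b}. min (g t) (h t) \<partial>lborel) + ennreal e"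
    using NR by (intro add_mono) auto
  finally show "ennreal \<bar>F a - F b\<bar> \<le> (\<integral>\<^sup>+t\<in>{a..b}. min (g t) (h t) \<partial>lborel) + ennreal e" .
qed

text \<open>Up to the first and after the last time in \<open>Z\<close> the curve avoids \<open>Z\<close>, and \<open>w\<close> is zero at both of these times.\<close>

lemma abs_diff_le_nn_integral_off_zeros:
  fixes w :: "real \<Rightarrow> real" and k :: "real \<Rightarrow> ennreal"
  assumes "closed Z" "a \<le> b"
    and w0: "\<And>t. a \<le> t \<Longrightarrow> t \<le> b \<Longrightarrow> 0 \<le> w t" "\<And>t. t \<in> Z \<Longrightarrow> a \<le> t \<Longrightarrow> t \<le> b \<Longrightarrow> w t = 0"
    and k: "\<And>s t. a \<le> s \<Longrightarrow> s \<le> t \<Longrightarrow> t \<le> b \<Longrightarrow> {s<..<t} \<inter> Z = {} \<Longrightarrow>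
      ennreal \<bar>w s - w t\<bar> \<le> (\<integral>\<^sup>+x\<in>{s..t}. k x \<partial>lborel)"
  shows "ennreal \<bar>w a - w b\<bar> \<le> (\<integral>\<^sup>+x\<in>{a..b}. k x * indicator (- Z) x \<partial>lborel)"
proof -
  have off: "(\<integral>\<^sup>+x\<in>{s..t}. k x \<partial>lborel) \<le> (\<integral>\<^sup>+x\<in>{a..b}. k x * indicator (- Z) x \<partial>lborel)"
    if "a \<le> s" "t \<le> b" "{s<..<t} \<inter> Z = {}" for s t
  proof (intro nn_integral_mono_AE)
    \<comment> \<open>The end points of the interval may belong to \<open>Z\<close>; they form a
      null set.\<close>
    show "AE x in lborel. k x * indicator {s..t} x \<le> k x * indicator (- Z) x * indicator {a..b} x"
      using AE_lborel_singleton[of s] AE_lborel_singleton[of t]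
    proof eventually_elim
      case (elim x)
      then show ?case using that by (cases "x \<in> {s<..<t}") (auto split: split_indicator)
    qed
  qed
  show ?thesis
  proof (cases "{a..b} \<inter> Z = {}")
    case True
    then have *: "{a<..<b} \<inter> Z = {}" by (auto simp: disjoint_iff)
    show ?thesis using k[OF order_refl \<open>a \<le> b\<close> order_refl *] off[OF order_refl order_refl *] by (rule order_trans)
  next
    case False
    let ?S = "{a..b} \<inter> Z"
    have cS: "closed ?S" using \<open>closed Z\<close> by auto
    have bdd: "bdd_below ?S" "bdd_above ?S" by (auto intro: bdd_belowI[of _ a] bdd_aboveI[of _ b])
    have i: "Inf ?S \<in> ?S" by (rule closed_contains_Inf[OF False bdd(1) cS])
    have s: "Sup ?S \<in> ?S" by (rule closed_contains_Sup[OF False bdd(2) cS])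
    have e1: "{a<..<Inf ?S} \<inter> Z = {}"
    proof (rule ccontr)
      assume "{a<..<Inf ?S} \<inter> Z \<noteq> {}"
      then obtain x where "x \<in> Z" "a < x" "x < Inf ?S" by auto
      then show False using cInf_lower[of x ?S] bdd i by auto
    qed
    have e2: "{Sup ?S<..<b} \<inter> Z = {}"
    proof (rule ccontr)
      assume "{Sup ?S<..<b} \<inter> Z \<noteq> {}"
      then obtain x where "x \<in> Z" "Sup ?S < x" "x < b" by auto
      then show False using cSup_upper[of x ?S] bdd s by auto
    qed
    have "ennreal \<bar>w a - w (Inf ?S)\<bar> \<le> (\<integral>\<^sup>+x\<in>{a..b}. k x * indicator (- Z) x \<partial>lborel)"
      using k[of a "Inf ?S"] off[of a "Inf ?S"] i e1 by (auto intro: order_trans)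
    moreover have "w (Inf ?S) = 0" "w (Sup ?S) = 0" using i s w0(2) by auto
    moreover have "ennreal \<bar>w (Sup ?S) - w b\<bar> \<le> (\<integral>\<^sup>+x\<in>{a..b}. k x * indicator (- Z) x \<partial>lborel)"
      using k[of "Sup ?S" b] off[of "Sup ?S" b] s e2 by (auto intro: order_trans)
    ultimately have "ennreal (w a) \<le> (\<integral>\<^sup>+x\<in>{a..b}. k x * indicator (- Z) x \<partial>lborel)"
      "ennreal (w b) \<le> (\<integral>\<^sup>+x\<in>{a..b}. k x * indicator (- Z) x \<partial>lborel)"
      using w0(1)[of a] w0(1)[of b] \<open>a \<le> b\<close> by auto
    \<comment> \<open>Both values are nonnegative, so their difference is at most the larger one and
      the two bounds need not be added.\<close>
    moreover have "\<bar>w a - w b\<bar> \<le> max (w a) (w b)" using w0(1)[of a] w0(1)[of b] \<open>a \<le> b\<close> by auto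
    ultimately show ?thesis
      by (smt (verit, best) ennreal_leI order_trans)
  qed
qed

text \<open>The increments of \<open>F\<close> are dominated by those of the indefinite integral of
  \<open>g\<close>, which is continuous. It serves to show that the times at which one function lies
  below another form a closed set along a curve.\<close>

lemma continuous_on_of_abs_diff_le_nn_integral:
  fixes F :: "real \<Rightarrow> real" and g :: "real \<Rightarrow> ennreal"
  assumes [measurable]: "g \<in> borel_measurable borel"
    and fin: "(\<integral>\<^sup>+t\<in>{a..b}. g t \<partial>lborel) < \<infinity>"
    and g: "\<And>s t. a \<le> s \<Longrightarrow> s \<le> t \<Longrightarrow> t \<le> b \<Longrightarrow> ennreal \<bar>F s - F t\<bar> \<le> (\<integral>\<^sup>+x\<in>{s..t}. g x \<partial>lborel)"
  shows "continuous_on {a..b} F"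
proof -
  define G where "G t = enn2real (\<integral>\<^sup>+x\<in>{a..t}. g x \<partial>lborel)" for t
  have G0: "0 \<le> G t" for t by (simp add: G_def)
  have fin': "(\<integral>\<^sup>+x\<in>{s..t}. g x \<partial>lborel) < \<infinity>" if "a \<le> s" "t \<le> b" for s t
    using that by (intro le_less_trans[OF _ fin] nn_integral_mono) (auto split: split_indicator)
  have G: "(\<integral>\<^sup>+x\<in>{a..t}. g x \<partial>lborel) = ennreal (G t)" if "t \<le> b" for t
    using fin'[of a t] that unfolding G_def by (intro ennreal_enn2real[symmetric]) auto
  have le: "\<bar>F s - F t\<bar> \<le> \<bar>G s - G t\<bar>" if "s \<in> {a..b}" "t \<in> {a..b}" for s t
  proof -
    have *: "\<bar>F s - F t\<bar> \<le> G t - G s" if st: "a \<le> s" "s \<le> t" "t \<le> b" for s t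
    proof -
      obtain r where r: "(\<integral>\<^sup>+x\<in>{s..t}. g x \<partial>lborel) = ennreal r" "0 \<le> r"
        using fin'[OF st(1) st(3)] by (cases "\<integral>\<^sup>+x\<in>{s..t}. g x \<partial>lborel") auto
      have "ennreal (G s) + ennreal r = ennreal (G t)"
        using nn_integral_Icc_add[of g a s t] st G r by simp
      then have "G s + r = G t"
        using r G0[of s] G0[of t] by (simp flip: ennreal_plus)
      moreover have "\<bar>F s - F t\<bar> \<le> r" using g[OF st] r by simp
      ultimately show ?thesis by simp
    qed
    show ?thesis using *[of s t] *[of t s] that by (cases "s \<le> t") auto
  qed
  have "continuous_on {a..b} G"
  proof -
    have "set_integrable lborel {a..b} (\<lambda>x. enn2real (g x))"
      unfolding set_integrable_def
    proof (rule integrableI_bounded)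
      have "(\<integral>\<^sup>+ x. ennreal (norm (indicat_real {a..b} x *\<^sub>R enn2real (g x))) \<partial>lborel) \<le> (\<integral>\<^sup>+t\<in>{a..b}. g t \<partial>lborel)"
        by (intro nn_integral_mono) (auto split: split_indicator simp: ennreal_enn2real_if)
      also have "\<dots> < \<infinity>" by (rule fin)
      finally show "(\<integral>\<^sup>+ x. ennreal (norm (indicat_real {a..b} x *\<^sub>R enn2real (g x))) \<partial>lborel) < \<infinity>" .
    qed measurable
    then have "continuous_on {a..b} (\<lambda>t. integral {a..t} (\<lambda>x. enn2real (g x)))"
      by (intro indefinite_integral_continuous_1 set_borel_integral_eq_integral)
    moreover have "integral {a..t} (\<lambda>x. enn2real (g x)) = G t" if "t \<in> {a..b}" for t
    proof -
      have si: "set_integrable lborel {a..t} (\<lambda>x. enn2real (g x))"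
        by (rule set_integrable_subset[OF \<open>set_integrable lborel {a..b} _\<close>]) (use that in auto)
      \<comment> \<open>\<open>enn2real\<close> sends \<infinity> to 0; the real and the extended
        integral agree because \<open>g\<close> is finite almost everywhere on the interval.\<close>
      have AE: "AE x in lborel. x \<in> {a..b} \<longrightarrow> g x \<noteq> \<infinity>"
      proof -
        have "AE x in lborel. g x * indicator {a..b} x \<noteq> \<infinity>"
          using fin by (intro nn_integral_PInf_AE) auto
        then show ?thesis by eventually_elim auto
      qed
      have "integral {a..t} (\<lambda>x. enn2real (g x)) = (LINT x:{a..t}|lborel. enn2real (g x))"
        using set_borel_integral_eq_integral(2)[OF si] by simp
      also have "\<dots> = enn2real (\<integral>\<^sup>+x. ennreal (indicat_real {a..t} x *\<^sub>R enn2real (g x)) \<partial>lborel)"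
        unfolding set_lebesgue_integral_def by (intro integral_eq_nn_integral) auto
      also have "(\<integral>\<^sup>+x. ennreal (indicat_real {a..t} x *\<^sub>R enn2real (g x)) \<partial>lborel) = (\<integral>\<^sup>+x\<in>{a..t}. g x \<partial>lborel)"
        using AE by (intro nn_integral_cong_AE, eventually_elim) (use that in \<open>auto split: split_indicator simp: ennreal_enn2real_if\<close>)
      finally show ?thesis by (simp add: G_def)
    qed
    ultimately show ?thesis by (subst continuous_on_cong[OF refl]) auto
  qed
  then show ?thesis
    unfolding continuous_on_iff using le
    by (smt (verit, best) dist_real_def)
qed

subsection \<open>Lower semicontinuity and measures on locally complete spaces\<close>

lemma ennreal_rpow_top [simp]: "ennreal_rpow top p = top"
  by (simp add: ennreal_rpow_def)

lemma ennreal_rpow_ennreal: "0 \<le> x \<Longrightarrow> ennreal_rpow (ennreal x) p = ennreal (x powr p)"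
  by (simp add: ennreal_rpow_def)

lemma ennreal_rpow_0 [simp]: "ennreal_rpow 0 p = 0"
  by (simp add: ennreal_rpow_def)

lemma ennreal_rpow_1 [simp]: "ennreal_rpow 1 p = 1"
  by (simp add: ennreal_rpow_def)

lemma ennreal_rpow_mono: "0 < p \<Longrightarrow> a \<le> b \<Longrightarrow> ennreal_rpow a p \<le> ennreal_rpow b p"
  by (cases a; cases b) (auto simp: ennreal_rpow_ennreal top_unique intro!: ennreal_leI powr_mono2)

lemma ennreal_rpow_rpow:
  assumes "0 < p" "0 < q"
  shows "ennreal_rpow (ennreal_rpow a p) q = ennreal_rpow a (p * q)"
  by (cases a) (use assms in \<open>auto simp: ennreal_rpow_ennreal powr_powr\<close>)

lemma ennreal_rpow_one [simp]: "ennreal_rpow a 1 = a"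
  by (cases a) (auto simp: ennreal_rpow_ennreal)

lemma ennreal_rpow_inverse [simp]:
  assumes "0 < p"
  shows "ennreal_rpow (ennreal_rpow a p) (1 / p) = a" "ennreal_rpow (ennreal_rpow a (1 / p)) p = a"
  using assms by (simp_all add: ennreal_rpow_rpow)

lemma ennreal_rpow_le_iff:
  assumes "0 < p"
  shows "ennreal_rpow a p \<le> b \<longleftrightarrow> a \<le> ennreal_rpow b (1 / p)"
  using ennreal_rpow_mono[of "1 / p" "ennreal_rpow a p" b] ennreal_rpow_mono[of p a "ennreal_rpow b (1 / p)"] assms
  by auto

lemma ennreal_le_rpow_iff:
  assumes "0 < p"
  shows "b \<le> ennreal_rpow a p \<longleftrightarrow> ennreal_rpow b (1 / p) \<le> a"
  using ennreal_rpow_mono[of "1 / p" b "ennreal_rpow a p"] ennreal_rpow_mono[of p "ennreal_rpow b (1 / p)" a] assms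
  by auto

lemma ennreal_rpow_SUP:
  assumes "0 < p"
  shows "ennreal_rpow (SUP i\<in>I. f i) p = (SUP i\<in>I. ennreal_rpow (f i) p)"
proof (rule antisym)
  show "ennreal_rpow (SUP i\<in>I. f i) p \<le> (SUP i\<in>I. ennreal_rpow (f i) p)"
    unfolding ennreal_rpow_le_iff[OF assms]
    by (intro SUP_least, subst ennreal_rpow_le_iff[OF assms, symmetric]) (rule SUP_upper)
  show "(SUP i\<in>I. ennreal_rpow (f i) p) \<le> ennreal_rpow (SUP i\<in>I. f i) p"
    using assms by (intro SUP_least ennreal_rpow_mono SUP_upper)
qed

lemma ennreal_rpow_mult:
  assumes "0 < p" "0 \<le> c"
  shows "ennreal_rpow (ennreal c * a) p = ennreal (c powr p) * ennreal_rpow a p"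
proof (cases a)
  case (real r)
  then show ?thesis using assms by (simp add: ennreal_rpow_ennreal powr_mult flip: ennreal_mult)
next
  case top
  then show ?thesis using assms by (cases "c = 0") (auto simp: ennreal_mult_top)
qed

text \<open>Either \<open>b \<le> t * a\<close>, and the sum is at most \<open>(1 + t) * a\<close>,
  or \<open>a \<le> b / t\<close>, and it is at most \<open>(1 + 1 / t) * b\<close>. As
  \<open>t\<close> tends to 0 the coefficient of the first term tends to 1; the large coefficient of
  the second is affordable where \<open>b\<close> is a correction of tiny energy.\<close>

lemma ennreal_rpow_add_le:
  assumes "0 < p" "0 < t"
  shows "ennreal_rpow (a + b) p \<le> ennreal ((1 + t) powr p) * ennreal_rpow a p + ennreal ((1 + 1 / t) powr p) * ennreal_rpow b p"
proof (cases "b \<le> ennreal t * a")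
  case True
  have "a + b \<le> ennreal (1 + t) * a"
    using True assms by (simp add: distrib_right add_left_mono)
  then have "ennreal_rpow (a + b) p \<le> ennreal ((1 + t) powr p) * ennreal_rpow a p"
    using ennreal_rpow_mono[OF assms(1)] assms by (metis add_pos_pos ennreal_rpow_mult less_imp_le zero_less_one)
  then show ?thesis by (rule add_increasing2[OF zero_le])
next
  case False
  then have "ennreal (1/t) * (ennreal t * a) \<le> ennreal (1/t) * b" by (intro mult_left_mono) auto
  moreover have "ennreal (1/t) * (ennreal t * a) = a"
    using assms by (simp add: mult.assoc[symmetric] flip: ennreal_mult)
  ultimately have "a + b \<le> ennreal (1 + 1/t) * b"
    using assms by (simp add: distrib_right add.commute add_left_mono)
  then have "ennreal_rpow (a + b) p \<le> ennreal ((1 + 1/t) powr p) * ennreal_rpow b p"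
    using ennreal_rpow_mono[OF assms(1)] assms by (metis add_nonneg_nonneg ennreal_rpow_mult less_imp_le zero_le_divide_1_iff zero_less_one)
  then show ?thesis by (rule add_increasing[OF zero_le])
qed

lemma ennreal_rpow_measurable [measurable]: "(\<lambda>a. ennreal_rpow a p) \<in> borel_measurable borel"
  unfolding ennreal_rpow_def by measurable

section \<open>Lower semicontinuous functions\<close>

definition lsc :: "('a::topological_space \<Rightarrow> 'b::linorder) \<Rightarrow> bool" where
  "lsc f \<longleftrightarrow> (\<forall>t. open {x. t < f x})"

lemma lsc_measurable:
  fixes f :: "'a::topological_space \<Rightarrow> ennreal"
  shows "lsc f \<Longrightarrow> f \<in> borel_measurable borel"
  by (intro borel_measurableI_greater) (auto simp: lsc_def)

lemma lsc_SUP: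
  fixes f :: "'i \<Rightarrow> 'a::topological_space \<Rightarrow> 'b::{complete_linorder}"
  shows "(\<And>i. lsc (f i)) \<Longrightarrow> lsc (\<lambda>x. SUP i. f i x)"
  unfolding lsc_def less_SUP_iff by (auto intro: open_Collect_ex)

lemma lsc_max: "lsc f \<Longrightarrow> lsc g \<Longrightarrow> lsc (\<lambda>x. max (f x) (g x))"
  unfolding lsc_def less_max_iff_disj by (auto intro: open_Collect_disj)

lemma lsc_const: "lsc (\<lambda>x. c)"
  by (auto simp: lsc_def)

lemma lsc_indicator: "open U \<Longrightarrow> lsc (\<lambda>x. (c::ennreal) * indicator U x)"
  unfolding lsc_def
proof
  fix t :: ennreal assume "open U"
  have "{x. t < c * indicator U x} = (if t < c then U else {})" by (auto split: split_indicator)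
  then show "open {x. t < c * indicator U x}" using \<open>open U\<close> by simp
qed

lemma lsc_rpow:
  assumes "0 < p" "lsc f"
  shows "lsc (\<lambda>x. ennreal_rpow (f x) p)"
proof -
  have "t < ennreal_rpow (f x) p \<longleftrightarrow> ennreal_rpow t (1 / p) < f x" for t x
    using ennreal_rpow_le_iff[OF assms(1), of "f x" t] by (simp add: not_le[symmetric])
  then show ?thesis using assms(2) by (simp add: lsc_def)
qed

lemma exists_index_close_from_above:
  fixes A :: "nat \<Rightarrow> 'a set"
  assumes D: "D \<in> sets M" "emeasure M D < \<infinity>" and A: "\<And>n. A n \<in> sets M" "D \<subseteq> (\<Union>n. A n)" and "0 < e"
  obtains k :: nat where "emeasure M (D - (\<Union>n<k. A n)) < ennreal e"
proof -
  have fin: "emeasure M (D - S) \<noteq> \<infinity>" for S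
    using emeasure_mono[of "D - S" D M] D by (auto simp: top_unique)
  have "(\<lambda>k. emeasure M (D - (\<Union>n<k. A n))) \<longlonglongrightarrow> emeasure M (\<Inter>k. D - (\<Union>n<k. A n))"
    using D A fin by (intro Lim_emeasure_decseq) (auto simp: decseq_def)
  moreover have e: "(\<Inter>k. D - (\<Union>n<k. A n)) = {}" using A(2) by blast
  ultimately have "(\<lambda>k. emeasure M (D - (\<Union>n<k. A n))) \<longlonglongrightarrow> 0" unfolding e by simp
  then have "eventually (\<lambda>k. emeasure M (D - (\<Union>n<k. A n)) < ennreal e) sequentially"
    using \<open>0 < e\<close> by (intro order_tendstoD) auto
  then show ?thesis using that eventually_happens'[OF sequentially_bot] by blast
qed

lemma suminf_half_pow:
  fixes e :: real
  assumes "0 < e"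
  shows "(\<Sum>n. ennreal (e * (1/2) ^ Suc n)) = ennreal e"
proof -
  have "(\<lambda>n. e * (1/2) ^ Suc n) sums (e * 1)" by (intro sums_mult power_half_series)
  then show ?thesis using assms by (intro suminf_ennreal_eq) auto
qed

lemma nn_integral_SUP_le_suminf:
  fixes f :: "nat \<Rightarrow> 'a \<Rightarrow> ennreal"
  assumes "\<And>i. f i \<in> borel_measurable M"
  shows "(\<integral>\<^sup>+x. (SUP i. f i x) \<partial>M) \<le> (\<Sum>i. \<integral>\<^sup>+x. f i x \<partial>M)"
proof -
  have "(\<integral>\<^sup>+x. (SUP i. f i x) \<partial>M) \<le> (\<integral>\<^sup>+x. (\<Sum>i. f i x) \<partial>M)"
  proof (intro nn_integral_mono SUP_least)
    fix x i show "f i x \<le> (\<Sum>i. f i x)" using sum_le_suminf[of "\<lambda>i. f i x" "{i}"] by auto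
  qed
  also have "\<dots> = (\<Sum>i. \<integral>\<^sup>+x. f i x \<partial>M)" using assms by (rule nn_integral_suminf)
  finally show ?thesis .
qed

section \<open>Borel representatives, separability and regularity of the measure\<close>

locale capacity_space =
  fixes M :: "'a::metric_space measure" and p :: real
  assumes p: "1 \<le> p"
    and locally_complete: "\<And>x::'a. \<exists>S. x \<in> interior S \<and> complete S"
    and borel: "complete_borel_measure M"
    and ball_measure: "\<And>x r. 0 < r \<Longrightarrow> 0 < emeasure M (ball x r) \<and> emeasure M (ball x r) < \<infinity>"
begin

lemma p_pos: "0 < p" using p by simp

lemma obtain_N:
  obtains N :: "'a measure" where "sets N = sets borel" "M = completion N"
  using borel by (auto simp: complete_borel_measure_def)

lemma space_M [simp]: "space M = UNIV"
  using obtain_N by (metis sets_eq_imp_space_eq space_borel space_completion)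

lemma sets_M [measurable (raw)]: "A \<in> sets borel \<Longrightarrow> A \<in> sets M"
  using obtain_N by (metis sets_completionI_sets)

lemma borel_M: "f \<in> borel \<rightarrow>\<^sub>M L \<Longrightarrow> f \<in> M \<rightarrow>\<^sub>M L"
  by (rule measurable_mono[THEN subsetD, rotated -1]) (auto simp: sets_M)

lemma AE_obtain_borel_null:
  assumes "AE x in M. P x"
  obtains B where "B \<in> sets borel" "emeasure M B = 0" "\<And>x. x \<notin> B \<Longrightarrow> P x"
proof -
  obtain N :: "'a measure" where N: "sets N = sets borel" "M = completion N" by (rule obtain_N)
  have "AE x in N. P x" using assms AE_completion_iff[of P N] unfolding N(2) by blast
  then obtain B where "{x \<in> space N. \<not> P x} \<subseteq> B" "emeasure N B = 0" "B \<in> sets N" by (rule AE_E)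
  moreover have "space N = UNIV" using sets_eq_imp_space_eq[OF N(1)] by simp
  ultimately show ?thesis using N by (intro that[of B]) auto
qed

text \<open>Null sets can be visible along a curve, so almost everywhere equality is not enough: the
  Borel representative is set to \<infinity> on a Borel null set and then lies above
  \<open>f\<close> everywhere. Enlarging an upper gradient, or the weight of an exceptional family,
  preserves its defining property.\<close>

lemma borel_majorant:
  fixes f :: "'a \<Rightarrow> ennreal"
  assumes "f \<in> borel_measurable M"
  obtains g where "g \<in> borel_measurable borel" "\<And>x. f x \<le> g x" "AE x in M. f x = g x"
proof -
  obtain N :: "'a measure" where N: "sets N = sets borel" "M = completion N" by (rule obtain_N)
  obtain h where h: "h \<in> borel_measurable N" "AE x in N. f x = h x"
    using completion_ex_borel_measurable[of f N] assms unfolding N(2) by blast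
  have hb: "h \<in> borel_measurable borel" using h(1) measurable_cong_sets[OF N(1) refl] by blast
  have AE: "AE x in M. f x = h x" using AE_completion[OF h(2)] unfolding N(2) .
  then obtain B where B: "B \<in> sets borel" "emeasure M B = 0" "\<And>x. x \<notin> B \<Longrightarrow> f x = h x"
    by (rule AE_obtain_borel_null) blast
  define g where "g x = (if x \<in> B then \<infinity> else h x)" for x
  have "AE x in M. x \<notin> B" using B by (intro AE_not_in) (auto simp: null_sets_def sets_M)
  then have "AE x in M. f x = g x" by eventually_elim (auto simp: g_def B)
  moreover have "g \<in> borel_measurable borel" unfolding g_def using hb B(1) by measurable
  ultimately show ?thesis by (intro that[of g]) (auto simp: g_def B)
qed

lemma borel_superset:
  assumes "A \<in> sets M"
  obtains B where "B \<in> sets borel" "A \<subseteq> B" "AE x in M. x \<in> B \<longrightarrow> x \<in> A"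
proof -
  obtain g :: "'a \<Rightarrow> ennreal" where g: "g \<in> borel_measurable borel" "\<And>x. indicator A x \<le> g x" "AE x in M. indicator A x = g x"
    using borel_majorant[of "indicator A"] assms by auto
  have "AE x in M. x \<in> {x. 1 \<le> g x} \<longrightarrow> x \<in> A" using g(3) by eventually_elim (auto split: split_indicator_asm)
  moreover have "A \<subseteq> {x. 1 \<le> g x}"
  proof
    fix x assume "x \<in> A" then show "x \<in> {x. 1 \<le> g x}" using g(2)[of x] by simp
  qed
  moreover have "{x. 1 \<le> g x} \<in> sets borel" using g(1) by measurable
  ultimately show ?thesis by (intro that[of "{x. 1 \<le> g x}"])
qed

text \<open>A Borel superset and the finite measure that sends \<open>S\<close> to the mass of
  \<open>S \<inter> D\<close> reduce this to the regularity of finite Borel measures. The open set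
  contains all of \<open>A\<close>, but the excess is measured only inside \<open>D\<close>, as the
  total mass may be infinite.\<close>

lemma outer_open:
  assumes "A \<in> sets M" and D: "D \<in> sets borel" "emeasure M D < \<infinity>" and "0 < e"
  obtains U where "open U" "A \<subseteq> U" "emeasure M ((U - A) \<inter> D) < ennreal e"
proof -
  obtain N :: "'a measure" where N: "sets N = sets borel" "M = completion N" by (rule obtain_N)
  obtain B where B: "B \<in> sets borel" "A \<subseteq> B" "AE x in M. x \<in> B \<longrightarrow> x \<in> A" by (rule borel_superset[OF assms(1)])
  define ND where "ND = density N (indicator D)"
  have em: "emeasure ND S = emeasure M (S \<inter> D)" if S: "S \<in> sets borel" for S
  proof -
    have SD: "S \<in> sets N" "D \<in> sets N" using S D N(1) by auto
    then have "emeasure ND S = (\<integral>\<^sup>+x. indicator D x * indicator S x \<partial>N)"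
      unfolding ND_def by (intro emeasure_density borel_measurable_indicator)
    also have "\<dots> = (\<integral>\<^sup>+x. indicator (S \<inter> D) x \<partial>N)"
      by (intro nn_integral_cong) (auto split: split_indicator)
    also have "\<dots> = emeasure N (S \<inter> D)" using SD by (intro nn_integral_indicator) auto
    also have "\<dots> = emeasure M (S \<inter> D)" using S D N by (simp add: emeasure_completion)
    finally show ?thesis .
  qed
  have "sets ND = sets borel" by (simp add: ND_def N)
  moreover have "emeasure ND UNIV \<noteq> \<infinity>" using D by (simp add: em)
  ultimately have "\<exists>C U. closed C \<and> open U \<and> C \<subseteq> B \<and> B \<subseteq> U \<and> emeasure ND (U - C) < ennreal e"
    using B(1) \<open>0 < e\<close> by (rule finite_borel_closed_open_approx)
  then obtain C U where U: "closed C" "open U" "C \<subseteq> B" "B \<subseteq> U" "emeasure ND (U - C) < ennreal e"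
    by (elim exE conjE)
  have "emeasure M ((U - A) \<inter> D) = emeasure M ((U - B) \<inter> D)"
    using B U assms by (intro emeasure_eq_AE) (auto intro!: sets.Diff sets.Int sets_M)
  also have "\<dots> \<le> emeasure M ((U - C) \<inter> D)"
    using B U D by (intro emeasure_mono) (auto intro!: sets_M)
  also have "\<dots> < ennreal e" using U em[of "U - C"] by auto
  finally show ?thesis using U B by (intro that[of U]) auto
qed

lemma inner_closed:
  assumes "A \<in> sets M" and D: "D \<in> sets borel" "emeasure M D < \<infinity>" and "0 < e"
  obtains C where "closed C" "C \<subseteq> A" "emeasure M ((A - C) \<inter> D) < ennreal e"
proof -
  have "- A \<in> sets M" using sets.compl_sets[OF assms(1)] by (simp add: Compl_eq_Diff_UNIV)
  then obtain U where U: "open U" "- A \<subseteq> U" "emeasure M ((U - - A) \<inter> D) < ennreal e"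
    using outer_open assms by blast
  moreover have "A - - U = U - - A" by auto
  ultimately show ?thesis by (intro that[of "- U"]) auto
qed

text \<open>The balls of radius \<open>e / 2\<close> around the points of \<open>S\<close> are
  disjoint and have positive mass, while large balls have finite mass. So only finitely many centres
  in a given ball carry a mass above a given level, and letting both parameters vary exhausts
  \<open>S\<close>. This is how the hypothesis on balls makes the space separable.\<close>

lemma separated_countable:
  assumes "0 < e" "\<And>x y. x \<in> S \<Longrightarrow> y \<in> S \<Longrightarrow> x \<noteq> y \<Longrightarrow> e \<le> dist x y"
  shows "countable (S :: 'a set)"
proof -
  fix x0 :: 'a
  have fin: "finite {x \<in> S \<inter> ball x0 (real m). 1 / real (Suc k) < emeasure M (ball x (e/2))}" (is "finite ?T") for m k
  proof (rule ccontr)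
    assume inf: "infinite ?T"
    define R where "R = emeasure M (ball x0 (real m + e))"
    have R: "R < \<infinity>" unfolding R_def using ball_measure assms(1) by (metis add_nonneg_pos of_nat_0_le_iff)
    have "of_nat n * ennreal (1 / real (Suc k)) \<le> R" for n
    proof -
      obtain F where F: "F \<subseteq> ?T" "finite F" "card F = n" using infinite_arbitrarily_large[OF inf] by blast
      have "of_nat n * ennreal (1 / real (Suc k)) = (\<Sum>x\<in>F. ennreal (1 / real (Suc k)))" using F by simp
      also have "\<dots> \<le> (\<Sum>x\<in>F. emeasure M (ball x (e/2)))"
        using F by (intro sum_mono) (auto intro: less_imp_le)
      also have "\<dots> = emeasure M (\<Union>x\<in>F. ball x (e/2))"
      proof (intro sum_emeasure)
        show "disjoint_family_on (\<lambda>x. ball x (e/2)) F"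
          unfolding disjoint_family_on_def
        proof (intro ballI impI equals0I)
          fix x y z assume *: "x \<in> F" "y \<in> F" "x \<noteq> y" and "z \<in> ball x (e/2) \<inter> ball y (e/2)"
          then have "dist x y < e" using dist_triangle2[of x y z] by (auto simp: dist_commute)
          moreover have "e \<le> dist x y" using * F assms(2) by auto
          ultimately show False by simp
        qed
      qed (use F in \<open>auto intro: sets_M\<close>)
      also have "\<dots> \<le> R"
        unfolding R_def
      proof (intro emeasure_mono)
        show "(\<Union>x\<in>F. ball x (e/2)) \<subseteq> ball x0 (real m + e)"
        proof safe
          fix x z assume "x \<in> F" "z \<in> ball x (e/2)"
          moreover from this have "dist x0 x < real m" using F by auto
          ultimately show "z \<in> ball x0 (real m + e)" using dist_triangle[of x0 z x] assms(1) by auto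
        qed
      qed (auto intro: sets_M)
      finally show ?thesis .
    qed
    moreover obtain r where "R = ennreal r" "0 \<le> r" using R by (cases R) auto
    ultimately have "real n * (1 / real (Suc k)) \<le> r" for n
      by (metis ennreal_le_iff ennreal_mult ennreal_of_nat_eq_real_of_nat of_nat_0_le_iff zero_le_divide_1_iff)
    moreover obtain n where "r < real n * (1 / real (Suc k))"
      using ex_less_of_nat_mult[of "1 / real (Suc k)" r] by auto
    ultimately show False by (meson not_le)
  qed
  have "S \<subseteq> (\<Union>m k. {x \<in> S \<inter> ball x0 (real m). 1 / real (Suc k) < emeasure M (ball x (e/2))})"
  proof
    fix x assume x: "x \<in> S"
    obtain m where m: "dist x0 x < real m" using reals_Archimedean2 by blast
    have pos: "0 < emeasure M (ball x (e/2))" "emeasure M (ball x (e/2)) < \<infinity>" using ball_measure[of "e/2" x] assms(1) by auto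
    then obtain r where r: "emeasure M (ball x (e/2)) = ennreal r" "0 < r"
      by (cases "emeasure M (ball x (e/2))") auto
    obtain k where "1 / real (Suc k) < r" using reals_Archimedean[OF r(2)] by (auto simp: inverse_eq_divide)
    then have "ennreal (1 / real (Suc k)) < emeasure M (ball x (e/2))" using r by (simp add: ennreal_less_iff)
    then show "x \<in> (\<Union>m k. {x \<in> S \<inter> ball x0 (real m). 1 / real (Suc k) < emeasure M (ball x (e/2))})"
      using x m by auto
  qed
  moreover have "countable (\<Union>m k. {x \<in> S \<inter> ball x0 (real m). 1 / real (Suc k) < emeasure M (ball x (e/2))})"
    using fin by (intro countable_UN countableI_type countable_finite)
  ultimately show ?thesis by (rule countable_subset)
qed

text \<open>A maximal set of points at mutual distance at least \<open>e\<close>, given by Zorn's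
  lemma, is an \<open>e\<close>-net and countable; the union of these nets for
  \<open>e = 1 / Suc n\<close> is dense.\<close>

lemma countable_dense:
  obtains Q :: "'a set" where "countable Q" "\<And>x e. 0 < e \<Longrightarrow> \<exists>q\<in>Q. dist x q < e"
proof -
  have "\<exists>S :: 'a set. countable S \<and> (\<forall>x. \<exists>q\<in>S. dist x q < e)" if "0 < e" for e
  proof -
    define sep where "sep S \<longleftrightarrow> (\<forall>x\<in>S. \<forall>y\<in>S. x \<noteq> y \<longrightarrow> e \<le> dist x y)" for S :: "'a set"
    have "\<exists>S\<in>{S. sep S}. \<forall>X\<in>{S. sep S}. S \<subseteq> X \<longrightarrow> X = S"
    proof (rule subset_Zorn')
      fix C assume C: "subset.chain {S. sep S} C"
      have "sep (\<Union> C)"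
        unfolding sep_def
      proof (intro ballI impI)
        fix x y assume "x \<in> \<Union> C" "y \<in> \<Union> C" "x \<noteq> y"
        then obtain S T where "S \<in> C" "x \<in> S" "T \<in> C" "y \<in> T" by auto
        moreover from this have "S \<subseteq> T \<or> T \<subseteq> S" using C by (auto simp: subset.chain_def)
        moreover have "sep S" "sep T" using C \<open>S \<in> C\<close> \<open>T \<in> C\<close> by (auto simp: subset.chain_def)
        ultimately show "e \<le> dist x y" using \<open>x \<noteq> y\<close> unfolding sep_def by blast
      qed
      then show "\<Union> C \<in> {S. sep S}" by simp
    qed
    then obtain S where S: "sep S" "\<And>X. sep X \<Longrightarrow> S \<subseteq> X \<Longrightarrow> X = S" by blast
    have "\<exists>q\<in>S. dist x q < e" for x
    proof (rule ccontr)
      assume "\<not> (\<exists>q\<in>S. dist x q < e)"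
      then have far: "e \<le> dist x q" if "q \<in> S" for q using that by (auto simp: not_less)
      then have "sep (insert x S)" using S(1) by (auto simp: sep_def dist_commute)
      then have "x \<in> S" using S(2) by blast
      then show False using far[of x] that by simp
    qed
    moreover have "countable S" using separated_countable[OF that] S(1) by (auto simp: sep_def)
    ultimately show ?thesis by blast
  qed
  then have "\<forall>n. \<exists>S :: 'a set. countable S \<and> (\<forall>x. \<exists>q\<in>S. dist x q < 1 / real (Suc n))" by simp
  then obtain S :: "nat \<Rightarrow> 'a set" where S: "\<And>n. countable (S n)" "\<And>n x. \<exists>q\<in>S n. dist x q < 1 / real (Suc n)"
    by metis
  show ?thesis
  proof (rule that[of "\<Union>n. S n"])
    fix x and e :: real assume "0 < e"
    obtain n where "1 / real (Suc n) < e" using reals_Archimedean[OF \<open>0 < e\<close>] by (auto simp: inverse_eq_divide)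
    moreover obtain q where "q \<in> S n" "dist x q < 1 / real (Suc n)" using S(2) by blast
    ultimately show "\<exists>q\<in>\<Union> (range S). dist x q < e" by (intro bexI[of _ q]) auto
  qed (use S(1) in auto)
qed

text \<open>Ulam's theorem on a complete set. For each \<open>n\<close>, finitely many closed balls
  of radius \<open>1 / Suc n\<close> around points of a dense sequence cover \<open>D\<close> up to
  mass \<open>e * (1/2) ^ Suc n\<close>; intersecting these finite unions with \<open>D\<close>
  leaves a complete and totally bounded set.\<close>

lemma inner_compact:
  assumes D: "complete D" "emeasure M D < \<infinity>" and "0 < e"
  obtains K where "compact K" "K \<subseteq> D" "emeasure M (D - K) \<le> ennreal e"
proof -
  obtain Q :: "'a set" where Q: "countable Q" "\<And>x e. 0 < e \<Longrightarrow> \<exists>q\<in>Q. dist x q < e" using countable_dense by metis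
  have "Q \<noteq> {}" using Q(2)[of 1] by auto
  define q where "q = from_nat_into Q"
  have q: "\<exists>i. dist x (q i) < e" if "0 < e" for x e
    using Q(2)[OF that, of x] from_nat_into_surj[OF Q(1)] unfolding q_def by metis
  have "closed D" using D(1) by (rule complete_imp_closed)
  then have Db: "D \<in> sets borel" by (rule borel_closed)
  define A where "A n i = cball (q i) (1 / real (Suc n))" for n i
  have A: "A n i \<in> sets M" for n i unfolding A_def by (intro sets_M borel_closed closed_cball)
  have "\<exists>k. emeasure M (D - (\<Union>i<k. A n i)) < ennreal (e * (1/2) ^ Suc n)" for n
  proof -
    have "x \<in> (\<Union>i. A n i)" for x
    proof -
      obtain i where "dist x (q i) < 1 / real (Suc n)" using q[of "1 / real (Suc n)" x] by auto
      then show ?thesis by (auto simp: A_def dist_commute intro!: exI[of _ i])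
    qed
    then have "D \<subseteq> (\<Union>i. A n i)" by blast
    moreover have "0 < e * (1/2) ^ Suc n" using \<open>0 < e\<close> by simp
    ultimately obtain j where "emeasure M (D - (\<Union>i<j. A n i)) < ennreal (e * (1/2) ^ Suc n)"
      using exists_index_close_from_above[OF sets_M[OF Db] D(2), of "A n"] A by metis
    then show ?thesis by blast
  qed
  then obtain k where k: "\<And>n. emeasure M (D - (\<Union>i<k n. A n i)) < ennreal (e * (1/2) ^ Suc n)" by metis
  define K where "K = D \<inter> (\<Inter>n. \<Union>i<k n. A n i)"
  have "closed (\<Inter>n. \<Union>i<k n. A n i)" by (intro closed_INT ballI closed_UN) (auto simp: A_def)
  then have cK: "closed K" unfolding K_def using \<open>closed D\<close> by auto
  have "compact K"
    unfolding compact_eq_totally_bounded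
  proof safe
    show "complete K" unfolding K_def using D(1) \<open>closed (\<Inter>n. \<Union>i<k n. A n i)\<close> by (rule complete_Int_closed)
    fix r :: real assume "0 < r"
    then obtain n where n: "1 / real (Suc n) < r" using reals_Archimedean by (auto simp: inverse_eq_divide)
    show "\<exists>F. finite F \<and> K \<subseteq> (\<Union>x\<in>F. ball x r)"
    proof (intro exI[of _ "q ` {..<k n}"] conjI)
      show "K \<subseteq> (\<Union>x\<in>q ` {..<k n}. ball x r)"
      proof
        fix x assume "x \<in> K"
        then obtain i where "i < k n" "x \<in> A n i" unfolding K_def by blast
        then have "dist (q i) x < r" using n by (simp add: A_def)
          then show "x \<in> (\<Union>x\<in>q ` {..<k n}. ball x r)" using \<open>i < k n\<close> by auto
      qed
    qed simp
  qed
  moreover have "emeasure M (D - K) \<le> ennreal e"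
  proof -
    have "emeasure M (D - K) \<le> emeasure M (\<Union>n. D - (\<Union>i<k n. A n i))"
      unfolding K_def by (intro emeasure_mono sets.countable_UN) (use A sets_M[OF Db] in auto)
    also have "\<dots> \<le> (\<Sum>n. emeasure M (D - (\<Union>i<k n. A n i)))"
      using A sets_M[OF Db] by (intro emeasure_subadditive_countably) auto
    also have "\<dots> \<le> (\<Sum>n. ennreal (e * (1/2) ^ Suc n))"
      using k by (intro suminf_le) (auto intro: less_imp_le)
    also have "\<dots> = ennreal e" using \<open>0 < e\<close> by (rule suminf_half_pow)
    finally show ?thesis .
  qed
  ultimately show ?thesis by (intro that[of K]) (auto simp: K_def)
qed

text \<open>A one-sided Lusin theorem. Each sublevel set at a rational height and its complement are
  approximated from inside by closed sets \<open>C n\<close> and \<open>C' n\<close>. A point of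
  \<open>F\<close> lies in one of the two, so the trace of the sublevel set on \<open>F\<close> is
  the closed set \<open>F \<inter> C n\<close>; other heights are intersections of these.\<close>

lemma restrict_lsc:
  fixes u :: "'a \<Rightarrow> real"
  assumes u: "u \<in> borel_measurable M" and D: "closed D" "emeasure M D < \<infinity>" and "0 < e"
  obtains F where "closed F" "F \<subseteq> D" "emeasure M (D - F) \<le> ennreal e" "\<And>t. closed {x\<in>F. u x \<le> t}"
proof -
  have Db: "D \<in> sets borel" using D by (intro borel_closed)
  define r where "r n = (from_nat_into \<rat> n :: real)" for n
  have r: "\<exists>n. x < r n \<and> r n < y" if "x < y" for x y
  proof -
    obtain s where "s \<in> \<rat>" "x < s" "s < y" using Rats_dense_in_real[OF \<open>x < y\<close>] by blast
    then show ?thesis using from_nat_into_surj[OF countable_rat, of s] unfolding r_def by auto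
  qed
  define A where "A n = {x. u x \<le> r n}" for n
  have A: "A n \<in> sets M" for n
  proof -
    have "{x \<in> space M. u x \<le> r n} \<in> sets M" using u by measurable
    then show ?thesis by (simp add: A_def)
  qed
  define d where "d n = e/2 * (1/2) ^ Suc n" for n
  have d: "0 < d n" for n using \<open>0 < e\<close> by (simp add: d_def)
  have "\<exists>C. closed C \<and> C \<subseteq> A n \<and> emeasure M ((A n - C) \<inter> D) < ennreal (d n)" for n
    using inner_closed[OF A Db D(2) d] by metis
  then obtain C where C: "\<And>n. closed (C n)" "\<And>n. C n \<subseteq> A n" "\<And>n. emeasure M ((A n - C n) \<inter> D) < ennreal (d n)"
    by metis
  have A': "- A n \<in> sets M" for n using sets.compl_sets[OF A] by (simp add: Compl_eq_Diff_UNIV)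
  have "\<exists>C. closed C \<and> C \<subseteq> - A n \<and> emeasure M ((- A n - C) \<inter> D) < ennreal (d n)" for n
    using inner_closed[OF A' Db D(2) d] by metis
  then obtain C' where C': "\<And>n. closed (C' n)" "\<And>n. C' n \<subseteq> - A n" "\<And>n. emeasure M ((- A n - C' n) \<inter> D) < ennreal (d n)"
    by metis
  define F where "F = D \<inter> (\<Inter>n. C n \<union> C' n)"
  have cF: "closed F" unfolding F_def using D C C' by (intro closed_Int closed_INT closed_Un ballI) auto
  have F1: "{x\<in>F. u x \<le> r n} = F \<inter> C n" for n
    using C(2)[of n] C'(2)[of n] by (auto simp: F_def A_def)
  have "closed {x\<in>F. u x \<le> t}" for t
  proof -
    have "{x\<in>F. u x \<le> t} = (\<Inter>n\<in>{n. t < r n}. F \<inter> C n) \<inter> F"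
    proof (intro subset_antisym subsetI)
      fix x assume "x \<in> {x \<in> F. u x \<le> t}"
      then show "x \<in> (\<Inter>n\<in>{n. t < r n}. F \<inter> C n) \<inter> F" unfolding F1[symmetric] by auto
    next
      fix x assume x: "x \<in> (\<Inter>n\<in>{n. t < r n}. F \<inter> C n) \<inter> F"
      have "u x \<le> t"
      proof (rule ccontr)
        assume "\<not> u x \<le> t"
        then obtain n where "t < r n" "r n < u x" using r[of t "u x"] by auto
        then have "x \<in> F \<inter> C n" using x by blast
        then have "u x \<le> r n" unfolding F1[symmetric] by simp
        with \<open>r n < u x\<close> show False by simp
      qed
      then show "x \<in> {x \<in> F. u x \<le> t}" using x by auto
    qed
    also have "closed \<dots>" using cF C by (intro closed_Int closed_INT ballI) auto
    finally show ?thesis .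
  qed
  moreover have "emeasure M (D - F) \<le> ennreal e"
  proof -
    let ?B = "\<lambda>n. (A n - C n) \<inter> D \<union> (- A n - C' n) \<inter> D"
    have m: "(A n - C n) \<inter> D \<in> sets M" "(- A n - C' n) \<inter> D \<in> sets M" for n
      using A A' C C' sets_M[OF Db] by (auto intro!: sets.Int sets.Diff sets_M)
    have "emeasure M (D - F) \<le> emeasure M (\<Union>n. ?B n)"
      using m unfolding F_def by (intro emeasure_mono sets.countable_UN) auto
    also have "\<dots> \<le> (\<Sum>n. emeasure M (?B n))"
      using m by (intro emeasure_subadditive_countably) auto
    also have "\<dots> \<le> (\<Sum>n. ennreal (e * (1/2) ^ Suc n))"
    proof (intro suminf_le)
      fix n
      have "emeasure M (?B n) \<le> emeasure M ((A n - C n) \<inter> D) + emeasure M ((- A n - C' n) \<inter> D)"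
        using m by (intro emeasure_subadditive)
      also have "\<dots> \<le> ennreal (d n) + ennreal (d n)" using C C' by (intro add_mono less_imp_le)
      also have "\<dots> = ennreal (e * (1/2) ^ Suc n)" using d[of n] by (simp add: d_def flip: ennreal_plus)
      finally show "emeasure M (?B n) \<le> ennreal (e * (1/2) ^ Suc n)" .
    qed auto
    also have "\<dots> = ennreal e" using \<open>0 < e\<close> by (rule suminf_half_pow)
    finally show ?thesis .
  qed
  ultimately show ?thesis using cF by (intro that[of F]) (auto simp: F_def)
qed

text \<open>As in the Vitali--Caratheodory theorem, the superlevel sets of \<open>f\<close>, here at the heights \<open>2 ^ i\<close>,
  are enlarged to open sets.\<close>

lemma lsc_majorant:
  fixes f :: "'a \<Rightarrow> ennreal"
  assumes f: "f \<in> borel_measurable M" and D: "D \<in> sets borel" "emeasure M D < \<infinity>"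
    and fin: "(\<integral>\<^sup>+x\<in>D. f x \<partial>M) < \<infinity>"
  obtains g where "lsc g" "\<And>x. f x \<le> g x" "(\<integral>\<^sup>+x\<in>D. g x \<partial>M) < \<infinity>"
proof -
  have Dm [measurable]: "D \<in> sets M" using D(1) by (rule sets_M)
  note f[measurable]
  define A where "A i = {x. ennreal (2 ^ i) < f x}" for i :: nat
  have A [measurable]: "A i \<in> sets M" for i
  proof -
    have "{x \<in> space M. ennreal (2 ^ i) < f x} \<in> sets M" by measurable
    then show ?thesis by (simp add: A_def)
  qed
  \<comment> \<open>The error \<open>(1/4) ^ Suc i\<close> beats the height \<open>2 ^ Suc i\<close>
    that is given to \<open>U i\<close>: the products sum to 1.\<close>
  have "\<exists>U. open U \<and> A i \<subseteq> U \<and> emeasure M ((U - A i) \<inter> D) < ennreal ((1/4) ^ Suc i)" for i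
    by (rule outer_open[OF A D, of "(1/4) ^ Suc i" i]) auto
  then obtain U where U: "\<And>i. open (U i)" "\<And>i. A i \<subseteq> U i" "\<And>i. emeasure M ((U i - A i) \<inter> D) < ennreal ((1/4) ^ Suc i)"
    by metis
  have [measurable]: "U i \<in> sets M" for i using U by (intro sets_M borel_open)
  define g where "g x = max 1 (SUP i. ennreal (2 ^ Suc i) * indicator (U i) x)" for x
  have "lsc g" unfolding g_def using U by (intro lsc_max lsc_const lsc_SUP lsc_indicator)
  moreover have "f x \<le> g x" for x
  proof (cases "f x \<le> 1")
    case True then show ?thesis by (simp add: g_def le_max_iff_disj)
  next
    case False
    show ?thesis
    proof (rule ccontr)
      assume "\<not> f x \<le> g x"
      then have lt: "g x < f x" by simp
      \<comment> \<open>Climbing the levels: if \<open>f x\<close> passes the height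
        \<open>2 ^ i\<close>, then \<open>x\<close> is in \<open>U i\<close>, so \<open>g x\<close>
        is at least \<open>2 ^ Suc i\<close>, and \<open>f x > g x\<close> passes the next height.
        In the end \<open>g x\<close> would exceed all heights, although it is finite.\<close>
      have "ennreal (2 ^ i) < f x" for i
      proof (induction i)
        case 0 then show ?case using False by simp
      next
        case (Suc i)
        then have "x \<in> U i" using U(2)[of i] by (auto simp: A_def)
        then have "ennreal (2 ^ Suc i) \<le> (SUP i. ennreal (2 ^ Suc i) * indicator (U i) x)"
          by (intro SUP_upper2[of i]) auto
        also have "\<dots> \<le> g x" by (simp add: g_def)
        finally show ?case using lt by simp
      qed
      then have xU: "x \<in> U i" for i using U(2)[of i] by (auto simp: A_def)
      have "ennreal (2 ^ Suc i) \<le> g x" for i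
        using xU[of i] unfolding g_def by (intro order_trans[OF _ max.cobounded2] SUP_upper2[of i]) auto
      moreover obtain r where r: "g x = ennreal r" "0 \<le> r" using lt by (cases "g x") auto
      moreover obtain n :: nat where n: "r < 2 ^ n" using real_arch_pow[of 2 r] by auto
      ultimately have "2 ^ Suc n \<le> r" by (simp add: r del: power_Suc)
      moreover have "(2::real) ^ n \<le> 2 ^ Suc n" by simp
      ultimately show False using n by linarith
    qed
  qed
  moreover have "(\<integral>\<^sup>+x\<in>D. g x \<partial>M) < \<infinity>"
  proof -
    \<comment> \<open>On \<open>A i\<close> the height \<open>2 ^ Suc i\<close> is at most
      \<open>2 * f x\<close>; only the excess \<open>U i - A i\<close> calls for the measure
      estimate.\<close>
    have le: "g x \<le> 1 + (2 * f x + (SUP i. ennreal (2 ^ Suc i) * indicator (U i - A i) x))" for x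
      unfolding g_def
    proof (intro max.boundedI)
      show "(SUP i. ennreal (2 ^ Suc i) * indicator (U i) x) \<le> 1 + (2 * f x + (SUP i. ennreal (2 ^ Suc i) * indicator (U i - A i) x))"
      proof (rule add_increasing[OF zero_le], rule SUP_least)
        fix i
        show "ennreal (2 ^ Suc i) * indicator (U i) x \<le> 2 * f x + (SUP i. ennreal (2 ^ Suc i) * indicator (U i - A i) x)"
        proof (cases "x \<in> A i")
          case True
          then have "ennreal (2 ^ i) \<le> f x" by (simp add: A_def)
          then have "2 * ennreal (2 ^ i) \<le> 2 * f x" by (intro mult_left_mono) auto
          then have "ennreal (2 ^ Suc i) \<le> 2 * f x" by (simp add: ennreal_mult)
          then show ?thesis by (intro add_increasing2[OF zero_le]) (auto split: split_indicator)
        next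
          case False
          then show ?thesis by (intro add_increasing[OF zero_le] SUP_upper2[of i]) (auto split: split_indicator)
        qed
      qed
    qed simp
    let ?h = "\<lambda>x. SUP i. ennreal (2 ^ Suc i) * indicator ((U i - A i) \<inter> D) x"
    have "(\<integral>\<^sup>+x\<in>D. g x \<partial>M) \<le> (\<integral>\<^sup>+x. indicator D x + (2 * (f x * indicator D x) + ?h x) \<partial>M)"
    proof (intro nn_integral_mono)
      fix x show "g x * indicator D x \<le> indicator D x + (2 * (f x * indicator D x) + ?h x)"
      proof (cases "x \<in> D")
        case True
        then have "indicator ((U i - A i) \<inter> D) x = (indicator (U i - A i) x :: ennreal)" for i
          by (auto split: split_indicator)
        then show ?thesis using le[of x] True by simp
      qed simp
    qed
    also have "\<dots> = emeasure M D + (2 * (\<integral>\<^sup>+x\<in>D. f x \<partial>M) + (\<integral>\<^sup>+x. ?h x \<partial>M))"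
      by (simp add: nn_integral_add nn_integral_cmult)
    also have "(\<integral>\<^sup>+x. ?h x \<partial>M) \<le> (\<Sum>i. \<integral>\<^sup>+x. ennreal (2 ^ Suc i) * indicator ((U i - A i) \<inter> D) x \<partial>M)"
      by (rule nn_integral_SUP_le_suminf) measurable
    also have "\<dots> \<le> (\<Sum>i. ennreal (1 * (1/2) ^ Suc i))"
    proof (intro suminf_le)
      fix i
      have "(\<integral>\<^sup>+x. ennreal (2 ^ Suc i) * indicator ((U i - A i) \<inter> D) x \<partial>M) = ennreal (2 ^ Suc i) * emeasure M ((U i - A i) \<inter> D)"
        by (rule nn_integral_cmult_indicator) measurable
      also have "\<dots> \<le> ennreal (2 ^ Suc i) * ennreal ((1/4) ^ Suc i)"
        using U(3)[of i] by (intro mult_left_mono less_imp_le) auto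
      also have "\<dots> = ennreal (1 * (1/2) ^ Suc i)"
        by (simp add: power_mult_distrib[symmetric] del: power_Suc flip: ennreal_mult)
      finally show "(\<integral>\<^sup>+x. ennreal (2 ^ Suc i) * indicator ((U i - A i) \<inter> D) x \<partial>M) \<le> ennreal (1 * (1/2) ^ Suc i)" .
    qed auto
    also have "\<dots> = ennreal 1" by (rule suminf_half_pow) simp
    finally have "(\<integral>\<^sup>+x\<in>D. g x \<partial>M) \<le> emeasure M D + (2 * (\<integral>\<^sup>+x\<in>D. f x \<partial>M) + ennreal 1)"
      by (simp add: add_left_mono)
    also have "\<dots> < \<infinity>" using D fin by (simp add: ennreal_mult_less_top)
    finally show ?thesis .
  qed
  ultimately show ?thesis by (rule that)
qed

text \<open>The function serves as cost density for paths: lower semicontinuity is there for Fatou's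
  lemma, the bound \<open>1 \<le> g\<close> limits the duration of cheap paths, and the last
  property keeps them near a compact set. The construction takes place for \<open>p\<close>-th
  powers, whose integrals are controlled, and the \<open>p\<close>-th root is taken at the
  end.\<close>

lemma tight_lsc_majorant:
  fixes f :: "'a \<Rightarrow> ennreal"
  assumes f: "f \<in> borel_measurable M" and D: "complete D" "emeasure M D < \<infinity>"
    and fin: "(\<integral>\<^sup>+x\<in>D. ennreal_rpow (f x) p \<partial>M) < \<infinity>"
  obtains g where "lsc g" "\<And>x. f x \<le> g x" "\<And>x. 1 \<le> g x" "(\<integral>\<^sup>+x\<in>D. ennreal_rpow (g x) p \<partial>M) < \<infinity>"
    "\<And>B. \<exists>K. compact K \<and> K \<subseteq> D \<and> (\<forall>x\<in>D - K. ennreal B \<le> g x)"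
proof -
  have cD: "closed D" using D(1) by (rule complete_imp_closed)
  then have Db: "D \<in> sets borel" by (rule borel_closed)
  have Dm [measurable]: "D \<in> sets M" using Db by (rule sets_M)
  note f[measurable]
  have fp: "(\<lambda>x. ennreal_rpow (f x) p) \<in> borel_measurable M" by measurable
  obtain \<psi> where \<psi>: "lsc \<psi>" "\<And>x. ennreal_rpow (f x) p \<le> \<psi> x" "(\<integral>\<^sup>+x\<in>D. \<psi> x \<partial>M) < \<infinity>"
    using lsc_majorant[OF fp Db D(2) fin] by blast
  \<comment> \<open>The complement of \<open>K i\<close> will carry the height
    \<open>2 ^ Suc i\<close>; masses of at most \<open>(1/4) ^ Suc i\<close> keep the integral of
    \<open>T\<close> over \<open>D\<close> below or equal to 1.\<close>
  have "\<exists>K. compact K \<and> K \<subseteq> D \<and> emeasure M (D - K) \<le> ennreal ((1/4) ^ Suc i)" for i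
    by (rule inner_compact[OF D, of "(1/4) ^ Suc i"]) auto
  then obtain K where K: "\<And>i. compact (K i)" "\<And>i. K i \<subseteq> D" "\<And>i. emeasure M (D - K i) \<le> ennreal ((1/4) ^ Suc i)"
    by metis
  have [measurable]: "K i \<in> sets M" for i using K by (intro sets_M borel_compact)
  define T where "T x = (SUP i. ennreal (2 ^ Suc i) * indicator (- K i) x)" for x
  have "lsc T" unfolding T_def using K by (intro lsc_SUP lsc_indicator) (auto intro: compact_imp_closed)
  define \<phi> where "\<phi> x = max 1 (max (\<psi> x) (T x))" for x
  have "lsc \<phi>" unfolding \<phi>_def by (intro lsc_max lsc_const \<psi> \<open>lsc T\<close>)
  define g where "g x = ennreal_rpow (\<phi> x) (1 / p)" for x
  have [measurable]: "\<psi> \<in> borel_measurable M" "T \<in> borel_measurable M"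
    using \<psi>(1) \<open>lsc T\<close> by (auto intro: borel_M lsc_measurable)
  have "lsc g" unfolding g_def using \<open>lsc \<phi>\<close> p_pos by (intro lsc_rpow) auto
  moreover have "f x \<le> g x" for x
    unfolding g_def ennreal_rpow_le_iff[OF p_pos, symmetric] \<phi>_def
    using \<psi>(2)[of x] by (simp add: le_max_iff_disj)
  moreover have "1 \<le> g x" for x
    unfolding g_def ennreal_rpow_le_iff[OF p_pos, symmetric] \<phi>_def by simp
  moreover have "(\<integral>\<^sup>+x\<in>D. ennreal_rpow (g x) p \<partial>M) < \<infinity>"
  proof -
    have "(\<integral>\<^sup>+x\<in>D. T x \<partial>M) = (\<integral>\<^sup>+x. (SUP i. ennreal (2 ^ Suc i) * indicator (D - K i) x) \<partial>M)"
    proof (intro nn_integral_cong)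
      fix x
      show "T x * indicator D x = (SUP i. ennreal (2 ^ Suc i) * indicator (D - K i) x)"
      proof (cases "x \<in> D")
        case True
        then have "indicator (- K i) x = (indicator (D - K i) x :: ennreal)" for i by (auto split: split_indicator)
        then show ?thesis using True by (simp add: T_def)
      qed simp
    qed
    also have "\<dots> \<le> (\<Sum>i. \<integral>\<^sup>+x. ennreal (2 ^ Suc i) * indicator (D - K i) x \<partial>M)"
      by (rule nn_integral_SUP_le_suminf) measurable
    also have "\<dots> \<le> (\<Sum>i. ennreal (1 * (1/2) ^ Suc i))"
    proof (intro suminf_le)
      fix i
      have "(\<integral>\<^sup>+x. ennreal (2 ^ Suc i) * indicator (D - K i) x \<partial>M) = ennreal (2 ^ Suc i) * emeasure M (D - K i)"
        by (rule nn_integral_cmult_indicator) measurable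
      also have "\<dots> \<le> ennreal (2 ^ Suc i) * ennreal ((1/4) ^ Suc i)"
        using K(3)[of i] by (intro mult_left_mono) auto
      also have "\<dots> = ennreal (1 * (1/2) ^ Suc i)"
        by (simp add: power_mult_distrib[symmetric] del: power_Suc flip: ennreal_mult)
      finally show "(\<integral>\<^sup>+x. ennreal (2 ^ Suc i) * indicator (D - K i) x \<partial>M) \<le> ennreal (1 * (1/2) ^ Suc i)" .
    qed auto
    also have "\<dots> = ennreal 1" by (rule suminf_half_pow) simp
    finally have T: "(\<integral>\<^sup>+x\<in>D. T x \<partial>M) \<le> 1" by simp
    have "(\<integral>\<^sup>+x\<in>D. ennreal_rpow (g x) p \<partial>M) \<le> (\<integral>\<^sup>+x. indicator D x + (\<psi> x * indicator D x + T x * indicator D x) \<partial>M)"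
      unfolding g_def using p_pos
      by (intro nn_integral_mono) (auto simp: \<phi>_def max_def add_increasing add_increasing2 split: split_indicator)
    also have "\<dots> = emeasure M D + ((\<integral>\<^sup>+x\<in>D. \<psi> x \<partial>M) + (\<integral>\<^sup>+x\<in>D. T x \<partial>M))"
      by (simp add: nn_integral_add)
    also have "\<dots> < \<infinity>" using D \<psi>(3) le_less_trans[OF T, of top] by simp
    finally show ?thesis .
  qed
  moreover have "\<exists>K. compact K \<and> K \<subseteq> D \<and> (\<forall>x\<in>D - K. ennreal B \<le> g x)" for B
  proof -
    \<comment> \<open>Only \<open>max B 0\<close> is raised to the power \<open>p\<close>, as
      \<open>ennreal B\<close> is 0 for negative \<open>B\<close>.\<close>
    obtain i :: nat where i: "max B 0 powr p < 2 ^ i" using real_arch_pow[of 2 "max B 0 powr p"] by auto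
    have "ennreal B \<le> g x" if "x \<in> D - K i" for x
    proof -
      have "ennreal_rpow (ennreal (max B 0)) p \<le> ennreal (2 ^ Suc i)"
        unfolding ennreal_rpow_ennreal[OF max.cobounded2]
      proof (intro ennreal_leI)
        have "(2::real) ^ i \<le> 2 ^ Suc i" by simp
        then show "max B 0 powr p \<le> 2 ^ Suc i" using i by linarith
      qed
      also have "\<dots> \<le> T x" unfolding T_def using that by (intro SUP_upper2[of i]) auto
      also have "\<dots> \<le> \<phi> x" by (simp add: \<phi>_def le_max_iff_disj)
      finally have "ennreal (max B 0) \<le> g x" unfolding g_def ennreal_rpow_le_iff[OF p_pos] .
      moreover have "ennreal B \<le> ennreal (max B 0)" by (intro ennreal_leI) simp
      ultimately show ?thesis by (rule order_trans[rotated])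
    qed
    then show ?thesis using K by blast
  qed
  ultimately show ?thesis by (rule that)
qed

end

subsection \<open>Weak upper gradients\<close>

text \<open>The weak upper gradient inequality, with \<open>\<rho>\<close> witnessing the exceptional family, along all 1-Lipschitz
  paths rather than arc length curves: these paths can be cut, concatenated and passed to limits, and
  reparametrization by arc length does not increase path integrals.\<close>

definition curve_ug :: "('a::metric_space \<Rightarrow> real) \<Rightarrow> ('a \<Rightarrow> ennreal) \<Rightarrow> ('a \<Rightarrow> ennreal) \<Rightarrow> bool" where
  "curve_ug f g \<rho> \<longleftrightarrow> (\<forall>c l. lip1 c \<longrightarrow> 0 \<le> l \<longrightarrow> path_integral \<rho> c 0 l < \<infinity> \<longrightarrow>
    ennreal \<bar>f (c 0) - f (c l)\<bar> \<le> path_integral g c 0 l)"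

lemma curve_ugD:
  "curve_ug f g \<rho> \<Longrightarrow> lip1 c \<Longrightarrow> 0 \<le> l \<Longrightarrow> path_integral \<rho> c 0 l < \<infinity> \<Longrightarrow>
    ennreal \<bar>f (c 0) - f (c l)\<bar> \<le> path_integral g c 0 l"
  by (simp add: curve_ug_def)

lemma path_integral_measurable:
  assumes "lip1 c" "g \<in> borel_measurable borel"
  shows "(\<lambda>t. g (c t)) \<in> borel_measurable borel"
  using lip1_measurable[OF assms(1)] assms(2) by (rule measurable_compose)

lemma curve_ug_segment:
  assumes "curve_ug f g \<rho>" "g \<in> borel_measurable borel" "\<rho> \<in> borel_measurable borel"
    and "lip1 c" "a \<le> b" "path_integral \<rho> c a b < \<infinity>"
  shows "ennreal \<bar>f (c a) - f (c b)\<bar> \<le> path_integral g c a b"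
proof -
  have "lip1 (\<lambda>t. c (a + t))" using assms(4) by (rule lip1_compose) auto
  then have "ennreal \<bar>f (c (a + 0)) - f (c (a + (b - a)))\<bar> \<le> path_integral g (\<lambda>t. c (a + t)) 0 (b - a)"
    using assms by (intro curve_ugD[OF assms(1)]) (auto simp: path_integral_shift)
  then show ?thesis using assms by (simp add: path_integral_shift)
qed

lemma e2ennreal_abs_ereal_diff: "e2ennreal \<bar>ereal a - ereal b\<bar> = ennreal \<bar>a - b\<bar>"
  by simp

context capacity_space begin

text \<open>Borel measurability, stronger than measurability for the completed measure, makes the
  composition with every path Borel, so that integrals along all paths are meaningful.\<close>

definition Lp :: "('a \<Rightarrow> ennreal) \<Rightarrow> bool" where
  "Lp g \<longleftrightarrow> g \<in> borel_measurable borel \<and> (\<integral>\<^sup>+x. ennreal_rpow (g x) p \<partial>M) < \<infinity>"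

lemma Lp_measurable: "Lp g \<Longrightarrow> g \<in> borel_measurable borel"
  by (simp add: Lp_def)

lemma rpow_borel_M: "g \<in> borel_measurable borel \<Longrightarrow> (\<lambda>x. ennreal_rpow (g x) p) \<in> borel_measurable M"
  by (intro borel_M) measurable

lemma Lp_mono:
  assumes "Lp g" "h \<in> borel_measurable borel" "\<And>x. h x \<le> g x"
  shows "Lp h"
proof -
  have "(\<integral>\<^sup>+x. ennreal_rpow (h x) p \<partial>M) \<le> (\<integral>\<^sup>+x. ennreal_rpow (g x) p \<partial>M)"
    using assms p_pos by (intro nn_integral_mono ennreal_rpow_mono)
  then show ?thesis using assms by (auto simp: Lp_def)
qed

lemma Lp_add:
  assumes "Lp g" "Lp h"
  shows "Lp (\<lambda>x. g x + h x)"
proof -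
  have [measurable]: "g \<in> borel_measurable borel" "h \<in> borel_measurable borel" using assms by (auto simp: Lp_def)
  define K where "K = ennreal ((1 + 1) powr p)"
  define K' where "K' = ennreal ((1 + 1 / 1) powr p)"
  have K: "K < \<infinity>" "K' < \<infinity>" unfolding K_def K'_def by simp_all
  have "(\<integral>\<^sup>+x. ennreal_rpow (g x + h x) p \<partial>M) \<le> (\<integral>\<^sup>+x. K * ennreal_rpow (g x) p + K' * ennreal_rpow (h x) p \<partial>M)"
    unfolding K_def K'_def by (intro nn_integral_mono ennreal_rpow_add_le p_pos zero_less_one)
  also have "\<dots> = K * (\<integral>\<^sup>+x. ennreal_rpow (g x) p \<partial>M) + K' * (\<integral>\<^sup>+x. ennreal_rpow (h x) p \<partial>M)"
  proof -
    have [measurable]: "(\<lambda>x. ennreal_rpow (g x) p) \<in> borel_measurable M" "(\<lambda>x. ennreal_rpow (h x) p) \<in> borel_measurable M"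
      by (simp_all add: rpow_borel_M)
    show ?thesis by (simp add: nn_integral_add nn_integral_cmult)
  qed
  also have "\<dots> < \<infinity>" using assms K by (simp add: Lp_def ennreal_mult_less_top)
  finally show ?thesis unfolding Lp_def by simp
qed

lemma Lp_cmult:
  assumes "Lp g" "0 \<le> k"
  shows "Lp (\<lambda>x. ennreal k * g x)"
proof -
  have [measurable]: "g \<in> borel_measurable borel" by (rule Lp_measurable[OF assms(1)])
  have "(\<integral>\<^sup>+x. ennreal_rpow (ennreal k * g x) p \<partial>M) = ennreal (k powr p) * (\<integral>\<^sup>+x. ennreal_rpow (g x) p \<partial>M)"
    using assms(2) p_pos by (simp add: ennreal_rpow_mult nn_integral_cmult rpow_borel_M)
  then show ?thesis using assms by (simp add: Lp_def ennreal_mult_less_top)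
qed

lemma Lp_zero: "Lp (\<lambda>x. 0)"
  by (simp add: Lp_def)

text \<open>Countably many exceptional families are contained in a single one: \<sigma> dominates a
  positive multiple of every \<open>\<rho> n\<close>. A supremum is convenient because its
  \<open>p\<close>-th power is at most the sum of the \<open>p\<close>-th powers.\<close>

lemma Lp_countable_exceptional:
  fixes \<rho> :: "nat \<Rightarrow> 'a \<Rightarrow> ennreal"
  assumes "\<And>n. Lp (\<rho> n)"
  obtains \<sigma> where "Lp \<sigma>" "\<And>n c a b. lip1 c \<Longrightarrow> path_integral \<sigma> c a b < \<infinity> \<Longrightarrow> path_integral (\<rho> n) c a b < \<infinity>"
proof -
  define I where "I n = enn2real (\<integral>\<^sup>+x. ennreal_rpow (\<rho> n x) p \<partial>M)" for n
  have I: "(\<integral>\<^sup>+x. ennreal_rpow (\<rho> n x) p \<partial>M) = ennreal (I n)" "0 \<le> I n" for n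
    using assms unfolding I_def Lp_def by (auto intro!: ennreal_enn2real[symmetric])
  \<comment> \<open>Dividing by \<open>1 + I n\<close> also covers \<open>I n = 0\<close> and keeps
    \<open>k n \<le> 1\<close>, so that \<open>k n powr p \<le> k n\<close> and the weighted
    energies sum to at most 1.\<close>
  define k where "k n = (1/2) ^ Suc n / (1 + I n)" for n
  have k: "0 < k n" "k n \<le> 1" "k n * I n \<le> (1/2) ^ Suc n" for n
  proof -
    show "0 < k n" using I(2)[of n] by (simp add: k_def)
    have "(1/2::real) ^ Suc n \<le> 1" by (intro power_le_one) auto
    then have "(1/2::real) ^ Suc n \<le> 1 + I n" using I(2)[of n] by linarith
    then show "k n \<le> 1" using I(2)[of n] unfolding k_def by (intro divide_le_eq_1_pos[THEN iffD2]) auto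
    have "k n * I n \<le> k n * (1 + I n)" using I(2)[of n] \<open>0 < k n\<close> by (intro mult_left_mono) auto
    also have "\<dots> = (1/2) ^ Suc n" using I(2)[of n] by (simp add: k_def del: power_Suc)
    finally show "k n * I n \<le> (1/2) ^ Suc n" .
  qed
  define \<sigma> where "\<sigma> x = (SUP n. ennreal (k n) * \<rho> n x)" for x
  have [measurable]: "\<rho> n \<in> borel_measurable borel" for n using assms by (rule Lp_measurable)
  have "(\<integral>\<^sup>+x. ennreal_rpow (\<sigma> x) p \<partial>M) = (\<integral>\<^sup>+x. (SUP n. ennreal_rpow (ennreal (k n) * \<rho> n x) p) \<partial>M)"
    unfolding \<sigma>_def using p_pos by (simp add: ennreal_rpow_SUP)
  also have "\<dots> \<le> (\<Sum>n. \<integral>\<^sup>+x. ennreal_rpow (ennreal (k n) * \<rho> n x) p \<partial>M)"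
    by (intro nn_integral_SUP_le_suminf rpow_borel_M) measurable
  also have "\<dots> \<le> (\<Sum>n. ennreal (1 * (1/2) ^ Suc n))"
  proof (intro suminf_le)
    fix n
    have "(\<integral>\<^sup>+x. ennreal_rpow (ennreal (k n) * \<rho> n x) p \<partial>M) = ennreal (k n powr p) * ennreal (I n)"
      using k(1)[of n] p_pos I(1)[of n]
      by (simp add: ennreal_rpow_mult nn_integral_cmult rpow_borel_M)
    also have "\<dots> = ennreal (k n powr p * I n)" using I(2) by (simp add: ennreal_mult)
    also have "\<dots> \<le> ennreal (k n * I n)"
    proof (intro ennreal_leI mult_right_mono I)
      have "k n powr p \<le> k n powr 1" using k[of n] p by (intro powr_mono') auto
      then show "k n powr p \<le> k n" using k(1)[of n] by simp
    qed
    also have "\<dots> \<le> ennreal (1 * (1/2) ^ Suc n)" using k(3)[of n] by (intro ennreal_leI) simp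
    finally show "(\<integral>\<^sup>+x. ennreal_rpow (ennreal (k n) * \<rho> n x) p \<partial>M) \<le> ennreal (1 * (1/2) ^ Suc n)" .
  qed auto
  also have "\<dots> = ennreal 1" by (rule suminf_half_pow) simp
  finally have "(\<integral>\<^sup>+x. ennreal_rpow (\<sigma> x) p \<partial>M) \<le> ennreal 1" .
  then have "(\<integral>\<^sup>+x. ennreal_rpow (\<sigma> x) p \<partial>M) < \<infinity>" using le_less_trans[of _ "ennreal 1" \<infinity>] by simp
  moreover have "\<sigma> \<in> borel_measurable borel" unfolding \<sigma>_def by measurable
  ultimately have "Lp \<sigma>" by (simp add: Lp_def)
  moreover have "path_integral (\<rho> n) c a b < \<infinity>" if "lip1 c" "path_integral \<sigma> c a b < \<infinity>" for n c a b
  proof -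
    have "ennreal (k n) * path_integral (\<rho> n) c a b = path_integral (\<lambda>x. ennreal (k n) * \<rho> n x) c a b"
      using that by (intro path_integral_cmult[symmetric]) auto
    also have "\<dots> \<le> path_integral \<sigma> c a b"
      unfolding \<sigma>_def by (intro path_integral_mono SUP_upper) auto
    also have "\<dots> < \<infinity>" by (rule that)
    finally show ?thesis using k(1)[of n] by (auto simp: ennreal_mult_less_top)
  qed
  ultimately show ?thesis by (rule that)
qed

section \<open>Passage between weak upper gradients and inequalities along paths\<close>

lemma weak_upper_gradientI:
  assumes "g \<in> borel_measurable borel" "Lp \<rho>" "curve_ug f g \<rho>"
  shows "weak_upper_gradient M p (\<lambda>x. ereal (f x)) g"
  unfolding weak_upper_gradient_def p_almost_every_curve_def
proof (intro conjI exI[of _ \<rho>] allI impI)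
  show "g \<in> borel_measurable M" "\<rho> \<in> borel_measurable M" "(\<integral>\<^sup>+x. ennreal_rpow (\<rho> x) p \<partial>M) < \<infinity>"
    using assms by (auto simp: Lp_def intro: borel_M)
  fix \<gamma> :: "real \<Rightarrow> 'a" and l
  assume arc: "arc_length_curve \<gamma> l"
    and bad: "\<not> (line_measurable g \<gamma> l \<and> e2ennreal \<bar>ereal (f (\<gamma> 0)) - ereal (f (\<gamma> l))\<bar> \<le> line_integral g \<gamma> l)"
  then have l: "0 < l" "continuous_on {0..l} \<gamma>" by (auto simp: arc_length_curve_def)
  show "line_measurable \<rho> \<gamma> l" using line_measurable_borel[OF l(2)] assms by (auto simp: Lp_def)
  let ?c = "\<lambda>t. \<gamma> (max 0 (min l t))"
  have c: "lip1 ?c" using arc by (rule arc_length_curve_clamp)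
  have eq: "line_integral k \<gamma> l = path_integral k ?c 0 l" if "k \<in> borel_measurable borel" for k
  proof -
    have "line_integral k \<gamma> l = line_integral k ?c l" by (rule line_integral_cong) auto
    then show ?thesis using line_integral_eq_path_integral[OF c that] by simp
  qed
  show "line_integral \<rho> \<gamma> l = \<infinity>"
  proof (rule ccontr)
    assume "line_integral \<rho> \<gamma> l \<noteq> \<infinity>"
    then have "path_integral \<rho> ?c 0 l < \<infinity>" using eq assms by (auto simp: Lp_def less_top)
    then have "ennreal \<bar>f (?c 0) - f (?c l)\<bar> \<le> path_integral g ?c 0 l"
      using l c by (intro curve_ugD[OF assms(3)]) auto
    then have "e2ennreal \<bar>ereal (f (\<gamma> 0)) - ereal (f (\<gamma> l))\<bar> \<le> line_integral g \<gamma> l"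
      using l eq[OF assms(1)] by (simp only: e2ennreal_abs_ereal_diff) simp
    with bad line_measurable_borel[OF l(2) assms(1)] show False by blast
  qed
qed

text \<open>Gradient and weight are replaced by Borel functions above them, and a path by an arc
  length curve with the same end points. All changes go in the right direction: the line integrals
  of the curve are at most the path integrals, so a path with finite weight yields a curve that is
  not exceptional.\<close>

lemma weak_upper_gradientE:
  assumes "weak_upper_gradient M p (\<lambda>x. ereal (f x)) g"
  obtains g' \<rho> where "g' \<in> borel_measurable borel" "\<And>x. g x \<le> g' x" "AE x in M. g x = g' x"
    "Lp \<rho>" "curve_ug f g' \<rho>"
proof -
  have gm: "g \<in> borel_measurable M" using assms by (simp add: weak_upper_gradient_def)
  obtain \<rho>0 where \<rho>0: "\<rho>0 \<in> borel_measurable M" "(\<integral>\<^sup>+x. ennreal_rpow (\<rho>0 x) p \<partial>M) < \<infinity>"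
    "\<And>\<gamma> l. arc_length_curve \<gamma> l \<Longrightarrow>
      \<not> (line_measurable g \<gamma> l \<and> e2ennreal \<bar>ereal (f (\<gamma> 0)) - ereal (f (\<gamma> l))\<bar> \<le> line_integral g \<gamma> l) \<Longrightarrow>
      line_integral \<rho>0 \<gamma> l = \<infinity>"
    using assms unfolding weak_upper_gradient_def p_almost_every_curve_def by blast
  obtain g' where g': "g' \<in> borel_measurable borel" "\<And>x. g x \<le> g' x" "AE x in M. g x = g' x"
    using borel_majorant[OF gm] by blast
  obtain \<rho> where \<rho>: "\<rho> \<in> borel_measurable borel" "\<And>x. \<rho>0 x \<le> \<rho> x" "AE x in M. \<rho>0 x = \<rho> x"
    using borel_majorant[OF \<rho>0(1)] by blast
  have "(\<integral>\<^sup>+x. ennreal_rpow (\<rho> x) p \<partial>M) = (\<integral>\<^sup>+x. ennreal_rpow (\<rho>0 x) p \<partial>M)"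
    using \<rho>(3) by (intro nn_integral_cong_AE) auto
  then have "Lp \<rho>" using \<rho> \<rho>0 by (simp add: Lp_def)
  moreover have "curve_ug f g' \<rho>"
    unfolding curve_ug_def
  proof (intro allI impI)
    fix c :: "real \<Rightarrow> 'a" and l :: real
    assume c: "lip1 c" "0 \<le> l" "path_integral \<rho> c 0 l < \<infinity>"
    show "ennreal \<bar>f (c 0) - f (c l)\<bar> \<le> path_integral g' c 0 l"
    proof (cases "c 0 = c l")
      case False
      obtain \<gamma> L where \<gamma>: "arc_length_curve \<gamma> L" "\<gamma> 0 = c 0" "\<gamma> L = c l"
        "\<And>h. h \<in> borel_measurable borel \<Longrightarrow> line_integral h \<gamma> L \<le> path_integral h c 0 l"
        using arc_length_reparametrization[OF c(1,2) False] by blast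
      have le: "line_integral h \<gamma> L \<le> line_integral h' \<gamma> L" if "\<And>x. h x \<le> h' x" for h h' :: "'a \<Rightarrow> ennreal"
        unfolding line_integral_def using that by (intro nn_integral_mono)
      have "line_integral \<rho>0 \<gamma> L \<le> path_integral \<rho> c 0 l"
        using le[of \<rho>0 \<rho>] \<gamma>(4)[OF \<rho>(1)] \<rho>(2) by (meson order_trans)
      then have "line_integral \<rho>0 \<gamma> L \<noteq> \<infinity>" using c(3) by auto
      then have "e2ennreal \<bar>ereal (f (\<gamma> 0)) - ereal (f (\<gamma> L))\<bar> \<le> line_integral g \<gamma> L"
        using \<rho>0(3)[OF \<gamma>(1)] by blast
      also have "\<dots> \<le> line_integral g' \<gamma> L" using g'(2) by (rule le)
      also have "\<dots> \<le> path_integral g' c 0 l" by (rule \<gamma>(4)[OF g'(1)])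
      finally show ?thesis unfolding e2ennreal_abs_ereal_diff \<gamma> .
    qed simp
  qed
  ultimately show ?thesis using g' by (intro that)
qed

section \<open>Minimal weak upper gradients\<close>

lemma countable_ball_subcover:
  fixes S :: "'a set"
  assumes "\<And>x. x \<in> S \<Longrightarrow> 0 < r x"
  obtains T where "countable T" "T \<subseteq> S" "S \<subseteq> (\<Union>x\<in>T. ball x (r x))"
proof -
  obtain Q :: "'a set" where Q: "countable Q" "\<And>x e. 0 < e \<Longrightarrow> \<exists>q\<in>Q. dist x q < e" using countable_dense by metis
  \<comment> \<open>One \<open>x\<close> is chosen for each ball with centre in the dense set and
    radius \<open>1 / Suc n\<close> that fits into some \<open>ball x (r x)\<close>; there are
    countably many of these small balls.\<close>
  define P where "P q n x \<longleftrightarrow> x \<in> S \<and> ball q (1 / real (Suc n)) \<subseteq> ball x (r x)" for q n x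
  define T where "T = (\<lambda>(q, n). SOME x. P q n x) ` {(q, n). q \<in> Q \<and> (\<exists>x. P q n x)}"
  have some: "P q n (SOME x. P q n x)" if "P q n x" for q n x using that by (rule someI)
  have "countable {(q, n :: nat). q \<in> Q \<and> (\<exists>x. P q n x)}"
    by (rule countable_subset[of _ "Q \<times> UNIV"]) (use Q in auto)
  then have "countable T" unfolding T_def by (rule countable_image)
  moreover have "T \<subseteq> S"
  proof
    fix x assume "x \<in> T"
    then obtain q n y where "P q n y" "x = (SOME x. P q n x)" unfolding T_def by auto
    then show "x \<in> S" using some[of q n y] by (simp add: P_def)
  qed
  moreover have "S \<subseteq> (\<Union>x\<in>T. ball x (r x))"
  proof
    fix x assume x: "x \<in> S"
    obtain n where n: "1 / real (Suc n) < r x / 2"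
      using reals_Archimedean[of "r x / 2"] assms[OF x] by (auto simp: inverse_eq_divide)
    obtain q where q: "q \<in> Q" "dist x q < 1 / real (Suc n)" using Q(2)[of "1 / real (Suc n)" x] by auto
    have "ball q (1 / real (Suc n)) \<subseteq> ball x (r x)"
    proof
      fix y assume "y \<in> ball q (1 / real (Suc n))"
      then show "y \<in> ball x (r x)" using dist_triangle[of x y q] q n by auto
    qed
    then have P: "P q n x" using x by (simp add: P_def)
    then have "(SOME x. P q n x) \<in> T" unfolding T_def using q by (auto intro!: image_eqI[of _ _ "(q, n)"])
    moreover have "x \<in> ball q (1 / real (Suc n))" using q by (simp add: dist_commute)
    ultimately show "x \<in> (\<Union>x\<in>T. ball x (r x))" using some[OF P] unfolding P_def by blast
  qed
  ultimately show ?thesis by (rule that)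
qed

text \<open>Competitors in the definition of the minimal gradient are only locally p-integrable.
  Countably many balls on which \<open>h\<close> is p-integrable cover the space, the restrictions
  to them share one weight, and the compact image of a path is covered by finitely many of
  them.\<close>

lemma Lp_loc_exceptional:
  assumes h: "h \<in> borel_measurable borel" "Lp_loc M p h"
  obtains \<sigma> where "Lp \<sigma>" "\<And>c a b. lip1 c \<Longrightarrow> path_integral \<sigma> c a b < \<infinity> \<Longrightarrow> path_integral h c a b < \<infinity>"
proof -
  obtain r where r: "\<And>x. 0 < r x" "\<And>x. (\<integral>\<^sup>+y\<in>ball x (r x). ennreal_rpow (h y) p \<partial>M) < \<infinity>"
    using h(2) unfolding Lp_loc_def by metis
  obtain T :: "'a set" where T: "countable T" "UNIV \<subseteq> (\<Union>x\<in>T. ball x (r x))"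
    using countable_ball_subcover[of UNIV r] r(1) by metis
  have "T \<noteq> {}" using T(2) by auto
  define B where "B n = ball (from_nat_into T n) (r (from_nat_into T n))" for n
  have B: "\<exists>n. x \<in> B n" for x
  proof -
    obtain t where "t \<in> T" "x \<in> ball t (r t)" using T(2) by blast
    then show ?thesis using from_nat_into_surj[OF T(1)] unfolding B_def by metis
  qed
  define \<rho> where "\<rho> n x = h x * indicator (B n) x" for n x
  have [measurable]: "B n \<in> sets borel" for n by (simp add: B_def)
  have \<rho>m: "\<rho> n \<in> borel_measurable borel" for n unfolding \<rho>_def using h(1) by measurable
  have "Lp (\<rho> n)" for n
  proof -
    have "(\<integral>\<^sup>+x. ennreal_rpow (\<rho> n x) p \<partial>M) = (\<integral>\<^sup>+y\<in>B n. ennreal_rpow (h y) p \<partial>M)"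
      unfolding \<rho>_def by (intro nn_integral_cong) (auto split: split_indicator)
    then show ?thesis using r(2) \<rho>m by (simp add: Lp_def B_def)
  qed
  then obtain \<sigma> where \<sigma>: "Lp \<sigma>" "\<And>n c a b. lip1 c \<Longrightarrow> path_integral \<sigma> c a b < \<infinity> \<Longrightarrow> path_integral (\<rho> n) c a b < \<infinity>"
    using Lp_countable_exceptional by metis
  have "path_integral h c a b < \<infinity>" if c: "lip1 c" "path_integral \<sigma> c a b < \<infinity>" for c a b
  proof -
    have "compact (c ` {a..b})" by (intro compact_continuous_image lip1_continuous c) auto
    moreover have "open (B n)" for n by (simp add: B_def)
    moreover have "c ` {a..b} \<subseteq> (\<Union>n\<in>UNIV. B n)" using B by blast
    ultimately obtain N where N: "finite N" "c ` {a..b} \<subseteq> (\<Union>n\<in>N. B n)"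
      using compactE_image[of "c ` {a..b}" UNIV B] by metis
    have "path_integral h c a b \<le> (\<integral>\<^sup>+t. (\<Sum>n\<in>N. \<rho> n (c t) * indicator {a..b} t) \<partial>lborel)"
      unfolding path_integral_def
    proof (intro nn_integral_mono)
      fix t
      show "h (c t) * indicator {a..b} t \<le> (\<Sum>n\<in>N. \<rho> n (c t) * indicator {a..b} t)"
      proof (cases "t \<in> {a..b}")
        case True
        then obtain n where "n \<in> N" "c t \<in> B n" using N(2) by blast
        then have "h (c t) * indicator {a..b} t = \<rho> n (c t) * indicator {a..b} t" by (simp add: \<rho>_def)
        also have "\<dots> \<le> (\<Sum>n\<in>N. \<rho> n (c t) * indicator {a..b} t)"
          using N(1) \<open>n \<in> N\<close> by (intro member_le_sum) auto
        finally show ?thesis .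
      qed simp
    qed
    also have "\<dots> = (\<Sum>n\<in>N. path_integral (\<rho> n) c a b)"
      unfolding path_integral_def using path_integral_measurable[OF c(1) \<rho>m]
      by (intro nn_integral_sum) auto
    also have "\<dots> < \<infinity>" using \<sigma>(2)[OF c] by (simp add: N(1) ennreal_sum_less_top)
    finally show ?thesis .
  qed
  with \<sigma>(1) show ?thesis by (rule that)
qed

lemma Lp_finite_loc: "Lp g \<Longrightarrow> Lp_loc M p g"
  unfolding Lp_loc_def
proof (intro conjI allI)
  assume g: "Lp g"
  then show "g \<in> borel_measurable M" by (auto simp: Lp_def intro: borel_M)
  fix x
  have "(\<integral>\<^sup>+y\<in>ball x 1. ennreal_rpow (g y) p \<partial>M) \<le> (\<integral>\<^sup>+y. ennreal_rpow (g y) p \<partial>M)"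
    by (intro nn_integral_mono) (auto split: split_indicator)
  then show "\<exists>r>0. (\<integral>\<^sup>+y\<in>ball x r. ennreal_rpow (g y) p \<partial>M) < \<infinity>"
    using g by (intro exI[of _ 1]) (auto simp: Lp_def)
qed

text \<open>Where \<tau> is integrable so are all four functions; hence both upper gradient
  inequalities hold on every subinterval, and the one-dimensional lemma applies to \<open>f\<close>
  along the path.\<close>

lemma curve_ug_min:
  fixes g h \<rho> \<sigma> \<tau> :: "'a \<Rightarrow> ennreal"
  assumes m: "g \<in> borel_measurable borel" "h \<in> borel_measurable borel"
    "\<rho> \<in> borel_measurable borel" "\<sigma> \<in> borel_measurable borel"
    and g: "curve_ug f g \<rho>" and h: "curve_ug f h \<sigma>"
    and \<tau>: "\<And>c l. lip1 c \<Longrightarrow> path_integral \<tau> c 0 l < \<infinity> \<Longrightarrow>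
      path_integral g c 0 l < \<infinity> \<and> path_integral h c 0 l < \<infinity> \<and> path_integral \<rho> c 0 l < \<infinity> \<and> path_integral \<sigma> c 0 l < \<infinity>"
  shows "curve_ug f (\<lambda>x. min (g x) (h x)) \<tau>"
  unfolding curve_ug_def
proof (intro allI impI)
  fix c :: "real \<Rightarrow> 'a" and l :: real
  assume c: "lip1 c" "0 \<le> l" "path_integral \<tau> c 0 l < \<infinity>"
  note fin = \<tau>[OF c(1,3)]
  have sub: "path_integral k c s t < \<infinity>" if "path_integral k c 0 l < \<infinity>" "0 \<le> s" "t \<le> l" for k :: "'a \<Rightarrow> ennreal" and s t
    using path_integral_subinterval[of 0 s t l k c] that by (meson le_less_trans)
  have "ennreal \<bar>(\<lambda>t. f (c t)) 0 - (\<lambda>t. f (c t)) l\<bar> \<le> (\<integral>\<^sup>+t\<in>{0..l}. min (g (c t)) (h (c t)) \<partial>lborel)"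
  proof (rule abs_diff_le_nn_integral_min[where g="\<lambda>t. g (c t)" and h="\<lambda>t. h (c t)"])
    show "(\<lambda>t. g (c t)) \<in> borel_measurable borel" "(\<lambda>t. h (c t)) \<in> borel_measurable borel"
      using path_integral_measurable[OF c(1)] m by auto
    show "(\<integral>\<^sup>+t\<in>{0..l}. g (c t) \<partial>lborel) < \<infinity>" "(\<integral>\<^sup>+t\<in>{0..l}. h (c t) \<partial>lborel) < \<infinity>"
      using fin by (auto simp: path_integral_def)
    fix s t assume st: "0 \<le> s" "s \<le> t" "t \<le> l"
    show "ennreal \<bar>f (c s) - f (c t)\<bar> \<le> (\<integral>\<^sup>+x\<in>{s..t}. g (c x) \<partial>lborel)"
      using curve_ug_segment[OF g m(1,3) c(1) st(2)] sub fin st by (simp add: path_integral_def)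
    show "ennreal \<bar>f (c s) - f (c t)\<bar> \<le> (\<integral>\<^sup>+x\<in>{s..t}. h (c x) \<partial>lborel)"
      using curve_ug_segment[OF h m(2,4) c(1) st(2)] sub fin st by (simp add: path_integral_def)
  qed (use c in auto)
  then show "ennreal \<bar>f (c 0) - f (c l)\<bar> \<le> path_integral (\<lambda>x. min (g x) (h x)) c 0 l"
    by (simp add: path_integral_def)
qed

definition ug_Lp :: "('a \<Rightarrow> real) \<Rightarrow> ('a \<Rightarrow> ennreal) \<Rightarrow> bool" where
  "ug_Lp f g \<longleftrightarrow> Lp g \<and> (\<exists>\<rho>. Lp \<rho> \<and> curve_ug f g \<rho>)"

lemma ug_Lp_weak: "ug_Lp f g \<Longrightarrow> weak_upper_gradient M p (\<lambda>x. ereal (f x)) g"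
  unfolding ug_Lp_def using weak_upper_gradientI Lp_measurable by blast

lemma ug_Lp_min:
  assumes g: "ug_Lp f g" and h: "h \<in> borel_measurable borel" "Lp_loc M p h" "Lp \<sigma>" "curve_ug f h \<sigma>"
  shows "ug_Lp f (\<lambda>x. min (g x) (h x))"
proof -
  obtain \<rho> where \<rho>: "Lp g" "Lp \<rho>" "curve_ug f g \<rho>" using g by (auto simp: ug_Lp_def)
  obtain \<kappa> where \<kappa>: "Lp \<kappa>" "\<And>c a b. lip1 c \<Longrightarrow> path_integral \<kappa> c a b < \<infinity> \<Longrightarrow> path_integral h c a b < \<infinity>"
    using Lp_loc_exceptional[OF h(1,2)] by blast
  define \<tau> where "\<tau> x = (g x + \<rho> x) + (\<sigma> x + \<kappa> x)" for x
  have \<tau>: "Lp \<tau>" unfolding \<tau>_def using \<rho> \<kappa> h by (intro Lp_add)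
  note m = Lp_measurable[OF \<rho>(1)] Lp_measurable[OF \<rho>(2)] Lp_measurable[OF h(3)] Lp_measurable[OF \<kappa>(1)]
  note [measurable] = m h(1)
  have "path_integral \<tau> c a b = (path_integral g c a b + path_integral \<rho> c a b) + (path_integral \<sigma> c a b + path_integral \<kappa> c a b)"
    if "lip1 c" for c a b
    unfolding \<tau>_def using that by (simp add: path_integral_add)
  then have "curve_ug f (\<lambda>x. min (g x) (h x)) \<tau>"
    using \<kappa>(2) by (intro curve_ug_min[OF m(1) h(1) m(2,3) \<rho>(3) h(4)]) auto
  moreover have "Lp (\<lambda>x. min (g x) (h x))"
    by (rule Lp_mono[OF \<rho>(1)]) auto
  ultimately show ?thesis using \<tau> by (auto simp: ug_Lp_def)
qed

text \<open>Pointwise minima turn an energy minimising sequence into a decreasing one, whose infimum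
  is an upper gradient by monotone convergence along curves. Its energy is least, so the minimum
  with a competitor cannot have less energy, and the infimum lies below the competitor almost
  everywhere.\<close>

lemma minimal_ug_Lp:
  assumes "ug_Lp f g0"
  obtains g where "ug_Lp f g" "is_minimal_weak_upper_gradient M p (\<lambda>x. ereal (f x)) g"
proof -
  let ?E = "\<lambda>g. \<integral>\<^sup>+x. ennreal_rpow (g x) p \<partial>M"
  define I where "I = Inf (?E ` Collect (ug_Lp f))"
  obtain a :: "nat \<Rightarrow> ennreal" where a: "range a \<subseteq> ?E ` Collect (ug_Lp f)" "I = (INF n. a n)"
    using ennreal_Inf_countable_INF[of "?E ` Collect (ug_Lp f)"] assms unfolding I_def by auto
  have "\<exists>g. ug_Lp f g \<and> ?E g = a n" for n using a(1) by (auto simp: image_subset_iff image_iff Bex_def) metis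
  then obtain G where G: "\<And>n. ug_Lp f (G n)" "\<And>n. ?E (G n) = a n" by metis
  define k where "k = rec_nat (G 0) (\<lambda>n g x. min (g x) (G (Suc n) x))"
  have k0: "k 0 = G 0" and kS: "k (Suc n) = (\<lambda>x. min (k n x) (G (Suc n) x))" for n by (simp_all add: k_def)
  have k: "ug_Lp f (k n)" for n
  proof (induction n)
    case 0 then show ?case by (simp add: k0 G)
  next
    case (Suc n)
    obtain \<sigma> where "Lp (G (Suc n))" "Lp \<sigma>" "curve_ug f (G (Suc n)) \<sigma>" using G(1)[of "Suc n"] by (auto simp: ug_Lp_def)
    then show ?case unfolding kS using Suc by (intro ug_Lp_min Lp_measurable Lp_finite_loc)
  qed
  have dec: "k (Suc n) x \<le> k n x" for n x by (simp add: kS)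
  have kG: "k n x \<le> G n x" for n x by (cases n) (simp_all add: k0 kS)
  define g where "g x = (INF n. k n x)" for x
  have km [measurable]: "k n \<in> borel_measurable borel" for n using k by (auto simp: ug_Lp_def Lp_def)
  have gm: "g \<in> borel_measurable borel" unfolding g_def by measurable
  have "g x \<le> k n x" for n x unfolding g_def by (rule INF_lower) simp
  then have "Lp g" using k[of 0] gm by (auto simp: ug_Lp_def intro: Lp_mono)
  obtain \<rho> where \<rho>: "\<And>n. Lp (\<rho> n)" "\<And>n. curve_ug f (k n) (\<rho> n)" using k unfolding ug_Lp_def by metis
  obtain \<sigma> where \<sigma>: "Lp \<sigma>" "\<And>n c a b. lip1 c \<Longrightarrow> path_integral \<sigma> c a b < \<infinity> \<Longrightarrow> path_integral (\<rho> n) c a b < \<infinity>"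
    using Lp_countable_exceptional[of \<rho>] \<rho>(1) by metis
  \<comment> \<open>The summand \<open>k 0\<close> of the weight makes the first integral along the
    curve finite, which monotone convergence of a decreasing sequence requires.\<close>
  have "curve_ug f g (\<lambda>x. \<sigma> x + k 0 x)"
    unfolding curve_ug_def
  proof (intro allI impI)
    fix c :: "real \<Rightarrow> 'a" and l :: real
    assume c: "lip1 c" "0 \<le> l" "path_integral (\<lambda>x. \<sigma> x + k 0 x) c 0 l < \<infinity>"
    then have fin: "path_integral \<sigma> c 0 l < \<infinity>" "path_integral (k 0) c 0 l < \<infinity>"
      using path_integral_add[OF c(1) Lp_measurable[OF \<sigma>(1)] km] by auto
    note [measurable] = path_integral_measurable[OF c(1) km]
    have "path_integral g c 0 l = (\<integral>\<^sup>+t. (INF n. k n (c t) * indicator {0..l} t) \<partial>lborel)"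
      unfolding path_integral_def g_def by (intro nn_integral_cong) (auto split: split_indicator)
    also have "\<dots> = (INF n. path_integral (k n) c 0 l)"
      unfolding path_integral_def using fin(2) dec
      by (intro nn_integral_monotone_convergence_INF_AE[where i=0]) (auto simp: path_integral_def intro!: mult_right_mono)
    also have "ennreal \<bar>f (c 0) - f (c l)\<bar> \<le> \<dots>"
      using \<sigma>(2)[OF c(1) fin(1)] by (intro INF_greatest curve_ugD[OF \<rho>(2) c(1,2)])
    finally show "ennreal \<bar>f (c 0) - f (c l)\<bar> \<le> path_integral g c 0 l" by simp
  qed
  moreover have "Lp (\<lambda>x. \<sigma> x + k 0 x)" using \<sigma>(1) k[of 0] by (intro Lp_add) (auto simp: ug_Lp_def)
  ultimately have g: "ug_Lp f g" using \<open>Lp g\<close> by (auto simp: ug_Lp_def)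
  have EI: "?E g \<le> I"
    unfolding a(2)
  proof (rule INF_greatest)
    fix n
    have "?E g \<le> ?E (G n)"
      using kG[of n] \<open>\<And>n x. g x \<le> k n x\<close>[of _ n] p_pos by (intro nn_integral_mono ennreal_rpow_mono) (auto intro: order_trans)
    then show "?E g \<le> a n" using G(2) by simp
  qed
  have "AE x in M. g x \<le> h x" if h: "weak_upper_gradient M p (\<lambda>x. ereal (f x)) h" "Lp_loc M p h" for h
  proof -
    obtain h' \<sigma> where h': "h' \<in> borel_measurable borel" "\<And>x. h x \<le> h' x" "AE x in M. h x = h' x"
      "Lp \<sigma>" "curve_ug f h' \<sigma>" using weak_upper_gradientE[OF h(1)] by blast
    have "Lp_loc M p h'"
      unfolding Lp_loc_def
    proof (intro conjI allI)
      show "h' \<in> borel_measurable M" using h'(1) by (rule borel_M)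
      fix x
      have "(\<integral>\<^sup>+y\<in>ball x r. ennreal_rpow (h' y) p \<partial>M) = (\<integral>\<^sup>+y\<in>ball x r. ennreal_rpow (h y) p \<partial>M)" for r
        using h'(3) by (intro nn_integral_cong_AE) auto
      then show "\<exists>r>0. (\<integral>\<^sup>+y\<in>ball x r. ennreal_rpow (h' y) p \<partial>M) < \<infinity>" using h(2) by (simp add: Lp_loc_def)
    qed
    then have mh: "ug_Lp f (\<lambda>x. min (g x) (h' x))" using g h' by (intro ug_Lp_min)
    then have "I \<le> ?E (\<lambda>x. min (g x) (h' x))" unfolding I_def by (intro Inf_lower) auto
    then have le: "?E g \<le> ?E (\<lambda>x. min (g x) (h' x))" using EI by (rule order_trans[rotated])
    \<comment> \<open>If \<open>g\<close> exceeded the minimum on a set of positive measure, the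
      energy, which is finite, would drop strictly.\<close>
    have "AE x in M. ennreal_rpow (g x) p \<le> ennreal_rpow (min (g x) (h' x)) p"
    proof (rule ccontr)
      assume "\<not> ?thesis"
      then have "?E (\<lambda>x. min (g x) (h' x)) < ?E g"
        using mh g p_pos
        by (intro nn_integral_less) (auto simp: ug_Lp_def Lp_def intro!: rpow_borel_M ennreal_rpow_mono)
      with le show False by simp
    qed
    then show ?thesis using h'(3)
    proof eventually_elim
      case (elim x)
      then have "g x \<le> min (g x) (h' x)" using ennreal_rpow_le_iff[OF p_pos] p_pos by simp
      then show ?case using elim by simp
    qed
  qed
  then have "is_minimal_weak_upper_gradient M p (\<lambda>x. ereal (f x)) g"
    unfolding is_minimal_weak_upper_gradient_def using ug_Lp_weak[OF g] \<open>Lp g\<close> by (auto intro: Lp_finite_loc)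
  with g show ?thesis by (rule that)
qed

end

subsection \<open>Strong subadditivity\<close>

lemma ennreal_less_add: "a < top \<Longrightarrow> 0 < e \<Longrightarrow> a < a + ennreal e"
  by (cases a) (auto simp: ennreal_less_iff simp flip: ennreal_plus)

context capacity_space begin

section \<open>The capacity in terms of real functions with p-integrable gradients\<close>

abbreviation energy :: "'a set \<Rightarrow> ('a \<Rightarrow> ennreal) \<Rightarrow> ennreal" where
  "energy \<Omega> g \<equiv> (\<integral>\<^sup>+x\<in>\<Omega>. ennreal_rpow (g x) p \<partial>M)"

text \<open>The gradient is part of the data, so that constructions can supply whichever upper
  gradient is at hand rather than the minimal one. Real values suffice because the functions lie
  between 0 and 1.\<close>

definition admissible :: "'a set \<Rightarrow> 'a set \<Rightarrow> ('a \<Rightarrow> real) \<Rightarrow> ('a \<Rightarrow> ennreal) \<Rightarrow> bool" where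
  "admissible E \<Omega> f g \<longleftrightarrow> f \<in> borel_measurable M \<and> ug_Lp f g \<and>
    (\<integral>\<^sup>+x. ennreal_rpow (ennreal (f x)) p \<partial>M) < \<infinity> \<and> (\<forall>x. indicator E x \<le> f x \<and> f x \<le> indicator \<Omega> x)"

lemma admissible_range: "admissible E \<Omega> f g \<Longrightarrow> 0 \<le> f x \<and> f x \<le> 1"
  by (auto simp: admissible_def intro: order_trans[OF indicator_pos_le] order_trans[OF _ indicator_le_1])

lemma minimal_weak_upper_gradient_is_minimal:
  assumes "ug_Lp f g"
  shows "is_minimal_weak_upper_gradient M p (\<lambda>x. ereal (f x)) (minimal_weak_upper_gradient M p (\<lambda>x. ereal (f x)))"
proof -
  obtain h where "is_minimal_weak_upper_gradient M p (\<lambda>x. ereal (f x)) h"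
    using minimal_ug_Lp[OF assms] by blast
  then show ?thesis unfolding minimal_weak_upper_gradient_def by (rule someI[where P="is_minimal_weak_upper_gradient M p (\<lambda>x. ereal (f x))"])
qed

lemma minimal_weak_upper_gradient_le:
  assumes "ug_Lp f g"
  shows "AE x in M. minimal_weak_upper_gradient M p (\<lambda>x. ereal (f x)) x \<le> g x"
  using minimal_weak_upper_gradient_is_minimal[OF assms] ug_Lp_weak[OF assms] assms
  unfolding is_minimal_weak_upper_gradient_def ug_Lp_def by (blast intro: Lp_finite_loc)

lemma condenser_cap_bounded_le_energy:
  assumes f: "admissible E \<Omega> f g"
  shows "condenser_cap_bounded M p E \<Omega> \<le> energy \<Omega> g"
proof -
  let ?u = "\<lambda>x. ereal (f x)"
  have g: "ug_Lp f g" using f by (simp add: admissible_def)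
  have "(INF g\<in>{g. weak_upper_gradient M p ?u g}. \<integral>\<^sup>+x. ennreal_rpow (g x) p \<partial>M) \<le> (\<integral>\<^sup>+x. ennreal_rpow (g x) p \<partial>M)"
    using ug_Lp_weak[OF g] by (intro INF_lower) simp
  also have "\<dots> < \<infinity>" using g by (simp add: ug_Lp_def Lp_def)
  finally have "newtonian_norm_pow M p ?u < \<infinity>"
    using f admissible_range[OF f] by (simp add: newtonian_norm_pow_def admissible_def abs_of_nonneg)
  moreover have "?u \<in> borel_measurable M" using f by (intro borel_measurable_ereal) (simp add: admissible_def)
  moreover have "indicator E x \<le> ?u x \<and> ?u x \<le> indicator \<Omega> x" for x
    using f unfolding admissible_def by (cases "x \<in> E"; cases "x \<in> \<Omega>") (auto dest!: spec[of _ x])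
  ultimately have "condenser_cap_bounded M p E \<Omega> \<le> (\<integral>\<^sup>+x\<in>\<Omega>. ennreal_rpow (minimal_weak_upper_gradient M p ?u x) p \<partial>M)"
    unfolding condenser_cap_bounded_def by (intro INF_lower) (simp add: newtonian_def)
  also have "\<dots> \<le> energy \<Omega> g"
    using minimal_weak_upper_gradient_le[OF g] p_pos
    by (intro nn_integral_mono_AE) (auto elim!: eventually_mono intro!: mult_right_mono ennreal_rpow_mono)
  finally show ?thesis .
qed

text \<open>The minimal gradient of a Newtonian function is p-integrable on the whole space, as it
  lies below any p-integrable weak upper gradient; a Borel function equal to it almost everywhere
  then completes an admissible pair of the same energy.\<close>

lemma condenser_cap_bounded_lessE:
  assumes "condenser_cap_bounded M p E \<Omega> < y"
  obtains f g where "admissible E \<Omega> f g" "energy \<Omega> g < y"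
proof -
  obtain u where u: "u \<in> newtonian M p" "\<And>x. indicator E x \<le> u x \<and> u x \<le> indicator \<Omega> x"
    "(\<integral>\<^sup>+x\<in>\<Omega>. ennreal_rpow (minimal_weak_upper_gradient M p u x) p \<partial>M) < y"
    using assms unfolding condenser_cap_bounded_def INF_less_iff by auto
  have u01: "0 \<le> u x" "u x \<le> 1" for x
  proof -
    have "(0::ereal) \<le> indicator E x" "indicator \<Omega> x \<le> (1::ereal)" by (auto split: split_indicator)
    then show "0 \<le> u x" "u x \<le> 1" using u(2)[of x] by (meson order_trans)+
  qed
  define f where "f x = real_of_ereal (u x)" for x
  have uf: "u x = ereal (f x)" for x
    unfolding f_def using u01[of x] by (cases "u x") auto
  then have uf': "u = (\<lambda>x. ereal (f x))" by auto
  have f0: "0 \<le> f x" for x using u01(1)[of x] by (simp add: uf)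
  have "u \<in> borel_measurable M" and nrm: "newtonian_norm_pow M p u < \<infinity>" using u(1) by (auto simp: newtonian_def)
  then have fm: "f \<in> borel_measurable M" unfolding f_def by measurable
  have fp: "(\<integral>\<^sup>+x. ennreal_rpow (ennreal (f x)) p \<partial>M) < \<infinity>"
    and "(INF g\<in>{g. weak_upper_gradient M p u g}. \<integral>\<^sup>+x. ennreal_rpow (g x) p \<partial>M) < \<infinity>"
    using nrm f0 by (simp_all add: newtonian_norm_pow_def uf' abs_of_nonneg)
  then obtain g0 where g0: "weak_upper_gradient M p u g0" "(\<integral>\<^sup>+x. ennreal_rpow (g0 x) p \<partial>M) < \<infinity>"
    unfolding INF_less_iff by auto
  have get: "\<exists>g'. ug_Lp f g' \<and> (AE x in M. g x = g' x)"
    if wu: "weak_upper_gradient M p u g" "(\<integral>\<^sup>+x. ennreal_rpow (g x) p \<partial>M) < \<infinity>" for g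
  proof -
    obtain g' \<rho> where g': "g' \<in> borel_measurable borel" "AE x in M. g x = g' x" "Lp \<rho>" "curve_ug f g' \<rho>"
      using weak_upper_gradientE[OF wu(1)[unfolded uf']] by metis
    have "(\<integral>\<^sup>+x. ennreal_rpow (g' x) p \<partial>M) = (\<integral>\<^sup>+x. ennreal_rpow (g x) p \<partial>M)"
      using g'(2) by (intro nn_integral_cong_AE) auto
    then show ?thesis using g' wu by (auto simp: ug_Lp_def Lp_def)
  qed
  obtain g1 where g1: "ug_Lp f g1" using get[OF g0] by blast
  let ?m = "minimal_weak_upper_gradient M p u"
  have "weak_upper_gradient M p u ?m"
    using minimal_weak_upper_gradient_is_minimal[OF g1] unfolding uf' is_minimal_weak_upper_gradient_def by blast
  moreover have "(\<integral>\<^sup>+x. ennreal_rpow (?m x) p \<partial>M) < \<infinity>"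
  proof -
    have "(\<integral>\<^sup>+x. ennreal_rpow (?m x) p \<partial>M) \<le> (\<integral>\<^sup>+x. ennreal_rpow (g1 x) p \<partial>M)"
      using minimal_weak_upper_gradient_le[OF g1] p_pos unfolding uf'
      by (intro nn_integral_mono_AE) (auto elim!: eventually_mono intro!: ennreal_rpow_mono)
    also have "\<dots> < \<infinity>" using g1 by (simp add: ug_Lp_def Lp_def)
    finally show ?thesis .
  qed
  ultimately obtain g where g: "ug_Lp f g" "AE x in M. ?m x = g x" using get by blast
  have "energy \<Omega> g = (\<integral>\<^sup>+x\<in>\<Omega>. ennreal_rpow (?m x) p \<partial>M)"
    using g(2) by (intro nn_integral_cong_AE) auto
  then have "energy \<Omega> g < y" using u(3) by simp
  moreover have "indicator E x \<le> f x \<and> f x \<le> indicator \<Omega> x" for x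
    using u(2)[of x] unfolding uf by (cases "x \<in> E"; cases "x \<in> \<Omega>") auto
  ultimately show ?thesis using fm fp g by (intro that) (auto simp: admissible_def)
qed

lemma condenser_cap_bounded_mono:
  assumes "E \<subseteq> F"
  shows "condenser_cap_bounded M p E \<Omega> \<le> condenser_cap_bounded M p F \<Omega>"
proof -
  have le: "indicator E x \<le> (indicator F x :: ereal)" for x using assms by (auto split: split_indicator)
  show ?thesis unfolding condenser_cap_bounded_def
    by (rule INF_superset_mono) (auto intro: order_trans[OF le])
qed

section \<open>Gradients of sums, positive parts, maxima and minima\<close>

lemma ug_Lp_add_bound:
  assumes f: "ug_Lp f g" "ug_Lp f' g'" and le: "\<And>x y. \<bar>h x - h y\<bar> \<le> \<bar>f x - f y\<bar> + \<bar>f' x - f' y\<bar>"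
  shows "ug_Lp h (\<lambda>x. g x + g' x)"
proof -
  obtain \<rho> \<sigma> where *: "Lp g" "Lp \<rho>" "curve_ug f g \<rho>" "Lp g'" "Lp \<sigma>" "curve_ug f' g' \<sigma>"
    using f by (auto simp: ug_Lp_def)
  note m = Lp_measurable[OF *(1)] Lp_measurable[OF *(2)] Lp_measurable[OF *(4)] Lp_measurable[OF *(5)]
  have "curve_ug h (\<lambda>x. g x + g' x) (\<lambda>x. \<rho> x + \<sigma> x)"
    unfolding curve_ug_def
  proof (intro allI impI)
    fix c :: "real \<Rightarrow> 'a" and l :: real
    assume c: "lip1 c" "0 \<le> l" "path_integral (\<lambda>x. \<rho> x + \<sigma> x) c 0 l < \<infinity>"
    then have fin: "path_integral \<rho> c 0 l < \<infinity>" "path_integral \<sigma> c 0 l < \<infinity>" using m by (auto simp: path_integral_add)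
    have "ennreal \<bar>h (c 0) - h (c l)\<bar> \<le> ennreal \<bar>f (c 0) - f (c l)\<bar> + ennreal \<bar>f' (c 0) - f' (c l)\<bar>"
      using le by (simp flip: ennreal_plus add: ennreal_leI)
    also have "\<dots> \<le> path_integral g c 0 l + path_integral g' c 0 l"
      using c fin by (intro add_mono curve_ugD[OF *(3)] curve_ugD[OF *(6)])
    finally show "ennreal \<bar>h (c 0) - h (c l)\<bar> \<le> path_integral (\<lambda>x. g x + g' x) c 0 l"
      using c m by (simp add: path_integral_add)
  qed
  then show ?thesis using * by (auto simp: ug_Lp_def intro: Lp_add)
qed

text \<open>The gain over the plain sum is the factor \<open>indicator B\<close>: along a curve the
  positive part vanishes on the closed set of times with \<open>u \<le> v\<close>, and only the gaps
  contribute. \<open>B\<close> is a superset because the set where \<open>v < u\<close> is merely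
  measurable for the completed measure, whereas gradients are to be Borel.\<close>

lemma ug_Lp_pos_part:
  assumes u: "ug_Lp u g" and v: "ug_Lp v h" and B: "B \<in> sets borel" "\<And>x. v x < u x \<Longrightarrow> x \<in> B"
  shows "ug_Lp (\<lambda>x. max 0 (u x - v x)) (\<lambda>x. (g x + h x) * indicator B x)"
proof -
  obtain \<rho> \<sigma> where *: "Lp g" "Lp \<rho>" "curve_ug u g \<rho>" "Lp h" "Lp \<sigma>" "curve_ug v h \<sigma>"
    using u v by (auto simp: ug_Lp_def)
  note m = Lp_measurable[OF *(1)] Lp_measurable[OF *(2)] Lp_measurable[OF *(4)] Lp_measurable[OF *(5)]
  note [measurable] = m B(1)
  \<comment> \<open>Besides \<rho> and \<sigma> the weight contains the gradients, whose integrals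
    along a curve have to be finite for \<open>u\<close> and \<open>v\<close> to be continuous
    there.\<close>
  define \<tau> where "\<tau> x = (g x + \<rho> x) + (h x + \<sigma> x)" for x
  have \<tau>: "Lp \<tau>" unfolding \<tau>_def using * by (intro Lp_add)
  have "curve_ug (\<lambda>x. max 0 (u x - v x)) (\<lambda>x. (g x + h x) * indicator B x) \<tau>"
    unfolding curve_ug_def
  proof (intro allI impI)
    fix c :: "real \<Rightarrow> 'a" and l :: real
    assume c: "lip1 c" "0 \<le> l" "path_integral \<tau> c 0 l < \<infinity>"
    have fin: "path_integral g c 0 l < \<infinity>" "path_integral h c 0 l < \<infinity>" "path_integral \<rho> c 0 l < \<infinity>" "path_integral \<sigma> c 0 l < \<infinity>"
      using c unfolding \<tau>_def by (auto simp: path_integral_add)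
    have sub: "path_integral k c s t < \<infinity>" if "path_integral k c 0 l < \<infinity>" "0 \<le> s" "t \<le> l" for k :: "'a \<Rightarrow> ennreal" and s t
      using path_integral_subinterval[of 0 s t l k c] that by (meson le_less_trans)
    have useg: "ennreal \<bar>u (c s) - u (c t)\<bar> \<le> path_integral g c s t" if "0 \<le> s" "s \<le> t" "t \<le> l" for s t
      using that sub fin by (intro curve_ug_segment[OF *(3) m(1,2) c(1)]) auto
    have vseg: "ennreal \<bar>v (c s) - v (c t)\<bar> \<le> path_integral h c s t" if "0 \<le> s" "s \<le> t" "t \<le> l" for s t
      using that sub fin by (intro curve_ug_segment[OF *(6) m(3,4) c(1)]) auto
    note pm [measurable] = path_integral_measurable[OF c(1) m(1)] path_integral_measurable[OF c(1) m(3)]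
    have cu: "continuous_on {0..l} (\<lambda>t. u (c t))"
      using useg fin by (intro continuous_on_of_abs_diff_le_nn_integral[OF pm(1)]) (auto simp: path_integral_def)
    have cv: "continuous_on {0..l} (\<lambda>t. v (c t))"
      using vseg fin by (intro continuous_on_of_abs_diff_le_nn_integral[OF pm(2)]) (auto simp: path_integral_def)
    define Z where "Z = {t\<in>{0..l}. u (c t) \<le> v (c t)}"
    have "closed Z" unfolding Z_def using cu cv by (intro continuous_on_closed_Collect_le) auto
    let ?w = "\<lambda>t. max 0 (u (c t) - v (c t))"
    have "ennreal \<bar>?w 0 - ?w l\<bar> \<le> (\<integral>\<^sup>+t\<in>{0..l}. (g (c t) + h (c t)) * indicator (- Z) t \<partial>lborel)"
    proof (rule abs_diff_le_nn_integral_off_zeros[OF \<open>closed Z\<close> c(2)])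
      fix s t assume st: "0 \<le> s" "s \<le> t" "t \<le> l"
      have "\<bar>?w s - ?w t\<bar> \<le> \<bar>u (c s) - u (c t)\<bar> + \<bar>v (c s) - v (c t)\<bar>" by (auto simp: max_def abs_if)
      then have "ennreal \<bar>?w s - ?w t\<bar> \<le> ennreal \<bar>u (c s) - u (c t)\<bar> + ennreal \<bar>v (c s) - v (c t)\<bar>"
        by (simp flip: ennreal_plus add: ennreal_leI)
      also have "\<dots> \<le> path_integral g c s t + path_integral h c s t"
        using st by (intro add_mono useg vseg)
      also have "\<dots> = (\<integral>\<^sup>+x\<in>{s..t}. g (c x) + h (c x) \<partial>lborel)"
        using path_integral_add[OF c(1) m(1,3)] by (simp add: path_integral_def)
      finally show "ennreal \<bar>?w s - ?w t\<bar> \<le> (\<integral>\<^sup>+x\<in>{s..t}. g (c x) + h (c x) \<partial>lborel)" .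
    qed (auto simp: Z_def)
    also have "\<dots> \<le> path_integral (\<lambda>x. (g x + h x) * indicator B x) c 0 l"
      unfolding path_integral_def
    proof (intro nn_integral_mono)
      fix t
      have "c t \<in> B" if "t \<in> {0..l}" "t \<notin> Z" using that B(2)[of "c t"] by (auto simp: Z_def)
      then show "(g (c t) + h (c t)) * indicator (- Z) t * indicator {0..l} t \<le> (g (c t) + h (c t)) * indicator B (c t) * indicator {0..l} t"
        by (auto split: split_indicator)
    qed
    finally show "ennreal \<bar>max 0 (u (c 0) - v (c 0)) - max 0 (u (c l) - v (c l))\<bar> \<le>
      path_integral (\<lambda>x. (g x + h x) * indicator B x) c 0 l" .
  qed
  moreover have "Lp (\<lambda>x. (g x + h x) * indicator B x)"
    by (rule Lp_mono[OF Lp_add[OF *(1,4)]]) (auto split: split_indicator)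
  ultimately show ?thesis using \<tau> by (auto simp: ug_Lp_def)
qed

lemma ug_Lp_min2:
  assumes "ug_Lp f g" "ug_Lp f h"
  shows "ug_Lp f (\<lambda>x. min (g x) (h x))"
proof -
  obtain \<sigma> where "Lp h" "Lp \<sigma>" "curve_ug f h \<sigma>" using assms(2) by (auto simp: ug_Lp_def)
  then show ?thesis using assms(1) by (intro ug_Lp_min Lp_measurable Lp_finite_loc)
qed

text \<open>With \<open>w = max 0 (u - v)\<close> both \<open>max u v = v + w\<close> and \<open>max u v = u + max 0 (v - u)\<close>; the minimum
  of the two resulting upper gradients is, almost everywhere, the one of the larger function.\<close>

lemma admissible_max_min:
  assumes u: "admissible A \<Omega> u g" and v: "admissible B \<Omega> v h" and "open \<Omega>"
  obtains gM gm where "admissible (A \<union> B) \<Omega> (\<lambda>x. max (u x) (v x)) gM"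
    "admissible (A \<inter> B) \<Omega> (\<lambda>x. min (u x) (v x)) gm"
    "energy \<Omega> gM + energy \<Omega> gm \<le> energy \<Omega> g + energy \<Omega> h"
proof -
  have um [measurable]: "u \<in> borel_measurable M" and ug: "ug_Lp u g" using u by (auto simp: admissible_def)
  have vm [measurable]: "v \<in> borel_measurable M" and vh: "ug_Lp v h" using v by (auto simp: admissible_def)
  have "{x \<in> space M. v x < u x} \<in> sets M" by measurable
  then obtain P where P: "P \<in> sets borel" "{x. v x < u x} \<subseteq> P" "AE x in M. x \<in> P \<longrightarrow> v x < u x"
    using borel_superset[of "{x. v x < u x}"] by auto
  have "{x \<in> space M. u x < v x} \<in> sets M" by measurable
  then obtain N where N: "N \<in> sets borel" "{x. u x < v x} \<subseteq> N" "AE x in M. x \<in> N \<longrightarrow> u x < v x"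
    using borel_superset[of "{x. u x < v x}"] by auto
  have p1: "ug_Lp (\<lambda>x. max 0 (u x - v x)) (\<lambda>x. (g x + h x) * indicator P x)"
    using P by (intro ug_Lp_pos_part ug vh) auto
  have p2: "ug_Lp (\<lambda>x. max 0 (v x - u x)) (\<lambda>x. (h x + g x) * indicator N x)"
    using N by (intro ug_Lp_pos_part ug vh) auto
  define a where "a x = g x + (g x + h x) * indicator P x" for x
  define a' where "a' x = g x + (h x + g x) * indicator N x" for x
  define b where "b x = h x + (g x + h x) * indicator P x" for x
  define b' where "b' x = h x + (h x + g x) * indicator N x" for x
  let ?mx = "\<lambda>x. max (u x) (v x)" and ?mn = "\<lambda>x. min (u x) (v x)"
  have M1: "ug_Lp ?mx b" unfolding b_def by (rule ug_Lp_add_bound[OF vh p1]) (auto simp: max_def)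
  have M2: "ug_Lp ?mx a'" unfolding a'_def by (rule ug_Lp_add_bound[OF ug p2]) (auto simp: max_def)
  have m1: "ug_Lp ?mn a" unfolding a_def by (rule ug_Lp_add_bound[OF ug p1]) (auto simp: max_def min_def)
  have m2: "ug_Lp ?mn b'" unfolding b'_def by (rule ug_Lp_add_bound[OF vh p2]) (auto simp: max_def min_def)
  define gM where "gM x = min (b x) (a' x)" for x
  define gm where "gm x = min (a x) (b' x)" for x
  have gM: "ug_Lp ?mx gM" unfolding gM_def by (rule ug_Lp_min2[OF M1 M2])
  have gm: "ug_Lp ?mn gm" unfolding gm_def by (rule ug_Lp_min2[OF m1 m2])
  have meas: "(\<lambda>x. ennreal_rpow (k x) p) \<in> borel_measurable M" if "ug_Lp f k" for f k
    using that by (auto simp: ug_Lp_def Lp_def intro!: rpow_borel_M)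
  have [measurable]: "\<Omega> \<in> sets M" using \<open>open \<Omega>\<close> by (intro sets_M borel_open)
  note [measurable] = meas[OF gM] meas[OF gm] meas[OF ug] meas[OF vh]
  have "energy \<Omega> gM + energy \<Omega> gm = (\<integral>\<^sup>+x\<in>\<Omega>. ennreal_rpow (gM x) p + ennreal_rpow (gm x) p \<partial>M)"
    by (subst nn_integral_add[symmetric]) (auto simp: distrib_right)
  also have "\<dots> \<le> (\<integral>\<^sup>+x\<in>\<Omega>. ennreal_rpow (g x) p + ennreal_rpow (h x) p \<partial>M)"
    using P(3) N(3)
  proof (intro nn_integral_mono_AE, eventually_elim)
    case (elim x)
    \<comment> \<open>The two strict inequalities exclude each other. Off \<open>P\<close> the
      gradient of the maximum is at most \<open>h\<close> and that of the minimum at most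
      \<open>g\<close>; off \<open>N\<close> the roles are exchanged.\<close>
    have "x \<notin> P \<or> x \<notin> N" using elim by auto
    then have "ennreal_rpow (gM x) p + ennreal_rpow (gm x) p \<le> ennreal_rpow (g x) p + ennreal_rpow (h x) p"
    proof
      assume "x \<notin> P"
      then have "gM x \<le> h x" "gm x \<le> g x" by (auto simp: gM_def gm_def a_def b_def)
      then show ?thesis using p_pos by (subst add.commute) (intro add_mono ennreal_rpow_mono)
    next
      assume "x \<notin> N"
      then have "gM x \<le> g x" "gm x \<le> h x" by (auto simp: gM_def gm_def a'_def b'_def)
      then show ?thesis using p_pos by (intro add_mono ennreal_rpow_mono)
    qed
    then show ?case by (intro mult_right_mono) auto
  qed
  also have "\<dots> = energy \<Omega> g + energy \<Omega> h"
    by (subst nn_integral_add[symmetric]) (auto simp: distrib_right)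
  finally have E: "energy \<Omega> gM + energy \<Omega> gm \<le> energy \<Omega> g + energy \<Omega> h" .
  have up: "(\<integral>\<^sup>+x. ennreal_rpow (ennreal (u x)) p \<partial>M) < \<infinity>" "(\<integral>\<^sup>+x. ennreal_rpow (ennreal (v x)) p \<partial>M) < \<infinity>"
    using u v by (auto simp: admissible_def)
  have "(\<integral>\<^sup>+x. ennreal_rpow (ennreal (?mx x)) p \<partial>M) \<le> (\<integral>\<^sup>+x. ennreal_rpow (ennreal (u x)) p + ennreal_rpow (ennreal (v x)) p \<partial>M)"
    by (intro nn_integral_mono) (auto simp: max_def add_increasing add_increasing2)
  also have "\<dots> = (\<integral>\<^sup>+x. ennreal_rpow (ennreal (u x)) p \<partial>M) + (\<integral>\<^sup>+x. ennreal_rpow (ennreal (v x)) p \<partial>M)"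
    by (rule nn_integral_add) measurable
  also have "\<dots> < \<infinity>" using up by simp
  finally have mxp: "(\<integral>\<^sup>+x. ennreal_rpow (ennreal (?mx x)) p \<partial>M) < \<infinity>" .
  have mnp: "(\<integral>\<^sup>+x. ennreal_rpow (ennreal (?mn x)) p \<partial>M) < \<infinity>"
    using p_pos by (intro le_less_trans[OF nn_integral_mono up(1)] ennreal_rpow_mono ennreal_leI) auto
  have bd: "indicator A x \<le> u x \<and> u x \<le> indicator \<Omega> x" "indicator B x \<le> v x \<and> v x \<le> indicator \<Omega> x" for x
    using u v by (auto simp: admissible_def)
  have "indicator (A \<union> B) x \<le> ?mx x \<and> ?mx x \<le> indicator \<Omega> x" for x
    using bd[of x] admissible_range[OF u, of x] admissible_range[OF v, of x]
    by (cases "x \<in> A"; cases "x \<in> B"; cases "x \<in> \<Omega>") auto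
  moreover have "indicator (A \<inter> B) x \<le> ?mn x \<and> ?mn x \<le> indicator \<Omega> x" for x
    using bd[of x] admissible_range[OF u, of x] admissible_range[OF v, of x]
    by (cases "x \<in> A"; cases "x \<in> B"; cases "x \<in> \<Omega>") auto
  ultimately show ?thesis using gM gm mxp mnp E by (intro that[of gM gm]) (auto simp: admissible_def)
qed

lemma condenser_cap_bounded_strong_subadditive:
  assumes "open \<Omega>"
  shows "condenser_cap_bounded M p (A \<union> B) \<Omega> + condenser_cap_bounded M p (A \<inter> B) \<Omega>
    \<le> condenser_cap_bounded M p A \<Omega> + condenser_cap_bounded M p B \<Omega>" (is "?l \<le> ?a + ?b")
proof (rule ennreal_le_epsilon)
  fix e :: real assume fin: "?a + ?b < top" and e: "0 < e"
  have "?a < ?a + ennreal (e/2)" "?b < ?b + ennreal (e/2)"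
    using fin e by (auto intro!: ennreal_less_add)
  note less = this
  obtain u g where u: "admissible A \<Omega> u g" "energy \<Omega> g < ?a + ennreal (e/2)"
    by (rule condenser_cap_bounded_lessE[OF less(1)])
  obtain v h where v: "admissible B \<Omega> v h" "energy \<Omega> h < ?b + ennreal (e/2)"
    by (rule condenser_cap_bounded_lessE[OF less(2)])
  obtain gM gm where M: "admissible (A \<union> B) \<Omega> (\<lambda>x. max (u x) (v x)) gM"
    "admissible (A \<inter> B) \<Omega> (\<lambda>x. min (u x) (v x)) gm"
    "energy \<Omega> gM + energy \<Omega> gm \<le> energy \<Omega> g + energy \<Omega> h"
    using admissible_max_min[OF u(1) v(1) assms] by blast
  have "?l \<le> energy \<Omega> gM + energy \<Omega> gm"
    using M by (intro add_mono condenser_cap_bounded_le_energy)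
  also have "\<dots> \<le> energy \<Omega> g + energy \<Omega> h" by (rule M)
  also have "\<dots> \<le> (?a + ennreal (e/2)) + (?b + ennreal (e/2))"
    using u v by (intro add_mono less_imp_le)
  also have "\<dots> = ?a + ?b + (ennreal (e/2) + ennreal (e/2))" by (simp add: algebra_simps)
  also have "ennreal (e/2) + ennreal (e/2) = ennreal e" using e by (simp flip: ennreal_plus)
  finally show "?l \<le> ?a + ?b + ennreal e" .
qed

end

subsection \<open>Approximation by lower semicontinuous functions\<close>

text \<open>The Arzela-Ascoli theorem for 1-Lipschitz paths: compactness of a countable product
  yields a subsequence converging at all rational times, and the common Lipschitz bound extends the
  convergence to every time.\<close>

lemma lip1_subsequence_limit:
  fixes c :: "nat \<Rightarrow> real \<Rightarrow> 'a::metric_space"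
  assumes lip: "\<And>n. lip1 (c n)" and S: "compact S" "\<And>n t. c n t \<in> S"
  obtains r c' where "strict_mono r" "lip1 c'" "\<And>t. (\<lambda>n. c (r n) t) \<longlonglongrightarrow> c' t"
proof -
  define q where "q i = (from_nat_into \<rat> i :: real)" for i
  have q: "\<exists>i. \<bar>q i - t\<bar> < e" if "0 < e" for t e
  proof -
    obtain s where "s \<in> \<rat>" "t < s" "s < t + e" using Rats_dense_in_real[of t "t + e"] \<open>0 < e\<close> by auto
    moreover then obtain i where "q i = s" using from_nat_into_surj[OF countable_rat, of s] unfolding q_def by auto
    ultimately show ?thesis by (intro exI[of _ i]) auto
  qed
  have "compactin (product_topology (\<lambda>i. euclidean) (UNIV :: nat set)) (PiE UNIV (\<lambda>i. S))"
    using S by (subst compactin_PiE) auto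
  then have "compact (PiE UNIV (\<lambda>i::nat. S))" by (simp add: euclidean_product_topology)
  then have "seq_compact (PiE UNIV (\<lambda>i::nat. S))" by (simp add: compact_eq_seq_compact_metric)
  moreover have "\<forall>n. (\<lambda>i. c n (q i)) \<in> PiE UNIV (\<lambda>i::nat. S)" using S(2) by auto
  ultimately obtain F r where r: "strict_mono r" "((\<lambda>n i. c n (q i)) \<circ> r) \<longlonglongrightarrow> F"
    by (rule seq_compactE) blast
  have lim: "(\<lambda>n. c (r n) (q i)) \<longlonglongrightarrow> F i" for i
    using continuous_on_tendsto_compose[OF continuous_on_product_coordinates r(2), of i] by (simp add: o_def)
  have "\<exists>z. (\<lambda>n. c (r n) t) \<longlonglongrightarrow> z" for t
  proof -
    have "Cauchy (\<lambda>n. c (r n) t)"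
    proof (rule metric_CauchyI)
      fix e :: real assume "0 < e"
      then obtain i where i: "\<bar>q i - t\<bar> < e/3" using q[of "e/3" t] by auto
      have "Cauchy (\<lambda>n. c (r n) (q i))" using lim by (rule LIMSEQ_imp_Cauchy)
      then obtain N where N: "\<And>m n. m \<ge> N \<Longrightarrow> n \<ge> N \<Longrightarrow> dist (c (r m) (q i)) (c (r n) (q i)) < e/3"
        using metric_CauchyD[of _ "e/3"] \<open>0 < e\<close> by (metis divide_pos_pos zero_less_numeral)
      have "dist (c (r m) t) (c (r n) t) < e" if "m \<ge> N" "n \<ge> N" for m n
      proof -
        have "dist (c (r m) t) (c (r n) t) \<le> dist (c (r m) t) (c (r m) (q i)) + dist (c (r m) (q i)) (c (r n) t)" by (rule dist_triangle)
        moreover have "dist (c (r m) (q i)) (c (r n) t) \<le> dist (c (r m) (q i)) (c (r n) (q i)) + dist (c (r n) (q i)) (c (r n) t)" by (rule dist_triangle)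
        moreover have "dist (c (r m) t) (c (r m) (q i)) < e/3" "dist (c (r n) (q i)) (c (r n) t) < e/3"
          using lip1D[OF lip, of "r m" "q i" t] lip1D[OF lip, of "r n" "q i" t] i by (auto simp: dist_commute)
        ultimately show ?thesis using N[OF that] by linarith
      qed
      then show "\<exists>N. \<forall>m\<ge>N. \<forall>n\<ge>N. dist (c (r m) t) (c (r n) t) < e" by blast
    qed
    moreover have "complete S" using S(1) by (rule compact_imp_complete)
    ultimately obtain z where "(\<lambda>n. c (r n) t) \<longlonglongrightarrow> z"
      using completeE[of S "\<lambda>n. c (r n) t"] S(2) by metis
    then show ?thesis by blast
  qed
  then obtain c' where c': "\<And>t. (\<lambda>n. c (r n) t) \<longlonglongrightarrow> c' t" by metis
  have "lip1 c'"
    unfolding lip1_def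
  proof (intro allI)
    fix s t
    have "(\<lambda>n. dist (c (r n) s) (c (r n) t)) \<longlonglongrightarrow> dist (c' s) (c' t)" by (intro tendsto_dist c')
    then show "dist (c' s) (c' t) \<le> \<bar>s - t\<bar>"
      using lip1D[OF lip] by (intro LIMSEQ_le_const2) auto
  qed
  then show ?thesis using r(1) c' by (intro that)
qed

section \<open>The distance weighted by a cost density\<close>

definition paths_to :: "'a::metric_space set \<Rightarrow> 'a \<Rightarrow> ((real \<Rightarrow> 'a) \<times> real) set" where
  "paths_to D y = {(c, l). lip1 c \<and> range c \<subseteq> D \<and> 0 \<le> l \<and> c l = y}"

definition path_cost :: "('a::metric_space \<Rightarrow> ennreal) \<Rightarrow> ('a \<Rightarrow> ennreal) \<Rightarrow> (real \<Rightarrow> 'a) \<times> real \<Rightarrow> ennreal" where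
  "path_cost h g = (\<lambda>(c, l). h (c 0) + path_integral g c 0 l)"

text \<open>The cap at 1 keeps the value finite. Outside \<open>D\<close> the infimum runs over the
  empty set, so the value there is 1.\<close>

definition path_value :: "('a::metric_space \<Rightarrow> ennreal) \<Rightarrow> ('a \<Rightarrow> ennreal) \<Rightarrow> 'a set \<Rightarrow> 'a \<Rightarrow> ennreal" where
  "path_value h g D y = min 1 (INF \<pi>\<in>paths_to D y. path_cost h g \<pi>)"

lemma path_value_le_cost: "\<pi> \<in> paths_to D y \<Longrightarrow> path_value h g D y \<le> path_cost h g \<pi>"
  unfolding path_value_def by (rule min.coboundedI2) (rule INF_lower)

lemma path_value_le_1: "path_value h g D y \<le> 1"
  by (simp add: path_value_def)

lemma path_value_geI:
  "a \<le> 1 \<Longrightarrow> (\<And>\<pi>. \<pi> \<in> paths_to D y \<Longrightarrow> a \<le> path_cost h g \<pi>) \<Longrightarrow> a \<le> path_value h g D y"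
  unfolding path_value_def by (auto intro: INF_greatest)

lemma path_value_le_start:
  assumes "y \<in> D"
  shows "path_value h g D y \<le> h y"
proof -
  have "((\<lambda>_. y), 0) \<in> paths_to D y" using assms by (auto simp: paths_to_def lip1_def)
  then have "path_value h g D y \<le> path_cost h g ((\<lambda>_. y), 0)" by (rule path_value_le_cost)
  moreover have "path_integral g (\<lambda>_. y) 0 0 = 0"
    unfolding path_integral_def by (subst nn_integral_0_iff_AE) (auto intro: AE_mp[OF AE_lborel_singleton[of 0]])
  ultimately show ?thesis by (simp add: path_cost_def)
qed

text \<open>A path ending at \<open>c s\<close> can be continued along \<open>c\<close> to
  \<open>c t\<close>, at the additional cost of the integral of \<open>g\<close>. Together with the
  reversed path this says that \<open>g\<close> is an upper gradient of the value along paths inside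
  \<open>D\<close>.\<close>

lemma path_value_segment:
  assumes g: "g \<in> borel_measurable borel" and c: "lip1 c" "s \<le> t" "c ` {s..t} \<subseteq> D"
  shows "path_value h g D (c t) \<le> path_value h g D (c s) + path_integral g c s t"
proof -
  let ?I = "path_integral g c s t"
  \<comment> \<open>With the integral subtracted on the left the claim can be tested against each
    single path ending at \<open>c s\<close>; subtraction is truncated at 0.\<close>
  have "path_value h g D (c t) - ?I \<le> path_value h g D (c s)"
  proof (rule path_value_geI)
    show "path_value h g D (c t) - ?I \<le> 1"
      using path_value_le_1 by (intro ennreal_diff_le_mono_left)
    fix \<pi> assume "\<pi> \<in> paths_to D (c s)"
    then obtain d k where \<pi>: "\<pi> = (d, k)" and d: "lip1 d" "range d \<subseteq> D" "0 \<le> k" "d k = c s"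
      by (auto simp: paths_to_def)
    \<comment> \<open>The piece of \<open>c\<close> on \<open>[s, t]\<close>, shifted to start at
      time \<open>k\<close>, where \<open>d\<close> arrives at \<open>c s\<close>, and clamped so
      that it stays in \<open>D\<close> at all times.\<close>
    define b where "b \<tau> = c (max s (min t (s - k + \<tau>)))" for \<tau>
    define e where "e \<tau> = (if \<tau> \<le> k then d \<tau> else b \<tau>)" for \<tau>
    have b: "lip1 b"
      unfolding b_def using c(1)
    proof (rule lip1_compose)
      fix x y
      show "\<bar>max s (min t (s - k + x)) - max s (min t (s - k + y))\<bar> \<le> \<bar>x - y\<bar>"
        using clamp_nonexpansive[of s t "s - k + x" "s - k + y"] by simp
    qed
    have bk: "b k = d k" using d c(2) by (simp add: b_def)
    have le: "dist (d x) (b y) \<le> y - x" if "x \<le> k" "k \<le> y" for x y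
    proof -
      have "dist (d x) (b y) \<le> dist (d x) (d k) + dist (b k) (b y)" unfolding bk by (rule dist_triangle)
      then show ?thesis using lip1D[OF d(1), of x k] lip1D[OF b, of k y] that by linarith
    qed
    have "lip1 e"
      unfolding lip1_def
    proof (intro allI)
      fix x y show "dist (e x) (e y) \<le> \<bar>x - y\<bar>"
        using le[of x y] le[of y x] lip1D[OF d(1), of x y] lip1D[OF b, of x y]
        by (auto simp: e_def dist_commute)
    qed
    moreover have "range e \<subseteq> D"
    proof
      fix z assume "z \<in> range e"
      then obtain \<tau> where "z = e \<tau>" by auto
      moreover have "b \<tau> \<in> D" using c(2,3) by (auto simp: b_def)
      ultimately show "z \<in> D" using d(2) by (auto simp: e_def)
    qed
    moreover have et: "e (k + (t - s)) = c t"
      using bk d(4) c(2) by (cases "t = s") (auto simp: e_def b_def)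
    ultimately have "(e, k + (t - s)) \<in> paths_to D (c t)" using d(3) c(2) by (auto simp: paths_to_def)
    then have "path_value h g D (c t) \<le> path_cost h g (e, k + (t - s))" by (rule path_value_le_cost)
    also have "\<dots> = h (d 0) + (path_integral g e 0 k + path_integral g e k (k + (t - s)))"
      unfolding path_cost_def using d c \<open>lip1 e\<close> g by (simp add: path_integral_split) (simp add: e_def)
    also have "path_integral g e 0 k = path_integral g d 0 k"
      by (rule path_integral_cong) (simp add: e_def)
    also have "path_integral g e k (k + (t - s)) = path_integral g (\<lambda>\<tau>. c (s - k + \<tau>)) k (k + (t - s))"
    proof (rule path_integral_cong)
      fix \<tau> assume \<tau>: "k \<le> \<tau>" "\<tau> \<le> k + (t - s)"
      have "e \<tau> = b \<tau>" using \<tau> bk by (auto simp: e_def dest: order_antisym)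
      then show "g (e \<tau>) = g (c (s - k + \<tau>))" using \<tau> by (simp add: b_def)
    qed
    also have "\<dots> = ?I" using path_integral_shift[OF c(1) g, of "s - k" k "k + (t - s)"] by simp
    finally have "path_value h g D (c t) \<le> ?I + path_cost h g \<pi>"
      by (simp add: \<pi> path_cost_def algebra_simps)
    then show "path_value h g D (c t) - ?I \<le> path_cost h g \<pi>"
      using path_value_le_1[of h g D "c t"] by (auto simp: ennreal_minus_le_iff top_unique)
  qed
  then show ?thesis
    using path_value_le_1[of h g D "c t"] by (simp add: ennreal_minus_le_iff add.commute)
qed

lemma path_value_segment':
  assumes g: "g \<in> borel_measurable borel" and c: "lip1 c" "s \<le> t" "c ` {s..t} \<subseteq> D"
  shows "path_value h g D (c s) \<le> path_value h g D (c t) + path_integral g c s t"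
proof -
  have "lip1 (\<lambda>\<tau>. c (s + t - \<tau>))" using c(1) by (rule lip1_compose) auto
  moreover have "(\<lambda>\<tau>. c (s + t - \<tau>)) ` {s..t} \<subseteq> D" using c(3) by auto
  ultimately show ?thesis
    using path_value_segment[OF g, of "\<lambda>\<tau>. c (s + t - \<tau>)" s t D h] path_integral_reverse[OF c(1) g, of "s + t" s t] c(2)
    by simp
qed

text \<open>Compactness of almost minimising paths: where a path leaves a compact set \<open>K\<close> its cost is large,
  so it stays close to \<open>K\<close> or to its end point, and the union of all paths is totally bounded.\<close>

lemma path_value_lsc:
  fixes g h :: "'a::metric_space \<Rightarrow> ennreal"
  assumes D: "complete D" and g: "lsc g" "\<And>x. 1 \<le> g x" and h: "lsc h"
    and tight: "\<And>B. \<exists>K. compact K \<and> K \<subseteq> D \<and> (\<forall>x\<in>D - K. ennreal B \<le> g x)"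
  shows "lsc (path_value h g D)"
proof -
  have gm: "g \<in> borel_measurable borel" using g(1) by (rule lsc_measurable)
  have cD: "closed D" using D by (rule complete_imp_closed)
  \<comment> \<open>Below the cap a small value comes from actual paths, which can be extracted;
    heights of at least 1 are never exceeded.\<close>
  have main: "path_value h g D y \<le> ennreal t"
    if Y: "Y \<longlonglongrightarrow> y" and t: "0 \<le> t" "t < 1" and vY: "\<And>n. path_value h g D (Y n) \<le> ennreal t" for Y y t
  proof -
    have "\<exists>\<pi>. \<pi> \<in> paths_to D (Y n) \<and> path_cost h g \<pi> < ennreal (t + 1 / real (Suc n))" for n
    proof -
      have "(INF \<pi>\<in>paths_to D (Y n). path_cost h g \<pi>) \<le> ennreal t"
        using vY[of n] t unfolding path_value_def by (auto simp: min_le_iff_disj)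
      also have "\<dots> < ennreal (t + 1 / real (Suc n))" using t by (intro ennreal_lessI) (auto intro: add_nonneg_pos)
      finally show ?thesis unfolding INF_less_iff by auto
    qed
    then obtain \<pi> where \<pi>: "\<And>n. \<pi> n \<in> paths_to D (Y n)" "\<And>n. path_cost h g (\<pi> n) < ennreal (t + 1 / real (Suc n))"
      by metis
    define b where "b n = fst (\<pi> n)" for n
    define l where "l n = snd (\<pi> n)" for n
    have b: "lip1 (b n)" "range (b n) \<subseteq> D" "0 \<le> l n" "b n (l n) = Y n" for n
      using \<pi>(1)[of n] by (auto simp: paths_to_def b_def l_def split_beta)
    \<comment> \<open>Clamping discards the behaviour of the paths outside \<open>[0, l n]\<close>,
      on which the cost has no influence.\<close>
    define c where "c n s = b n (max 0 (min (l n) s))" for n s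
    have c: "lip1 (c n)" for n unfolding c_def using b(1) clamp_nonexpansive by (rule lip1_compose)
    have cD': "c n s \<in> D" for n s using b(2) by (auto simp: c_def)
    have cl: "c n (l n) = Y n" for n using b by (simp add: c_def)
    have cost: "h (c n 0) + path_integral g (c n) 0 (l n) < ennreal (t + 1 / real (Suc n))" for n
    proof -
      have "path_integral g (c n) 0 (l n) = path_integral g (b n) 0 (l n)"
        by (rule path_integral_cong) (simp add: c_def)
      then show ?thesis using \<pi>(2)[of n] b(3)[of n] by (simp add: path_cost_def split_beta b_def l_def c_def)
    qed
    have cost2: "path_integral g (c n) 0 (l n) < ennreal 2" for n
    proof -
      have "path_integral g (c n) 0 (l n) \<le> h (c n 0) + path_integral g (c n) 0 (l n)" by (simp add: add_increasing)
      also have "\<dots> < ennreal (t + 1 / real (Suc n))" by (rule cost)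
      also have "\<dots> \<le> ennreal 2"
      proof (intro ennreal_leI)
        have "1 / real (Suc n) \<le> 1" by simp
        then show "t + 1 / real (Suc n) \<le> 2" using t by linarith
      qed
      finally show ?thesis .
    qed
    \<comment> \<open>Since \<open>g\<close> is at least 1, the integral bounds the duration, and it
      is below 2 as \<open>t < 1\<close>.\<close>
    have l2: "l n \<le> 2" for n
    proof -
      have "ennreal (l n) = path_integral (\<lambda>x. 1) (c n) 0 (l n)"
        using path_integral_const[of 0 "l n" 1 "c n"] b(3)[of n] by simp
      also have "\<dots> \<le> path_integral g (c n) 0 (l n)" using g(2) by (intro path_integral_mono)
      also have "\<dots> < ennreal 2" by (rule cost2)
      finally show ?thesis using b(3)[of n] by (simp add: ennreal_less_iff)
    qed
    define R where "R = (\<Union>n. range (c n))"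
    have near: "\<exists>F. finite F \<and> R \<subseteq> (\<Union>x\<in>F. ball x (3 * e))" if "0 < e" for e
    proof -
      \<comment> \<open>With density at least \<open>2 / e\<close> off \<open>K\<close>, avoiding
        \<open>K\<close> for time \<open>e\<close> would cost 2. So within time \<open>e\<close> the
        path meets \<open>K\<close> or reaches its end.\<close>
      obtain K where K: "compact K" "K \<subseteq> D" "\<And>x. x \<in> D \<Longrightarrow> x \<notin> K \<Longrightarrow> ennreal (2 / e) \<le> g x"
        using tight[of "2 / e"] by auto
      obtain F where F: "finite F" "K \<subseteq> (\<Union>x\<in>F. ball x e)"
        using K(1) \<open>0 < e\<close> unfolding compact_eq_totally_bounded by blast
      obtain N where N: "\<And>n. n \<ge> N \<Longrightarrow> dist (Y n) y < e" using metric_LIMSEQ_D[OF Y \<open>0 < e\<close>] by auto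
      \<comment> \<open>The first \<open>N\<close> end points enter as additional centres; all later
        ones lie within \<open>e\<close> of the limit \<open>y\<close>.\<close>
      have "R \<subseteq> (\<Union>x\<in>insert y (Y ` {..<N}) \<union> F. ball x (3 * e))"
      proof
        fix z assume "z \<in> R"
        then obtain n s' where "z = c n s'" by (auto simp: R_def)
        then obtain s where s: "z = c n s" "0 \<le> s" "s \<le> l n"
          using b(3)[of n] by (intro that[of "max 0 (min (l n) s')"]) (auto simp: c_def)
        show "z \<in> (\<Union>x\<in>insert y (Y ` {..<N}) \<union> F. ball x (3 * e))"
        proof (cases "l n < s + e")
          case True
          then have d: "dist (Y n) z < e" using lip1D[OF c, of n "l n" s] s cl[of n] by simp
          show ?thesis
          proof (cases "n < N")
            case True
            then have "z \<in> ball (Y n) (3 * e)" using d \<open>0 < e\<close> by simp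
            then show ?thesis using True by blast
          next
            case False
            then have "dist y z < 3 * e" using N[of n] d dist_triangle[of y z "Y n"] \<open>0 < e\<close> by (simp add: dist_commute)
            then show ?thesis by auto
          qed
        next
          case False
          have "\<exists>r\<in>{s..s+e}. c n r \<in> K"
          proof (rule ccontr)
            assume no: "\<not> (\<exists>r\<in>{s..s+e}. c n r \<in> K)"
            have "ennreal 2 = ennreal (2 / e) * ennreal e"
              using \<open>0 < e\<close> by (simp flip: ennreal_mult)
            also have "\<dots> = path_integral (\<lambda>x. ennreal (2 / e)) (c n) s (s + e)"
              using path_integral_const[of s "s + e" "ennreal (2 / e)" "c n"] \<open>0 < e\<close> by simp
            also have "\<dots> \<le> path_integral g (c n) s (s + e)"
              using no K(3) cD' by (intro path_integral_mono) auto
            also have "\<dots> \<le> path_integral g (c n) 0 (l n)"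
              using s False by (intro path_integral_subinterval) auto
            finally show False using cost2[of n] by simp
          qed
          then obtain r where rK: "s \<le> r" "r \<le> s + e" "c n r \<in> K" by auto
          then obtain x where "x \<in> F" "c n r \<in> ball x e" using F(2) by blast
          with rK have r: "s \<le> r" "r \<le> s + e" "x \<in> F" "dist x (c n r) < e" by auto
          have "dist x z < 3 * e"
            using dist_triangle[of x z "c n r"] lip1D[OF c, of n r s] r s \<open>0 < e\<close> by (simp add: dist_commute)
          then show ?thesis using r by auto
        qed
      qed
      then show ?thesis using F(1) by (intro exI[of _ "insert y (Y ` {..<N}) \<union> F"]) auto
    qed
    have "compact (closure R)"
      unfolding compact_eq_totally_bounded
    proof (intro conjI allI impI)
      have "closure R \<subseteq> D" using cD cD' by (intro closure_minimal) (auto simp: R_def)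
      then show "complete (closure R)" using D complete_Int_closed[of D "closure R"] by (simp add: inf_absorb2)
      fix e :: real assume "0 < e"
      then obtain F where F: "finite F" "R \<subseteq> (\<Union>x\<in>F. ball x (3 * (e / 6)))" using near[of "e/6"] by auto
      have "closure R \<subseteq> (\<Union>x\<in>F. cball x (e / 2))"
      proof (rule closure_minimal)
        have "ball x (3 * (e / 6)) \<subseteq> cball x (e / 2)" for x by auto
        then show "R \<subseteq> (\<Union>x\<in>F. cball x (e / 2))" using F(2) by blast
      qed (use F(1) in auto)
      also have "\<dots> \<subseteq> (\<Union>x\<in>F. ball x e)"
      proof (rule UN_mono[OF order_refl])
        show "cball x (e / 2) \<subseteq> ball x e" for x using \<open>0 < e\<close> by auto
      qed
      finally show "\<exists>F. finite F \<and> closure R \<subseteq> (\<Union>x\<in>F. ball x e)" using F(1) by blast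
    qed
    moreover have "c n s \<in> closure R" for n s using closure_subset[of R] by (auto simp: R_def)
    ultimately obtain r1 d where r1: "strict_mono r1" "lip1 d" "\<And>s. (\<lambda>n. c (r1 n) s) \<longlonglongrightarrow> d s"
      using lip1_subsequence_limit[of c "closure R"] c by metis
    have "\<forall>n. (l \<circ> r1) n \<in> {0..2}" using b(3) l2 by auto
    then obtain L r2 where L: "L \<in> {0..2}" "strict_mono r2" "((l \<circ> r1) \<circ> r2) \<longlonglongrightarrow> L"
      using seq_compactE[OF compact_imp_seq_compact[OF compact_Icc[of "0::real" 2]]] by metis
    define r where "r = r1 \<circ> r2"
    have lr: "(\<lambda>n. l (r n)) \<longlonglongrightarrow> L" using L(3) by (simp add: r_def o_def)
    have cr: "(\<lambda>n. c (r n) s) \<longlonglongrightarrow> d s" for s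
      using LIMSEQ_subseq_LIMSEQ[OF r1(3) L(2)] by (simp add: r_def o_def)
    have sr: "strict_mono r" unfolding r_def by (rule strict_mono_o[OF r1(1) L(2)])
    have dD: "range d \<subseteq> D" using closed_sequentially[OF cD _ cr] cD' by auto
    have dL: "d L = y"
    proof -
      have "(\<lambda>n. Y (r n)) \<longlonglongrightarrow> d L"
      proof (rule metric_LIMSEQ_I)
        fix e :: real assume "0 < e"
        then have "eventually (\<lambda>n. dist (c (r n) L) (d L) < e / 2) sequentially"
          "eventually (\<lambda>n. dist (l (r n)) L < e / 2) sequentially"
          using tendstoD[OF cr[of L], of "e/2"] tendstoD[OF lr, of "e/2"] by auto
        then have "eventually (\<lambda>n. dist (Y (r n)) (d L) < e) sequentially"
        proof eventually_elim
          case (elim n)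
          then show ?case
            using lip1D[OF c, of "r n" "l (r n)" L] cl[of "r n"] dist_triangle[of "Y (r n)" "d L" "c (r n) L"]
            by (simp add: dist_real_def)
        qed
        then show "\<exists>N. \<forall>n\<ge>N. dist (Y (r n)) (d L) < e" by (simp add: eventually_sequentially)
      qed
      moreover have "(\<lambda>n. Y (r n)) \<longlonglongrightarrow> y" using LIMSEQ_subseq_LIMSEQ[OF Y sr] by (simp add: o_def)
      ultimately show ?thesis by (rule LIMSEQ_unique)
    qed
    have \<pi>d: "(d, L) \<in> paths_to D y" using r1(2) dD L(1) dL by (auto simp: paths_to_def)
    \<comment> \<open>Writing the initial cost as an integral over \<open>[-1, 0)\<close> turns the
      whole cost into one integral, to which Fatou's lemma applies.\<close>
    define \<phi> where "\<phi> c l s = h (c 0) * indicator {- 1..<0} s + g (c s) * indicator {0..l} s" for c :: "real \<Rightarrow> 'a" and l s :: real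
    have \<phi>: "(\<lambda>s. \<phi> c l s) \<in> borel_measurable lborel" "(\<integral>\<^sup>+s. \<phi> c l s \<partial>lborel) = path_cost h g (c, l)" if "lip1 c" for c l
    proof -
      have [measurable]: "(\<lambda>t. g (c t)) \<in> borel_measurable borel" using that gm by (rule path_integral_measurable)
      show "(\<lambda>s. \<phi> c l s) \<in> borel_measurable lborel" unfolding \<phi>_def by measurable
      show "(\<integral>\<^sup>+s. \<phi> c l s \<partial>lborel) = path_cost h g (c, l)"
        unfolding \<phi>_def path_cost_def path_integral_def by (simp add: nn_integral_add nn_integral_cmult)
    qed
    have "path_cost h g (d, L) = (\<integral>\<^sup>+s. \<phi> d L s \<partial>lborel)" using \<phi>(2)[OF r1(2)] by simp
    also have "\<dots> \<le> (\<integral>\<^sup>+s. liminf (\<lambda>n. \<phi> (c (r n)) (l (r n)) s) \<partial>lborel)"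
    proof (intro nn_integral_mono_AE)
      show "AE s in lborel. \<phi> d L s \<le> liminf (\<lambda>n. \<phi> (c (r n)) (l (r n)) s)"
        \<comment> \<open>At the time \<open>L\<close> itself the intervals
          \<open>[0, l (r n)]\<close> may already have ended.\<close>
        using AE_lborel_singleton[of L]
      proof eventually_elim
        case (elim s)
        show ?case
          unfolding le_Liminf_iff
        proof safe
          fix a assume a: "a < \<phi> d L s"
          then have "s \<in> {-1..<0} \<and> a < h (d 0) \<or> 0 \<le> s \<and> s < L \<and> a < g (d s)"
            using elim by (cases "s \<in> {-1..<0}"; cases "s \<in> {0..L}") (auto simp: \<phi>_def)
          then consider "s \<in> {-1..<0}" "a < h (d 0)" | "0 \<le> s" "s < L" "a < g (d s)" by blast
          then show "eventually (\<lambda>n. a < \<phi> (c (r n)) (l (r n)) s) sequentially"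
          proof cases
            case 1
            have "eventually (\<lambda>n. a < h (c (r n) 0)) sequentially"
              using topological_tendstoD[OF cr, of "{x. a < h x}" 0] h 1 by (auto simp: lsc_def)
            then show ?thesis by eventually_elim (use 1 in \<open>auto simp: \<phi>_def\<close>)
          next
            case 2
            have "eventually (\<lambda>n. a < g (c (r n) s)) sequentially"
              using topological_tendstoD[OF cr, of "{x. a < g x}" s] g(1) 2 by (auto simp: lsc_def)
            moreover have "eventually (\<lambda>n. s < l (r n)) sequentially" using order_tendstoD(1)[OF lr 2(2)] .
            ultimately show ?thesis by eventually_elim (use 2 in \<open>auto simp: \<phi>_def\<close>)
          qed
        qed
      qed
    qed
    also have "\<dots> \<le> liminf (\<lambda>n. (\<integral>\<^sup>+s. \<phi> (c (r n)) (l (r n)) s \<partial>lborel))"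
      using \<phi>(1) c by (intro nn_integral_liminf) auto
    also have "\<dots> = liminf (\<lambda>n. path_cost h g (c (r n), l (r n)))" using \<phi>(2) c by simp
    also have "\<dots> \<le> liminf (\<lambda>n. ennreal (t + 1 / real (Suc (r n))))"
      using cost by (intro Liminf_mono always_eventually allI less_imp_le) (simp add: path_cost_def)
    also have "\<dots> = ennreal t"
    proof (rule lim_imp_Liminf[OF sequentially_bot])
      have "(\<lambda>n. t + 1 / real (Suc n)) \<longlonglongrightarrow> t + 0"
        by (intro tendsto_add tendsto_const LIMSEQ_inverse_real_of_nat[unfolded inverse_eq_divide])
      then have "(\<lambda>n. ennreal (t + 1 / real (Suc n))) \<longlonglongrightarrow> ennreal (t + 0)" by (intro tendsto_ennrealI)
      from LIMSEQ_subseq_LIMSEQ[OF this sr] show "(\<lambda>n. ennreal (t + 1 / real (Suc (r n)))) \<longlonglongrightarrow> ennreal t"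
        by (simp add: o_def)
    qed
    finally have "path_cost h g (d, L) \<le> ennreal t" .
    with path_value_le_cost[OF \<pi>d, of h g] show ?thesis by (rule order_trans)
  qed
  show ?thesis
    unfolding lsc_def
  proof
    fix a :: ennreal
    show "open {x. a < path_value h g D x}"
    proof (cases "a < 1")
      case True
      then obtain t where t: "a = ennreal t" "0 \<le> t" "t < 1" by (cases a) (auto simp: ennreal_less_iff simp flip: ennreal_1)
      have "closed {x. path_value h g D x \<le> a}"
        unfolding closed_sequential_limits using main t by blast
      moreover have "- {x. path_value h g D x \<le> a} = {x. a < path_value h g D x}" by auto
      ultimately show ?thesis by (metis open_Compl)
    next
      case False
      then have "{x. a < path_value h g D x} = {}"
        using path_value_le_1[of h g D] by (auto simp: not_less intro: order_trans)
      then show ?thesis by simp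
    qed
  qed
qed

section \<open>Local correction of an admissible function\<close>

lemma nn_integral_absolute_continuity:
  fixes f :: "'a \<Rightarrow> ennreal"
  assumes f[measurable]: "f \<in> borel_measurable M" and fin: "(\<integral>\<^sup>+x. f x \<partial>M) < \<infinity>" and "0 < e"
  obtains d where "0 < d" "\<And>A. A \<in> sets M \<Longrightarrow> emeasure M A \<le> ennreal d \<Longrightarrow> (\<integral>\<^sup>+x\<in>A. f x \<partial>M) \<le> ennreal e"
proof -
  define k where "k n x = min (f x) (ennreal (real n))" for n x
  have [measurable]: "k n \<in> borel_measurable M" for n unfolding k_def by measurable
  have lim: "(\<lambda>n. \<integral>\<^sup>+x. k n x \<partial>M) \<longlonglongrightarrow> (\<integral>\<^sup>+x. f x \<partial>M)"
  proof (rule nn_integral_LIMSEQ)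
    show "incseq k"
      unfolding incseq_def le_fun_def k_def by (intro allI impI min.mono order_refl ennreal_leI) simp
    fix x
    have "(\<lambda>n. min (f x) (ennreal (real n))) \<longlonglongrightarrow> min (f x) top"
      by (intro tendsto_min tendsto_const) (simp add: ennreal_of_nat_eq_real_of_nat[symmetric] of_nat_tendsto_top_ennreal)
    then show "(\<lambda>n. k n x) \<longlonglongrightarrow> f x" by (simp add: k_def)
  qed auto
  then have "(\<lambda>n. (\<integral>\<^sup>+x. k n x \<partial>M) + ennreal (e/2)) \<longlonglongrightarrow> (\<integral>\<^sup>+x. f x \<partial>M) + ennreal (e/2)"
    by (intro tendsto_add tendsto_const)
  moreover have "(\<integral>\<^sup>+x. f x \<partial>M) < (\<integral>\<^sup>+x. f x \<partial>M) + ennreal (e/2)"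
    using fin \<open>0 < e\<close> by (intro ennreal_less_add) auto
  ultimately have "eventually (\<lambda>n. (\<integral>\<^sup>+x. f x \<partial>M) < (\<integral>\<^sup>+x. k n x \<partial>M) + ennreal (e/2)) sequentially"
    by (intro order_tendstoD)
  then obtain n where n: "(\<integral>\<^sup>+x. f x \<partial>M) < (\<integral>\<^sup>+x. k n x \<partial>M) + ennreal (e/2)"
    using eventually_happens'[OF sequentially_bot] by blast
  have kf: "k n x \<le> f x" for x by (simp add: k_def)
  have kfin: "(\<integral>\<^sup>+x. k n x \<partial>M) < \<infinity>" using fin kf by (meson le_less_trans nn_integral_mono)
  have "(\<integral>\<^sup>+x. f x - k n x \<partial>M) = (\<integral>\<^sup>+x. f x \<partial>M) - (\<integral>\<^sup>+x. k n x \<partial>M)"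
    using kfin kf by (intro nn_integral_diff) auto
  also have "\<dots> \<le> ennreal (e/2)" using n fin by (auto simp: ennreal_minus_le_iff)
  finally have rest: "(\<integral>\<^sup>+x. f x - k n x \<partial>M) \<le> ennreal (e/2)" .
  \<comment> \<open>\<open>real n + 1\<close> keeps the denominator positive; the other half of
    \<open>e\<close> covers the error of truncating \<open>f\<close> at \<open>n\<close>.\<close>
  define d where "d = e / (2 * (real n + 1))"
  have "0 < d" using \<open>0 < e\<close> by (simp add: d_def)
  moreover have "(\<integral>\<^sup>+x\<in>A. f x \<partial>M) \<le> ennreal e" if A: "A \<in> sets M" "emeasure M A \<le> ennreal d" for A
  proof -
    have "(\<integral>\<^sup>+x\<in>A. f x \<partial>M) \<le> (\<integral>\<^sup>+x. ennreal (real n) * indicator A x + (f x - k n x) \<partial>M)"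
    proof (intro nn_integral_mono)
      fix x
      have "f x = k n x + (f x - k n x)" by (subst add.commute) (rule diff_add_cancel_ennreal[OF kf, symmetric])
      also have "\<dots> \<le> ennreal (real n) + (f x - k n x)" by (intro add_right_mono) (simp add: k_def)
      finally show "f x * indicator A x \<le> ennreal (real n) * indicator A x + (f x - k n x)"
        by (cases "x \<in> A") auto
    qed
    also have "\<dots> = ennreal (real n) * emeasure M A + (\<integral>\<^sup>+x. f x - k n x \<partial>M)"
      using A(1) by (simp add: nn_integral_add nn_integral_cmult_indicator)
    also have "\<dots> \<le> ennreal (real n) * ennreal d + ennreal (e/2)"
      using A(2) rest by (intro add_mono mult_left_mono) auto
    also have "\<dots> = ennreal (real n * d + e/2)"
      using \<open>0 < d\<close> \<open>0 < e\<close> by (simp add: ennreal_mult ennreal_plus)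
    also have "\<dots> \<le> ennreal e"
    proof (intro ennreal_leI)
      have "real n * d \<le> (real n + 1) * d" using \<open>0 < d\<close> by simp
      also have "\<dots> = e / 2" by (simp add: d_def field_simps)
      finally show "real n * d + e/2 \<le> e" by simp
    qed
    finally show ?thesis .
  qed
  ultimately show ?thesis by (rule that)
qed

context capacity_space begin

text \<open>Adding \<open>w\<close> to \<open>u\<close> replaces \<open>u\<close> on \<open>ball x r\<close> by a lower semicontinuous function \<open>v \<ge> u\<close>.
  Since \<open>v = u\<close> on a closed set \<open>F\<close> of almost full measure, \<open>w\<close> has an upper gradient supported off \<open>F\<close>.\<close>

lemma local_lsc_correction:
  assumes r: "0 < r" and D: "complete (cball x (2 * r))"
    and u: "u \<in> borel_measurable M" "\<And>y. 0 \<le> u y" "\<And>y. u y \<le> 1"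
    and F0: "Lp F0" "curve_ug u F0 (\<lambda>_. 0)" and e: "0 < e"
  obtains w \<kappa> where "w \<in> borel_measurable M" "\<And>y. 0 \<le> w y" "\<And>y. w y \<le> 1"
    "\<And>y. y \<notin> ball x (2 * r) \<Longrightarrow> w y = 0" "\<kappa> \<in> borel_measurable borel"
    "(\<integral>\<^sup>+y. ennreal_rpow (\<kappa> y) p \<partial>M) \<le> ennreal e" "curve_ug w \<kappa> (\<lambda>_. 0)"
    "\<And>t. open {y \<in> ball x r. t < u y + w y}" "emeasure M {y. w y \<noteq> 0} \<le> ennreal e"
proof -
  define D where "D = cball x (2 * r)"
  have cD: "complete D" using D by (simp add: D_def)
  have "emeasure M D \<le> emeasure M (ball x (3 * r))"
    unfolding D_def using r by (intro emeasure_mono sets_M) auto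
  also have "\<dots> < \<infinity>" using ball_measure[of "3 * r" x] r by simp
  finally have Dfin: "emeasure M D < \<infinity>" .
  have F0m: "F0 \<in> borel_measurable borel" using F0(1) by (rule Lp_measurable)
  have "(\<integral>\<^sup>+y\<in>D. ennreal_rpow (F0 y) p \<partial>M) \<le> (\<integral>\<^sup>+y. ennreal_rpow (F0 y) p \<partial>M)"
    by (intro nn_integral_mono) (auto split: split_indicator)
  then have F0fin: "(\<integral>\<^sup>+y\<in>D. ennreal_rpow (F0 y) p \<partial>M) < \<infinity>" using F0(1) by (auto simp: Lp_def)
  obtain g where g: "lsc g" "\<And>y. F0 y \<le> g y" "\<And>y. 1 \<le> g y" "(\<integral>\<^sup>+y\<in>D. ennreal_rpow (g y) p \<partial>M) < \<infinity>"
    "\<And>B. \<exists>K. compact K \<and> K \<subseteq> D \<and> (\<forall>y\<in>D - K. ennreal B \<le> g y)"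
    using tight_lsc_majorant[OF borel_M[OF F0m] cD Dfin F0fin] by blast
  have gm [measurable]: "g \<in> borel_measurable borel" using g(1) by (rule lsc_measurable)
  have Db [measurable]: "D \<in> sets borel" by (simp add: D_def)
  \<comment> \<open>\<open>1 / r\<close> is the Lipschitz constant of the cutoff \<eta>; the two
    copies of \<open>g\<close> account for the increments of \<open>v\<close> and of
    \<open>u\<close>.\<close>
  define G where "G y = ennreal (1 / r) + (g y + g y)" for y
  have Gm [measurable]: "G \<in> borel_measurable borel" unfolding G_def by measurable
  have "Lp (\<lambda>y. g y * indicator D y)"
  proof -
    have "(\<integral>\<^sup>+y. ennreal_rpow (g y * indicator D y) p \<partial>M) = (\<integral>\<^sup>+y\<in>D. ennreal_rpow (g y) p \<partial>M)"
      by (intro nn_integral_cong) (auto split: split_indicator)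
    then show ?thesis using g(4) unfolding Lp_def by simp
  qed
  moreover have "Lp (\<lambda>y. ennreal (1 / r) * indicator D y)"
  proof -
    have "(\<integral>\<^sup>+y. ennreal_rpow (ennreal (1 / r) * indicator D y) p \<partial>M) = (\<integral>\<^sup>+y. ennreal ((1 / r) powr p) * indicator D y \<partial>M)"
      using r by (intro nn_integral_cong) (auto simp: ennreal_rpow_ennreal split: split_indicator)
    also have "\<dots> < \<infinity>" using Dfin sets_M[OF Db] by (simp add: nn_integral_cmult_indicator ennreal_mult_less_top)
    finally show ?thesis unfolding Lp_def by simp
  qed
  ultimately have "Lp (\<lambda>y. ennreal (1 / r) * indicator D y + (g y * indicator D y + g y * indicator D y))"
    by (intro Lp_add)
  then have GL: "Lp (\<lambda>y. G y * indicator D y)" by (simp add: G_def distrib_right)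
  obtain d where d: "0 < d" "\<And>A. A \<in> sets M \<Longrightarrow> emeasure M A \<le> ennreal d \<Longrightarrow>
      (\<integral>\<^sup>+y\<in>A. ennreal_rpow (G y * indicator D y) p \<partial>M) \<le> ennreal e"
    using nn_integral_absolute_continuity[of "\<lambda>y. ennreal_rpow (G y * indicator D y) p" M e] GL e
    by (auto simp: Lp_def rpow_borel_M)
  have closedD: "closed D" by (simp add: D_def)
  \<comment> \<open>The bound \<open>d\<close> makes the energy of \<open>G\<close> off
    \<open>F\<close> small, the bound \<open>e\<close> the measure of the set where the correction
    is nonzero.\<close>
  have "0 < min d e" using d e by simp
  then obtain F where F: "closed F" "F \<subseteq> D" "emeasure M (D - F) \<le> ennreal (min d e)" "\<And>t. closed {y\<in>F. u y \<le> t}"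
    using restrict_lsc[OF u(1) closedD Dfin] by blast
  \<comment> \<open>For heights below 1 the sublevel sets of \<open>h\<close> are those of
    \<open>u\<close> in \<open>F\<close>, hence closed; and \<open>u \<le> h\<close> everywhere
    because \<open>u \<le> 1\<close>.\<close>
  define h where "h y = (if y \<in> F then ennreal (u y) else 1)" for y
  have "lsc h"
    unfolding lsc_def
  proof
    fix t :: ennreal
    show "open {y. t < h y}"
    proof (cases "t < 1")
      case True
      then obtain s where s: "t = ennreal s" "0 \<le> s" "s < 1" by (cases t) (auto simp: ennreal_less_iff simp flip: ennreal_1)
      then have "{y. t < h y} = - {y\<in>F. u y \<le> s}"
        using True u(2) by (auto simp: h_def ennreal_less_iff not_le)
      then show ?thesis using F(4)[of s] by (metis open_Compl)
    next
      case False
      have "h y \<le> 1" for y using u(3)[of y] by (simp add: h_def)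
      then have "{y. t < h y} = {}" using False by (auto simp: not_less intro: order_trans)
      then show ?thesis by simp
    qed
  qed
  define V where "V = path_value h g D"
  have lscV: "lsc V" unfolding V_def by (rule path_value_lsc[OF cD g(1,3) \<open>lsc h\<close> g(5)])
  have V1: "V y \<le> 1" for y unfolding V_def by (rule path_value_le_1)
  define v where "v y = enn2real (V y)" for y
  have Vv: "V y = ennreal (v y)" for y
    unfolding v_def using V1[of y] by (intro ennreal_enn2real[symmetric]) (auto intro: le_less_trans)
  have v0: "0 \<le> v y" for y by (simp add: v_def)
  have v1: "v y \<le> 1" for y using V1[of y] unfolding Vv by simp
  have useg: "ennreal \<bar>u (c s) - u (c t)\<bar> \<le> path_integral g c s t" if "lip1 c" "s \<le> t" for c s t
  proof -
    have "path_integral (\<lambda>_. 0) c s t < \<infinity>" by (simp add: path_integral_def)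
    then have "ennreal \<bar>u (c s) - u (c t)\<bar> \<le> path_integral F0 c s t"
      using curve_ug_segment[OF F0(2) F0m _ that] by simp
    also have "\<dots> \<le> path_integral g c s t" using g(2) by (intro path_integral_mono)
    finally show ?thesis .
  qed
  \<comment> \<open>Every path obeys the upper gradient inequality for \<open>u\<close>, as the
    weight of \<open>F0\<close> is 0 and no path is exceptional; and the path starts at cost
    \<open>h (c 0) \<ge> u (c 0)\<close>.\<close>
  have uv: "u y \<le> v y" for y
  proof -
    have "ennreal (u y) \<le> V y"
      unfolding V_def
    proof (rule path_value_geI)
      show "ennreal (u y) \<le> 1" using u(3) by simp
      fix \<pi> assume "\<pi> \<in> paths_to D y"
      then obtain c l where \<pi>: "\<pi> = (c, l)" "lip1 c" "0 \<le> l" "c l = y" by (auto simp: paths_to_def)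
      have "u (c l) \<le> u (c 0) + \<bar>u (c 0) - u (c l)\<bar>" by simp
      then have "ennreal (u (c l)) \<le> ennreal (u (c 0)) + ennreal \<bar>u (c 0) - u (c l)\<bar>"
        using u(2) by (simp flip: ennreal_plus add: ennreal_leI)
      also have "\<dots> \<le> h (c 0) + path_integral g c 0 l"
        using u(3)[of "c 0"] useg[OF \<pi>(2,3)] by (intro add_mono) (auto simp: h_def)
      finally show "ennreal (u y) \<le> path_cost h g \<pi>" using \<pi> by (simp add: path_cost_def)
    qed
    then show ?thesis unfolding Vv using v0 by simp
  qed
  have vF: "v y = u y" if "y \<in> F" for y
  proof -
    have "V y \<le> h y" unfolding V_def using F(2) that by (intro path_value_le_start) auto
    then have "v y \<le> u y" using that u(2)[of y] unfolding Vv by (simp add: h_def)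
    then show ?thesis using uv[of y] by simp
  qed
  have vseg: "ennreal \<bar>v (c s) - v (c t)\<bar> \<le> path_integral g c s t" if "lip1 c" "s \<le> t" "c ` {s..t} \<subseteq> D" for c s t
  proof (cases "path_integral g c s t")
    case (real i)
    have "ennreal (v (c t)) \<le> ennreal (v (c s)) + ennreal i" "ennreal (v (c s)) \<le> ennreal (v (c t)) + ennreal i"
      using path_value_segment[OF gm that, of h] path_value_segment'[OF gm that, of h] real
      unfolding V_def[symmetric] Vv by auto
    then have "v (c t) \<le> v (c s) + i" "v (c s) \<le> v (c t) + i"
      using real v0 by (simp_all flip: ennreal_plus)
    then show ?thesis using real by (simp add: abs_le_iff)
  qed simp
  define \<eta> where "\<eta> y = max 0 (min 1 (2 - dist x y / r))" for y
  have \<eta>cont: "continuous_on UNIV \<eta>" unfolding \<eta>_def by (intro continuous_intros) (use r in auto)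
  have \<eta>seg: "\<bar>\<eta> y - \<eta> z\<bar> \<le> 1 / r * dist y z" for y z
  proof -
    have "\<bar>\<eta> y - \<eta> z\<bar> \<le> \<bar>(2 - dist x y / r) - (2 - dist x z / r)\<bar>" unfolding \<eta>_def by (rule clamp_nonexpansive)
    also have "\<dots> = 1 / r * \<bar>dist x z - dist x y\<bar>" using r by (simp add: abs_mult diff_divide_distrib[symmetric])
    also have "\<dots> \<le> 1 / r * dist y z"
      using r abs_dist_diff_le[of x z y] dist_triangle[of x y z] dist_triangle[of x z y]
      by (intro mult_left_mono) (auto simp: dist_commute abs_le_iff)
    finally show ?thesis .
  qed
  \<comment> \<open>The increments of this minimum are bounded by the sum of those of \<eta>,
    \<open>v\<close> and \<open>u\<close>. On \<open>ball x r\<close> it equals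
    \<open>v - u\<close>, because there \<eta> is 1 and \<open>v - u \<le> 1\<close>.\<close>
  define w where "w y = min (\<eta> y) (v y - u y)" for y
  define Z where "Z = F \<union> {y. \<eta> y = 0}"
  have cZ: "closed Z"
    unfolding Z_def using F(1) \<eta>cont by (intro closed_Un closed_Collect_eq) auto
  have Zb [measurable]: "Z \<in> sets borel" using cZ by (rule borel_closed)
  have offD: "- Z \<subseteq> D - F"
  proof
    fix y assume "y \<in> - Z"
    then have "y \<notin> F" "\<eta> y \<noteq> 0" by (auto simp: Z_def)
    then have "dist x y / r < 2" by (auto simp: \<eta>_def max_def split: if_splits)
    then show "y \<in> D - F" using \<open>y \<notin> F\<close> r by (simp add: D_def field_simps)
  qed
  have w0: "0 \<le> w y" and w1: "w y \<le> 1" for y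
    using uv[of y] by (auto simp: w_def \<eta>_def)
  have wZ: "w y = 0" if "y \<in> Z" for y
    using that vF uv[of y] by (auto simp: Z_def w_def \<eta>_def)
  have DFm: "D - F \<in> sets M" using F(1) by (intro sets.Diff sets_M Db borel_closed)
  have Zm: "- Z \<in> sets M" by (intro sets_M) measurable
  have mZ: "emeasure M (- Z) \<le> ennreal (min d e)"
    using emeasure_mono[OF offD DFm] F(3) by (rule order_trans)
  define \<kappa> where "\<kappa> y = G y * indicator (- Z) y" for y
  show ?thesis
  proof (rule that[of w \<kappa>])
    have "V \<in> borel_measurable M" using lscV by (intro borel_M lsc_measurable)
    then have "v \<in> borel_measurable M" unfolding v_def by measurable
    moreover have "\<eta> \<in> borel_measurable M" using \<eta>cont by (intro borel_M borel_measurable_continuous_onI)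
    ultimately show "w \<in> borel_measurable M" unfolding w_def using u(1) by measurable
    show "0 \<le> w y" "w y \<le> 1" for y by (rule w0 w1)+
    show "w y = 0" if "y \<notin> ball x (2 * r)" for y
    proof -
      have "\<eta> y = 0" using that r by (auto simp: \<eta>_def field_simps)
      then show ?thesis by (intro wZ) (simp add: Z_def)
    qed
    show "\<kappa> \<in> borel_measurable borel" unfolding \<kappa>_def by measurable
    have "(\<integral>\<^sup>+y. ennreal_rpow (\<kappa> y) p \<partial>M) = (\<integral>\<^sup>+y\<in>- Z. ennreal_rpow (G y * indicator D y) p \<partial>M)"
      unfolding \<kappa>_def using offD by (intro nn_integral_cong) (auto split: split_indicator)
    also have "\<dots> \<le> ennreal e"
      using Zm by (intro d(2) order_trans[OF mZ] ennreal_leI) auto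
    finally show "(\<integral>\<^sup>+y. ennreal_rpow (\<kappa> y) p \<partial>M) \<le> ennreal e" .
    have "{y. w y \<noteq> 0} \<subseteq> - Z" using wZ by auto
    then have "emeasure M {y. w y \<noteq> 0} \<le> emeasure M (- Z)" using Zm by (rule emeasure_mono)
    also have "\<dots> \<le> ennreal e" using mZ by (rule order_trans) (intro ennreal_leI, simp)
    finally show "emeasure M {y. w y \<noteq> 0} \<le> ennreal e" .
    show "open {y \<in> ball x r. t < u y + w y}" for t
    proof -
      have "u y + w y = v y" if "y \<in> ball x r" for y
      proof -
        have "1 \<le> 2 - dist x y / r" using that r by (simp add: field_simps)
        then have "\<eta> y = 1" by (simp add: \<eta>_def)
        then show ?thesis using v1[of y] u(2)[of y] by (simp add: w_def min_def)
      qed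
      then have "{y \<in> ball x r. t < u y + w y} = ball x r \<inter> {y. t < v y}" by auto
      moreover have "open {y. t < v y}"
      proof (cases "0 \<le> t")
        case True
        then have "{y. t < v y} = {y. ennreal t < V y}" unfolding Vv by (auto simp: ennreal_less_iff)
        then show ?thesis using lscV by (simp add: lsc_def)
      next
        case False
        then have "{y. t < v y} = UNIV" using v0 by (auto simp: not_le intro: less_le_trans)
        then show ?thesis by simp
      qed
      ultimately show ?thesis by auto
    qed
    show "curve_ug w \<kappa> (\<lambda>_. 0)"
      unfolding curve_ug_def
    proof (intro allI impI)
      fix c :: "real \<Rightarrow> 'a" and l :: real
      assume c: "lip1 c" "0 \<le> l"
      have cc: "continuous_on UNIV c" using c(1) by (rule lip1_continuous)
      have "closed (c -` Z)" using continuous_closed_vimage[OF cZ] cc by (auto simp: continuous_on_eq_continuous_at)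
      then have "ennreal \<bar>w (c 0) - w (c l)\<bar> \<le> (\<integral>\<^sup>+t\<in>{0..l}. G (c t) * indicator (- (c -` Z)) t \<partial>lborel)"
      proof (rule abs_diff_le_nn_integral_off_zeros[OF _ c(2)])
        show "0 \<le> w (c t)" for t by (rule w0)
        show "w (c t) = 0" if "t \<in> c -` Z" for t using that by (intro wZ) auto
        fix s t assume st: "0 \<le> s" "s \<le> t" "t \<le> l" "{s<..<t} \<inter> c -` Z = {}"
        show "ennreal \<bar>w (c s) - w (c t)\<bar> \<le> (\<integral>\<^sup>+x\<in>{s..t}. G (c x) \<partial>lborel)"
        proof (cases "s = t")
          case False
          \<comment> \<open>Between visits to \<open>Z\<close> the path is in \<open>D\<close>;
            closedness of \<open>D\<close> adds the two end points, so that \<open>vseg\<close>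
            applies on the closed interval.\<close>
          then have "s < t" using st by simp
          have "c ` {s<..<t} \<subseteq> D" using st(4) offD by auto
          then have "c ` closure {s<..<t} \<subseteq> D"
            using closedD cc by (intro image_closure_subset) (auto intro: continuous_on_subset)
          then have cst: "c ` {s..t} \<subseteq> D" using \<open>s < t\<close> by simp
          have "\<bar>w (c s) - w (c t)\<bar> \<le> \<bar>\<eta> (c s) - \<eta> (c t)\<bar> + (\<bar>v (c s) - v (c t)\<bar> + \<bar>u (c s) - u (c t)\<bar>)"
            unfolding w_def by linarith
          also have "\<bar>\<eta> (c s) - \<eta> (c t)\<bar> \<le> 1 / r * (t - s)"
          proof -
            have "1 / r * dist (c s) (c t) \<le> 1 / r * (t - s)"
              using lip1D[OF c(1), of s t] st r by (intro mult_left_mono) auto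
            then show ?thesis using \<eta>seg[of "c s" "c t"] by linarith
          qed
          finally have "ennreal \<bar>w (c s) - w (c t)\<bar> \<le> ennreal (1 / r * (t - s) + (\<bar>v (c s) - v (c t)\<bar> + \<bar>u (c s) - u (c t)\<bar>))"
            by (intro ennreal_leI) simp
          also have "\<dots> = ennreal (1 / r) * ennreal (t - s) + (ennreal \<bar>v (c s) - v (c t)\<bar> + ennreal \<bar>u (c s) - u (c t)\<bar>)"
            using r st by (simp add: ennreal_plus ennreal_mult[symmetric])
          also have "\<dots> \<le> path_integral (\<lambda>_. ennreal (1 / r)) c s t + (path_integral g c s t + path_integral g c s t)"
            using useg[OF c(1) st(2)] vseg[OF c(1) st(2) cst] path_integral_const[OF st(2), of "ennreal (1/r)" c]
            by (intro add_mono) auto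
          also have "\<dots> = path_integral G c s t"
            unfolding G_def using c(1) by (simp add: path_integral_add)
          finally show ?thesis by (simp add: path_integral_def)
        qed simp
      qed
      also have "\<dots> = path_integral \<kappa> c 0 l"
        unfolding path_integral_def \<kappa>_def by (intro nn_integral_cong) (auto split: split_indicator)
      finally show "ennreal \<bar>w (c 0) - w (c l)\<bar> \<le> path_integral \<kappa> c 0 l" .
    qed
  qed
qed

end

subsection \<open>Outer capacity\<close>

context capacity_space begin

lemma ug_Lp_scale:
  assumes f: "ug_Lp f g" and k: "0 \<le> k" and le: "\<And>x y. \<bar>h x - h y\<bar> \<le> k * \<bar>f x - f y\<bar>"
  shows "ug_Lp h (\<lambda>x. ennreal k * g x)"
proof -
  obtain \<rho> where \<rho>: "Lp g" "Lp \<rho>" "curve_ug f g \<rho>" using f by (auto simp: ug_Lp_def)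
  have "curve_ug h (\<lambda>x. ennreal k * g x) \<rho>"
    unfolding curve_ug_def
  proof (intro allI impI)
    fix c :: "real \<Rightarrow> 'a" and l :: real
    assume c: "lip1 c" "0 \<le> l" "path_integral \<rho> c 0 l < \<infinity>"
    have "ennreal \<bar>h (c 0) - h (c l)\<bar> \<le> ennreal (k * \<bar>f (c 0) - f (c l)\<bar>)" using le by (intro ennreal_leI)
    also have "\<dots> = ennreal k * ennreal \<bar>f (c 0) - f (c l)\<bar>" using k by (simp add: ennreal_mult)
    also have "\<dots> \<le> ennreal k * path_integral g c 0 l" using c by (intro mult_left_mono curve_ugD[OF \<rho>(3)]) auto
    also have "\<dots> = path_integral (\<lambda>x. ennreal k * g x) c 0 l"
      using c(1) Lp_measurable[OF \<rho>(1)] by (rule path_integral_cmult[symmetric])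
    finally show "ennreal \<bar>h (c 0) - h (c l)\<bar> \<le> path_integral (\<lambda>x. ennreal k * g x) c 0 l" .
  qed
  then show ?thesis using \<rho> k by (auto simp: ug_Lp_def intro: Lp_cmult)
qed

lemma curve_ug_SUP:
  fixes w :: "nat \<Rightarrow> 'a \<Rightarrow> real"
  assumes "\<And>k. curve_ug (w k) (\<kappa> k) \<rho>" "\<And>k x. w k x \<le> b"
  shows "curve_ug (\<lambda>x. SUP k. w k x) (\<lambda>x. SUP k. \<kappa> k x) \<rho>"
  unfolding curve_ug_def
proof (intro allI impI)
  fix c :: "real \<Rightarrow> 'a" and l :: real
  assume c: "lip1 c" "0 \<le> l" "path_integral \<rho> c 0 l < \<infinity>"
  have bdd: "bdd_above (range (\<lambda>k. w k x))" for x using assms(2) by (intro bdd_aboveI) auto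
  show "ennreal \<bar>(SUP k. w k (c 0)) - (SUP k. w k (c l))\<bar> \<le> path_integral (\<lambda>x. SUP k. \<kappa> k x) c 0 l"
  proof (cases "path_integral (\<lambda>x. SUP k. \<kappa> k x) c 0 l")
    case (real i)
    have *: "\<bar>w k (c 0) - w k (c l)\<bar> \<le> i" for k
    proof -
      have "ennreal \<bar>w k (c 0) - w k (c l)\<bar> \<le> path_integral (\<kappa> k) c 0 l" using c by (intro curve_ugD[OF assms(1)])
      also have "\<dots> \<le> path_integral (\<lambda>x. SUP k. \<kappa> k x) c 0 l" by (intro path_integral_mono SUP_upper) auto
      finally show ?thesis using real by simp
    qed
    have "w k (c 0) \<le> (SUP k. w k (c l)) + i" for k
      using *[of k] cSUP_upper[OF UNIV_I bdd, of k "c l"] by simp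
    then have 1: "(SUP k. w k (c 0)) \<le> (SUP k. w k (c l)) + i" by (intro cSUP_least) auto
    have "w k (c l) \<le> (SUP k. w k (c 0)) + i" for k
      using *[of k] cSUP_upper[OF UNIV_I bdd, of k "c 0"] by simp
    then have 2: "(SUP k. w k (c l)) \<le> (SUP k. w k (c 0)) + i" by (intro cSUP_least) auto
    show ?thesis using 1 2 real by (simp add: abs_le_iff)
  qed simp
qed

lemma complete_cball_subset_open:
  fixes x :: 'a
  assumes "open \<Omega>" "x \<in> \<Omega>"
  obtains r where "0 < r" "complete (cball x (2 * r))" "cball x (2 * r) \<subseteq> \<Omega>"
proof -
  obtain S where S: "x \<in> interior S" "complete S" using locally_complete by blast
  have "open (interior S \<inter> \<Omega>)" "x \<in> interior S \<inter> \<Omega>" using assms S by auto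
  then obtain a where a: "0 < a" "cball x a \<subseteq> interior S \<inter> \<Omega>" using open_contains_cball by blast
  then have "S \<inter> cball x a = cball x a" using interior_subset by blast
  then have "complete (cball x a)" using complete_Int_closed[OF S(2), of "cball x a"] by simp
  \<comment> \<open>The radius is halved because the correction on \<open>ball x r\<close> works in
    the ball of radius \<open>2 * r\<close>.\<close>
  then show ?thesis using a by (intro that[of "a / 2"]) auto
qed

text \<open>Dividing by \<open>1 - \<theta>\<close> lifts \<open>f\<close> plus its correction to 1
  on \<open>G\<close>; the factor \<open>(1 + \<theta>) powr p\<close> is the price of adding the
  gradient of the correction to that of \<open>f\<close>; the last term bounds the contribution of
  all corrections.\<close>

lemma admissible_open_superset:
  assumes "open \<Omega>" and f: "admissible E \<Omega> f g" and \<theta>: "0 < \<theta>" "\<theta> < 1"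
  obtains G where "open G" "E \<inter> \<Omega> \<subseteq> G" "G \<subseteq> \<Omega>"
    "condenser_cap_bounded M p G \<Omega> \<le> ennreal (((1 + \<theta>) / (1 - \<theta>)) powr p) * energy \<Omega> g + ennreal \<theta>"
proof -
  have f01: "0 \<le> f x" "f x \<le> 1" for x using admissible_range[OF f] by auto
  have fm [measurable]: "f \<in> borel_measurable M" using f by (simp add: admissible_def)
  have fE: "1 \<le> f x" if "x \<in> E" for x using f that unfolding admissible_def by (metis indicator_simps(1))
  have f\<Omega>: "f x = 0" if "x \<notin> \<Omega>" for x
    using f f01(1)[of x] that unfolding admissible_def by (metis antisym indicator_simps(2))
  have ugf: "ug_Lp f g" using f by (simp add: admissible_def)
  then obtain \<rho> where \<rho>: "Lp g" "Lp \<rho>" "curve_ug f g \<rho>" by (auto simp: ug_Lp_def)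
  note m [measurable] = Lp_measurable[OF \<rho>(1)] Lp_measurable[OF \<rho>(2)]
  \<comment> \<open>Along a path on which the integral of \<rho> is infinite the inequality becomes
    trivial, so this sum is an upper gradient along all paths. It enters only the construction of
    the corrections; the energy estimate for \<open>f\<close> keeps \<open>g\<close>.\<close>
  define F0 where "F0 x = g x + \<rho> x" for x
  have F0: "Lp F0" unfolding F0_def using \<rho> by (intro Lp_add)
  have F0ug: "curve_ug f F0 (\<lambda>_. 0)"
    unfolding curve_ug_def
  proof (intro allI impI)
    fix c :: "real \<Rightarrow> 'a" and l :: real assume c: "lip1 c" "0 \<le> l"
    have eq: "path_integral F0 c 0 l = path_integral g c 0 l + path_integral \<rho> c 0 l"
      unfolding F0_def using c by (simp add: path_integral_add)
    show "ennreal \<bar>f (c 0) - f (c l)\<bar> \<le> path_integral F0 c 0 l"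
    proof (cases "path_integral \<rho> c 0 l < \<infinity>")
      case True
      then show ?thesis unfolding eq using curve_ugD[OF \<rho>(3) c True] by (intro add_increasing2) auto
    next
      case False
      then show ?thesis unfolding eq by (simp add: not_less top_unique)
    qed
  qed
  define C where "C = (1 + 1 / \<theta>) powr p"
  have "0 < 1 + 1 / \<theta>" using \<theta> by (simp add: add_pos_pos)
  then have "0 < C" unfolding C_def by simp
  \<comment> \<open>In the final estimate the energy of the corrections is multiplied by
    \<open>C\<close> and by the scaling factor \<open>(1 / (1 - \<theta>)) powr p\<close>; this
    \<delta> makes the product equal to \<theta>.\<close>
  define \<delta> where "\<delta> = \<theta> * (1 - \<theta>) powr p / C"
  have \<delta>: "0 < \<delta>" using \<theta> \<open>0 < C\<close> by (simp add: \<delta>_def)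
  have "\<forall>x\<in>\<Omega>. \<exists>r. 0 < r \<and> complete (cball x (2 * r)) \<and> cball x (2 * r) \<subseteq> \<Omega>"
    using complete_cball_subset_open[OF \<open>open \<Omega>\<close>] by metis
  then obtain r where r: "\<And>x. x \<in> \<Omega> \<Longrightarrow> 0 < r x" "\<And>x. x \<in> \<Omega> \<Longrightarrow> complete (cball x (2 * r x))"
    "\<And>x. x \<in> \<Omega> \<Longrightarrow> cball x (2 * r x) \<subseteq> \<Omega>" by metis
  obtain T where T: "countable T" "T \<subseteq> \<Omega>" "\<Omega> \<subseteq> (\<Union>x\<in>T. ball x (r x))"
    using countable_ball_subcover[of \<Omega> r] r(1) by blast
  show ?thesis
  proof (cases "T = {}")
    case True
    then have "\<Omega> = {}" using T by auto
    have "admissible {} \<Omega> f g" using f by (auto simp: admissible_def f01)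
    then have "condenser_cap_bounded M p {} \<Omega> \<le> energy \<Omega> g" by (rule condenser_cap_bounded_le_energy)
    then show ?thesis using \<open>\<Omega> = {}\<close> by (intro that[of "{}"]) auto
  next
    case False
    define z where "z k = from_nat_into T k" for k
    have z: "z k \<in> \<Omega>" for k using from_nat_into[OF False] T(2) unfolding z_def by auto
    have zr: "0 < r (z k)" "complete (cball (z k) (2 * r (z k)))" "cball (z k) (2 * r (z k)) \<subseteq> \<Omega>" for k
      using r z by auto
    have cover: "\<exists>k. x \<in> ball (z k) (r (z k))" if "x \<in> \<Omega>" for x
    proof -
      obtain y where "y \<in> T" "x \<in> ball y (r y)" using T(3) \<open>x \<in> \<Omega>\<close> by blast
      then show ?thesis using from_nat_into_surj[OF T(1)] unfolding z_def by metis
    qed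
    define \<epsilon> where "\<epsilon> k = \<delta> * (1/2) ^ Suc k" for k
    have \<epsilon>: "0 < \<epsilon> k" for k using \<delta> by (simp add: \<epsilon>_def)
    define P where "P k w \<kappa> \<longleftrightarrow> w \<in> borel_measurable M \<and> (\<forall>y. 0 \<le> w y \<and> w y \<le> 1) \<and>
      (\<forall>y. y \<notin> ball (z k) (2 * r (z k)) \<longrightarrow> w y = 0) \<and> \<kappa> \<in> borel_measurable borel \<and>
      (\<integral>\<^sup>+y. ennreal_rpow (\<kappa> y) p \<partial>M) \<le> ennreal (\<epsilon> k) \<and> curve_ug w \<kappa> (\<lambda>_. 0) \<and>
      (\<forall>t. open {y \<in> ball (z k) (r (z k)). t < f y + w y}) \<and> emeasure M {y. w y \<noteq> 0} \<le> ennreal (\<epsilon> k)"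
      for k and w :: "'a \<Rightarrow> real" and \<kappa> :: "'a \<Rightarrow> ennreal"
    have "\<exists>w \<kappa>. P k w \<kappa>" for k
    proof (rule local_lsc_correction[OF zr(1,2) fm f01 F0 F0ug \<epsilon>, of k k])
      fix w \<kappa>
      assume "w \<in> borel_measurable M" "\<And>y. 0 \<le> w y" "\<And>y. w y \<le> 1"
        "\<And>y. y \<notin> ball (z k) (2 * r (z k)) \<Longrightarrow> w y = 0" "\<kappa> \<in> borel_measurable borel"
        "(\<integral>\<^sup>+y. ennreal_rpow (\<kappa> y) p \<partial>M) \<le> ennreal (\<epsilon> k)" "curve_ug w \<kappa> (\<lambda>_. 0)"
        "\<And>t. open {y \<in> ball (z k) (r (z k)). t < f y + w y}" "emeasure M {y. w y \<noteq> 0} \<le> ennreal (\<epsilon> k)"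
      then have "P k w \<kappa>" unfolding P_def by (intro conjI allI impI)
      then show ?thesis by (intro exI)
    qed
    then obtain w \<kappa> where P: "\<And>k. P k (w k) (\<kappa> k)" by metis
    have wm [measurable]: "w k \<in> borel_measurable M" and w01: "0 \<le> w k y" "w k y \<le> 1"
      and w0: "y \<notin> ball (z k) (2 * r (z k)) \<Longrightarrow> w k y = 0"
      and \<kappa>m [measurable]: "\<kappa> k \<in> borel_measurable borel"
      and \<kappa>: "(\<integral>\<^sup>+y. ennreal_rpow (\<kappa> k y) p \<partial>M) \<le> ennreal (\<epsilon> k)" "curve_ug (w k) (\<kappa> k) (\<lambda>_. 0)"
      and wopen: "open {y \<in> ball (z k) (r (z k)). t < f y + w k y}"
      and wmeas: "emeasure M {y. w k y \<noteq> 0} \<le> ennreal (\<epsilon> k)" for k y t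
      using P[of k] unfolding P_def by simp_all
    have sum\<epsilon>: "(\<Sum>k. ennreal (\<epsilon> k)) = ennreal \<delta>" unfolding \<epsilon>_def using \<delta> by (rule suminf_half_pow)
    \<comment> \<open>The energy of a supremum is at most the sum of the energies, here at most
      \<delta>; finite overlap of the balls is not at issue.\<close>
    define W where "W y = (SUP k. w k y)" for y
    define \<kappa>' where "\<kappa>' y = (SUP k. \<kappa> k y)" for y
    have bdd: "bdd_above (range (\<lambda>k. w k y))" for y using w01 by (intro bdd_aboveI[of _ 1]) auto
    have wW: "w k y \<le> W y" for k y unfolding W_def using bdd by (intro cSUP_upper) auto
    have W01: "0 \<le> W y" for y using wW[of 0 y] w01(1)[of 0 y] by linarith
    have Wzero: "W y = 0" if "\<And>k. w k y = 0" for y using that by (simp add: W_def)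
    have W\<Omega>: "W y = 0" if "y \<notin> \<Omega>" for y
    proof (rule Wzero)
      fix k
      have "y \<notin> ball (z k) (2 * r (z k))" using zr(3)[of k] that ball_subset_cball by blast
      then show "w k y = 0" by (rule w0)
    qed
    have Wm [measurable]: "W \<in> borel_measurable M"
      unfolding W_def using bdd by (intro borel_measurable_cSUP) auto
    have \<kappa>'m [measurable]: "\<kappa>' \<in> borel_measurable borel" unfolding \<kappa>'_def by measurable
    have "(\<integral>\<^sup>+y. ennreal_rpow (\<kappa>' y) p \<partial>M) = (\<integral>\<^sup>+y. (SUP k. ennreal_rpow (\<kappa> k y) p) \<partial>M)"
      unfolding \<kappa>'_def using p_pos by (simp add: ennreal_rpow_SUP)
    also have "\<dots> \<le> (\<Sum>k. \<integral>\<^sup>+y. ennreal_rpow (\<kappa> k y) p \<partial>M)"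
      by (intro nn_integral_SUP_le_suminf rpow_borel_M \<kappa>m)
    also have "\<dots> \<le> (\<Sum>k. ennreal (\<epsilon> k))" using \<kappa>(1) by (intro suminf_le) auto
    finally have \<kappa>'E: "(\<integral>\<^sup>+y. ennreal_rpow (\<kappa>' y) p \<partial>M) \<le> ennreal \<delta>" unfolding sum\<epsilon> .
    then have "Lp \<kappa>'" unfolding Lp_def using le_less_trans[of _ "ennreal \<delta>" \<infinity>] by simp
    moreover have "curve_ug W \<kappa>' (\<lambda>_. 0)"
      unfolding W_def \<kappa>'_def using \<kappa>(2) w01(2) by (rule curve_ug_SUP)
    ultimately have ugW: "ug_Lp W \<kappa>'" using Lp_zero by (auto simp: ug_Lp_def)
    define v where "v y = min 1 (1 / (1 - \<theta>) * (f y + W y))" for y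
    have "ug_Lp (\<lambda>y. f y + W y) (\<lambda>y. g y + \<kappa>' y)" by (rule ug_Lp_add_bound[OF ugf ugW]) linarith
    then have ugv: "ug_Lp v (\<lambda>y. ennreal (1 / (1 - \<theta>)) * (g y + \<kappa>' y))"
    proof (rule ug_Lp_scale)
      fix x y
      let ?a = "1 / (1 - \<theta>) * (f x + W x)" and ?b = "1 / (1 - \<theta>) * (f y + W y)"
      have "\<bar>v x - v y\<bar> \<le> \<bar>?a - ?b\<bar>" unfolding v_def by (auto simp: min_def)
      also have "?a - ?b = 1 / (1 - \<theta>) * ((f x + W x) - (f y + W y))" by (simp add: algebra_simps)
      also have "\<bar>\<dots>\<bar> = 1 / (1 - \<theta>) * \<bar>(f x + W x) - (f y + W y)\<bar>" using \<theta> by (simp add: abs_mult)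
      finally show "\<bar>v x - v y\<bar> \<le> 1 / (1 - \<theta>) * \<bar>(f x + W x) - (f y + W y)\<bar>" .
    qed (use \<theta> in simp)
    \<comment> \<open>On each ball only its own correction is known to make the sum lower
      semicontinuous; since \<open>W\<close> dominates them all, \<open>f + W\<close> still exceeds
      \<open>1 - \<theta>\<close> on the union.\<close>
    define G where "G = (\<Union>k. {y \<in> ball (z k) (r (z k)). 1 - \<theta> < f y + w k y})"
    have "open G" unfolding G_def using wopen by (intro open_UN) auto
    have G\<Omega>: "G \<subseteq> \<Omega>"
    proof
      fix y assume "y \<in> G"
      then obtain k where "y \<in> ball (z k) (r (z k))" unfolding G_def by blast
      moreover have "ball (z k) (r (z k)) \<subseteq> cball (z k) (2 * r (z k))" using zr(1)[of k] by auto
      ultimately show "y \<in> \<Omega>" using zr(3)[of k] by blast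
    qed
    have EG: "E \<inter> \<Omega> \<subseteq> G"
    proof
      fix y assume y: "y \<in> E \<inter> \<Omega>"
      then obtain k where "y \<in> ball (z k) (r (z k))" using cover by blast
      moreover have "1 - \<theta> < f y + w k y" using fE[of y] y w01(1)[of k y] \<theta> by simp
      ultimately show "y \<in> G" unfolding G_def by blast
    qed
    have v0: "0 \<le> v y" for y using f01(1)[of y] W01[of y] \<theta> by (simp add: v_def)
    have v1: "v y \<le> 1" for y by (simp add: v_def)
    have "(\<integral>\<^sup>+y. ennreal_rpow (ennreal (v y)) p \<partial>M) < \<infinity>"
    proof -
      \<comment> \<open>The purpose of the measure bounds: off \<open>?S\<close> the function
        \<open>v\<close> is at most a multiple of \<open>f\<close>, and on \<open>?S\<close>, a set
        of finite measure, it is at most 1. Hence \<open>v\<close> is p-integrable.\<close>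
      let ?S = "\<Union>k. {y. w k y \<noteq> 0}"
      have Sm [measurable]: "{y. w k y \<noteq> 0} \<in> sets M" for k
      proof -
        have "{y \<in> space M. w k y \<noteq> 0} \<in> sets M" by measurable
        then show ?thesis by simp
      qed
      have [measurable]: "?S \<in> sets M" by (intro sets.countable_UN) auto
      have "emeasure M ?S \<le> (\<Sum>k. emeasure M {y. w k y \<noteq> 0})"
        using Sm by (intro emeasure_subadditive_countably) auto
      also have "\<dots> \<le> (\<Sum>k. ennreal (\<epsilon> k))" using wmeas by (intro suminf_le) auto
      finally have S: "emeasure M ?S \<le> ennreal \<delta>" unfolding sum\<epsilon> .
      let ?K = "ennreal ((1 / (1 - \<theta>)) powr p)"
      have "(\<integral>\<^sup>+y. ennreal_rpow (ennreal (v y)) p \<partial>M) \<le> (\<integral>\<^sup>+y. indicator ?S y + ?K * ennreal_rpow (ennreal (f y)) p \<partial>M)"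
      proof (intro nn_integral_mono)
        fix y
        show "ennreal_rpow (ennreal (v y)) p \<le> indicator ?S y + ?K * ennreal_rpow (ennreal (f y)) p"
        proof (cases "y \<in> ?S")
          case True
          have "ennreal_rpow (ennreal (v y)) p \<le> ennreal_rpow 1 p"
            using v1[of y] p_pos by (intro ennreal_rpow_mono) auto
          then show ?thesis using True by (intro add_increasing2[OF zero_le]) simp
        next
          case False
          then have "W y = 0" by (intro Wzero) auto
          then have "v y \<le> 1 / (1 - \<theta>) * f y" by (simp add: v_def)
          then have "ennreal (v y) \<le> ennreal (1 / (1 - \<theta>)) * ennreal (f y)"
            using f01(1)[of y] \<theta> by (simp add: ennreal_leI flip: ennreal_mult)
          then have "ennreal_rpow (ennreal (v y)) p \<le> ennreal_rpow (ennreal (1 / (1 - \<theta>)) * ennreal (f y)) p"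
            using p_pos by (intro ennreal_rpow_mono)
          also have "\<dots> = ?K * ennreal_rpow (ennreal (f y)) p" using \<theta> p_pos by (intro ennreal_rpow_mult) auto
          finally show ?thesis by (rule add_increasing[OF zero_le])
        qed
      qed
      also have "\<dots> = emeasure M ?S + ?K * (\<integral>\<^sup>+y. ennreal_rpow (ennreal (f y)) p \<partial>M)"
        by (subst nn_integral_add) (auto simp: nn_integral_cmult)
      also have "\<dots> < \<infinity>" using le_less_trans[OF S, of top] f by (auto simp: admissible_def ennreal_mult_less_top)
      finally show ?thesis .
    qed
    moreover have "indicator G y \<le> v y \<and> v y \<le> indicator \<Omega> y" for y
    proof
      show "v y \<le> indicator \<Omega> y" using v1[of y] f\<Omega>[of y] W\<Omega>[of y] by (cases "y \<in> \<Omega>") (auto simp: v_def)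
      show "indicator G y \<le> v y"
      proof (cases "y \<in> G")
        case True
        then obtain k where "1 - \<theta> < f y + w k y" unfolding G_def by blast
        then have "1 - \<theta> \<le> f y + W y" using wW[of k y] by simp
        then have "1 \<le> 1 / (1 - \<theta>) * (f y + W y)" using \<theta> by (simp add: field_simps)
        then show ?thesis using True by (simp add: v_def)
      qed (use v0 in simp)
    qed
    moreover have "v \<in> borel_measurable M" unfolding v_def by measurable
    ultimately have "admissible G \<Omega> v (\<lambda>y. ennreal (1 / (1 - \<theta>)) * (g y + \<kappa>' y))"
      using ugv by (simp add: admissible_def)
    then have "condenser_cap_bounded M p G \<Omega> \<le> energy \<Omega> (\<lambda>y. ennreal (1 / (1 - \<theta>)) * (g y + \<kappa>' y))"
      by (rule condenser_cap_bounded_le_energy)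
    also have "\<dots> \<le> ennreal (((1 + \<theta>) / (1 - \<theta>)) powr p) * energy \<Omega> g + ennreal \<theta>"
    proof -
      let ?K = "ennreal ((1 / (1 - \<theta>)) powr p)" and ?L = "ennreal ((1 + \<theta>) powr p)"
      have [measurable]: "\<Omega> \<in> sets M" using \<open>open \<Omega>\<close> by (intro sets_M borel_open)
      have [measurable]: "(\<lambda>x. ennreal_rpow (g x) p) \<in> borel_measurable M" "(\<lambda>x. ennreal_rpow (\<kappa>' x) p) \<in> borel_measurable M"
        by (simp_all add: rpow_borel_M)
      have "energy \<Omega> (\<lambda>y. ennreal (1 / (1 - \<theta>)) * (g y + \<kappa>' y)) \<le>
        (\<integral>\<^sup>+y. ?K * ?L * (ennreal_rpow (g y) p * indicator \<Omega> y) + ?K * ennreal C * ennreal_rpow (\<kappa>' y) p \<partial>M)"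
      proof (intro nn_integral_mono)
        fix y
        have "ennreal_rpow (ennreal (1 / (1 - \<theta>)) * (g y + \<kappa>' y)) p = ?K * ennreal_rpow (g y + \<kappa>' y) p"
          using \<theta> p_pos by (intro ennreal_rpow_mult) auto
        also have "\<dots> \<le> ?K * (?L * ennreal_rpow (g y) p + ennreal C * ennreal_rpow (\<kappa>' y) p)"
          unfolding C_def by (intro mult_left_mono ennreal_rpow_add_le p_pos \<theta>) auto
        finally show "ennreal_rpow (ennreal (1 / (1 - \<theta>)) * (g y + \<kappa>' y)) p * indicator \<Omega> y \<le>
          ?K * ?L * (ennreal_rpow (g y) p * indicator \<Omega> y) + ?K * ennreal C * ennreal_rpow (\<kappa>' y) p"
          by (cases "y \<in> \<Omega>") (auto simp: distrib_left mult.assoc)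
      qed
      also have "\<dots> = ?K * ?L * energy \<Omega> g + ?K * ennreal C * (\<integral>\<^sup>+y. ennreal_rpow (\<kappa>' y) p \<partial>M)"
        by (subst nn_integral_add) (auto simp: nn_integral_cmult)
      also have "\<dots> \<le> ?K * ?L * energy \<Omega> g + ?K * ennreal C * ennreal \<delta>"
        using \<kappa>'E by (intro add_mono mult_left_mono) auto
      also have "?K * ?L = ennreal (((1 + \<theta>) / (1 - \<theta>)) powr p)"
        using \<theta> by (simp add: powr_divide flip: ennreal_mult)
      also have "?K * ennreal C * ennreal \<delta> = ennreal \<theta>"
      proof -
        have "(1 / (1 - \<theta>)) powr p * C * \<delta> = \<theta>"
          using \<theta> \<open>0 < C\<close> by (simp add: \<delta>_def powr_divide)
        then show ?thesis using \<open>0 < C\<close> \<delta> by (simp flip: ennreal_mult)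
      qed
      finally show ?thesis .
    qed
    finally show ?thesis using \<open>open G\<close> EG G\<Omega> by (intro that)
  qed
qed

section \<open>From a single admissible function to arbitrary sets\<close>

lemma condenser_cap_bounded_outer:
  assumes "open \<Omega>" "E \<subseteq> \<Omega>" "condenser_cap_bounded M p E \<Omega> < y"
  obtains G where "open G" "E \<subseteq> G" "G \<subseteq> \<Omega>" "condenser_cap_bounded M p G \<Omega> < y"
proof -
  obtain f g where fg: "admissible E \<Omega> f g" "energy \<Omega> g < y" by (rule condenser_cap_bounded_lessE[OF assms(3)])
  obtain e where e: "energy \<Omega> g = ennreal e" "0 \<le> e" using fg(2) by (cases "energy \<Omega> g") (auto simp: not_top_less)
  \<comment> \<open>\<theta> runs through \<open>1 / Suc (Suc n)\<close>, strictly between 0 and 1;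
    the bound tends to the energy, which is below \<open>y\<close>.\<close>
  have "(\<lambda>n. ((1 + 1 / real (Suc (Suc n))) / (1 - 1 / real (Suc (Suc n)))) powr p * e + 1 / real (Suc (Suc n)))
      \<longlonglongrightarrow> ((1 + 0) / (1 - 0)) powr p * e + 0"
    by (intro tendsto_intros LIMSEQ_Suc[OF LIMSEQ_inverse_real_of_nat[unfolded inverse_eq_divide]]) auto
  then have "(\<lambda>n. ennreal (((1 + 1 / real (Suc (Suc n))) / (1 - 1 / real (Suc (Suc n)))) powr p * e + 1 / real (Suc (Suc n))))
      \<longlonglongrightarrow> ennreal (((1 + 0) / (1 - 0)) powr p * e + 0)"
    by (rule tendsto_ennrealI)
  moreover have "ennreal (((1 + 0) / (1 - 0)) powr p * e + 0) < y" using fg(2) e by simp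
  ultimately have "eventually (\<lambda>n. ennreal (((1 + 1 / real (Suc (Suc n))) / (1 - 1 / real (Suc (Suc n)))) powr p * e + 1 / real (Suc (Suc n))) < y) sequentially"
    by (rule order_tendstoD)
  then obtain n where n: "ennreal (((1 + 1 / real (Suc (Suc n))) / (1 - 1 / real (Suc (Suc n)))) powr p * e + 1 / real (Suc (Suc n))) < y"
    using eventually_happens'[OF sequentially_bot] by blast
  define \<theta> where "\<theta> = 1 / real (Suc (Suc n))"
  have \<theta>: "0 < \<theta>" "\<theta> < 1" by (auto simp: \<theta>_def)
  obtain G where G: "open G" "E \<inter> \<Omega> \<subseteq> G" "G \<subseteq> \<Omega>"
    "condenser_cap_bounded M p G \<Omega> \<le> ennreal (((1 + \<theta>) / (1 - \<theta>)) powr p) * energy \<Omega> g + ennreal \<theta>"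
    by (rule admissible_open_superset[OF assms(1) fg(1) \<theta>])
  note G(4)
  also have "ennreal (((1 + \<theta>) / (1 - \<theta>)) powr p) * energy \<Omega> g + ennreal \<theta> = ennreal (((1 + \<theta>) / (1 - \<theta>)) powr p * e + \<theta>)"
    using e \<theta> by (simp add: ennreal_plus ennreal_mult)
  also have "\<dots> < y" using n by (simp add: \<theta>_def)
  finally show ?thesis using G assms(2) by (intro that[of G]) auto
qed

text \<open>One formula for bounded and unbounded sets: for bounded \<open>E\<close> the sequence is
  eventually constant, and for unbounded \<open>E\<close> the limit of a monotone sequence is its
  supremum.\<close>

lemma condenser_cap_eq_SUP:
  "condenser_cap M p x0 E \<Omega> = (SUP j. condenser_cap_bounded M p (E \<inter> ball x0 (real j)) \<Omega>)"
proof -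
  have inc: "incseq (\<lambda>j. condenser_cap_bounded M p (E \<inter> ball x0 (real j)) \<Omega>)"
    unfolding incseq_def by (intro allI impI condenser_cap_bounded_mono Int_mono order_refl subset_ball) simp
  show ?thesis
  proof (cases "bounded E")
    case True
    obtain e where e: "E \<subseteq> ball x0 e" using bounded_subset_ballD[OF True, of x0] by auto
    obtain j :: nat where "e \<le> real j" using real_arch_simple by blast
    then have Ej: "E \<inter> ball x0 (real j) = E" using e subset_ball[of e "real j" x0] by blast
    have "condenser_cap_bounded M p E \<Omega> = (SUP j. condenser_cap_bounded M p (E \<inter> ball x0 (real j)) \<Omega>)"
    proof (rule antisym)
      show "condenser_cap_bounded M p E \<Omega> \<le> (SUP j. condenser_cap_bounded M p (E \<inter> ball x0 (real j)) \<Omega>)"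
        by (rule SUP_upper2[of j]) (simp_all add: Ej)
      show "(SUP j. condenser_cap_bounded M p (E \<inter> ball x0 (real j)) \<Omega>) \<le> condenser_cap_bounded M p E \<Omega>"
        by (intro SUP_least condenser_cap_bounded_mono) auto
    qed
    then show ?thesis using True by (simp add: condenser_cap_def)
  next
    case False
    then show ?thesis using LIMSEQ_SUP[OF inc] by (simp add: condenser_cap_def limI)
  qed
qed

lemma condenser_cap_mono:
  "E \<subseteq> F \<Longrightarrow> condenser_cap M p x0 E \<Omega> \<le> condenser_cap M p x0 F \<Omega>"
  unfolding condenser_cap_eq_SUP by (intro SUP_mono bexI[of _ "_::nat"] condenser_cap_bounded_mono) auto

text \<open>Only finitely many of the sets \<open>G j - cball x0 (j - 2)\<close> meet a given ball, so strong subadditivity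
  controls the capacity of the bounded parts of their union.\<close>

lemma condenser_cap_outer:
  assumes "open \<Omega>" "E \<subseteq> \<Omega>" "condenser_cap M p x0 E \<Omega> < \<infinity>" "0 < \<epsilon>"
  obtains G where "open G" "E \<subseteq> G" "G \<subseteq> \<Omega>"
    "condenser_cap M p x0 G \<Omega> \<le> condenser_cap M p x0 E \<Omega> + ennreal \<epsilon>"
proof -
  let ?C = "\<lambda>A. condenser_cap_bounded M p A \<Omega>"
  let ?c = "condenser_cap M p x0 E \<Omega>"
  define a where "a j = ?C (E \<inter> ball x0 (real j))" for j
  have ac: "a j \<le> ?c" for j unfolding condenser_cap_eq_SUP a_def by (rule SUP_upper) simp
  then have afin: "a j < \<infinity>" for j using assms(3) by (rule le_less_trans)
  define d where "d j = \<epsilon> * (1/2) ^ Suc j" for j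
  have d: "0 < d j" for j using \<open>0 < \<epsilon>\<close> by (simp add: d_def)
  have "\<exists>G. open G \<and> E \<inter> ball x0 (real j) \<subseteq> G \<and> G \<subseteq> \<Omega> \<and> ?C G < a j + ennreal (d j)" for j
  proof -
    have "?C (E \<inter> ball x0 (real j)) < a j + ennreal (d j)"
      using afin[of j] d[of j] ennreal_less_add by (simp add: a_def)
    moreover have "E \<inter> ball x0 (real j) \<subseteq> \<Omega>" using assms(2) by blast
    ultimately obtain G where "open G" "E \<inter> ball x0 (real j) \<subseteq> G" "G \<subseteq> \<Omega>" "?C G < a j + ennreal (d j)"
      using condenser_cap_bounded_outer[OF assms(1)] by metis
    then show ?thesis by blast
  qed
  then obtain G where G: "\<And>j. open (G j)" "\<And>j. E \<inter> ball x0 (real j) \<subseteq> G j" "\<And>j. G j \<subseteq> \<Omega>"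
    "\<And>j. ?C (G j) < a j + ennreal (d j)" by metis
  define H where "H j = (\<Union>i\<le>j. G i)" for j
  have HC: "?C (H j) \<le> a j + (\<Sum>i\<le>j. ennreal (d i))" for j
  proof (induction j)
    case 0
    then show ?case using G(4)[of 0] by (simp add: H_def)
  next
    case (Suc j)
    have "H (Suc j) = H j \<union> G (Suc j)" by (auto simp: H_def le_Suc_eq)
    \<comment> \<open>\<open>E \<inter> ball x0 j\<close> lies in both sets, so the intersection
      term of strong subadditivity is at least \<open>a j\<close> and cancels the finite
      \<open>a j\<close> on the right: only the errors accumulate, not the capacities.\<close>
    moreover have "a j \<le> ?C (H j \<inter> G (Suc j))"
      unfolding a_def
    proof (rule condenser_cap_bounded_mono)
      have "ball x0 (real j) \<subseteq> ball x0 (real (Suc j))" by (intro subset_ball) simp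
      then show "E \<inter> ball x0 (real j) \<subseteq> H j \<inter> G (Suc j)" using G(2)[of j] G(2)[of "Suc j"] by (auto simp: H_def)
    qed
    ultimately have "?C (H (Suc j)) + a j \<le> ?C (H j \<union> G (Suc j)) + ?C (H j \<inter> G (Suc j))"
      by (intro add_mono) auto
    also have "\<dots> \<le> ?C (H j) + ?C (G (Suc j))" using assms(1) by (rule condenser_cap_bounded_strong_subadditive)
    also have "\<dots> \<le> (a j + (\<Sum>i\<le>j. ennreal (d i))) + (a (Suc j) + ennreal (d (Suc j)))"
      using Suc G(4)[of "Suc j"] by (intro add_mono) auto
    also have "\<dots> = (a (Suc j) + (\<Sum>i\<le>Suc j. ennreal (d i))) + a j" by (simp add: algebra_simps)
    finally show ?case using afin[of j] by (auto simp: add.commute[of _ "a j"] ennreal_add_left_cancel_le)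
  qed
  have HC': "?C (H j) \<le> ?c + ennreal \<epsilon>" for j
  proof -
    have "(\<Sum>i\<le>j. ennreal (d i)) \<le> (\<Sum>i. ennreal (d i))" by (intro sum_le_suminf) auto
    also have "\<dots> = ennreal \<epsilon>" unfolding d_def using \<open>0 < \<epsilon>\<close> by (rule suminf_half_pow)
    finally have "a j + (\<Sum>i\<le>j. ennreal (d i)) \<le> ?c + ennreal \<epsilon>" using ac by (intro add_mono)
    with HC show ?thesis by (rule order_trans)
  qed
  \<comment> \<open>A point of \<open>E\<close> with
    \<open>real j - 1 \<le> dist x0 x < real j\<close> is kept in the set with index
    \<open>j\<close>; the radius \<open>real j - 2\<close> leaves room for equality on the left. For
    \<open>j < 2\<close> the ball is empty and nothing is removed.\<close>
  define U where "U = (\<Union>j. G j - cball x0 (real j - 2))"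
  have "open U" unfolding U_def using G(1) by (intro open_UN ballI open_Diff) auto
  moreover have "E \<subseteq> U"
  proof
    fix x assume "x \<in> E"
    define j where "j = Suc (nat \<lfloor>dist x0 x\<rfloor>)"
    have "real j = real_of_int \<lfloor>dist x0 x\<rfloor> + 1" by (simp add: j_def)
    then have "dist x0 x < real j" "real j - 2 < dist x0 x" by linarith+
    then have "x \<in> ball x0 (real j)" "x \<notin> cball x0 (real j - 2)" by auto
    then show "x \<in> U" using \<open>x \<in> E\<close> G(2)[of j] unfolding U_def by blast
  qed
  moreover have "U \<subseteq> \<Omega>" unfolding U_def using G(3) by blast
  moreover have "condenser_cap M p x0 U \<Omega> \<le> ?c + ennreal \<epsilon>"
    unfolding condenser_cap_eq_SUP[of x0 U]
  proof (rule SUP_least)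
    fix i
    have "U \<inter> ball x0 (real i) \<subseteq> H (i + 2)"
    proof
      fix x assume x: "x \<in> U \<inter> ball x0 (real i)"
      then obtain j where j: "x \<in> G j" "real j - 2 < dist x0 x" unfolding U_def by auto
      then have "real j < real (i + 2)" using x by simp
      then have "j \<le> i + 2" by linarith
      then show "x \<in> H (i + 2)" using j unfolding H_def by blast
    qed
    then show "?C (U \<inter> ball x0 (real i)) \<le> ?c + ennreal \<epsilon>"
      using condenser_cap_bounded_mono HC' by (meson order_trans)
  qed
  ultimately show ?thesis by (rule that)
qed

lemma condenser_cap_eq_INF_open:
  assumes "open \<Omega>" "E \<subseteq> \<Omega>"
  shows "condenser_cap M p x0 E \<Omega> = (INF G\<in>{G. open G \<and> E \<subseteq> G \<and> G \<subseteq> \<Omega>}. condenser_cap M p x0 G \<Omega>)"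
proof (rule antisym)
  show "condenser_cap M p x0 E \<Omega> \<le> (INF G\<in>{G. open G \<and> E \<subseteq> G \<and> G \<subseteq> \<Omega>}. condenser_cap M p x0 G \<Omega>)"
    by (intro INF_greatest condenser_cap_mono) auto
  show "(INF G\<in>{G. open G \<and> E \<subseteq> G \<and> G \<subseteq> \<Omega>}. condenser_cap M p x0 G \<Omega>) \<le> condenser_cap M p x0 E \<Omega>"
  proof (rule ennreal_le_epsilon)
    fix \<epsilon> :: real assume "condenser_cap M p x0 E \<Omega> < top" "0 < \<epsilon>"
    then obtain G where G: "open G" "E \<subseteq> G" "G \<subseteq> \<Omega>"
      "condenser_cap M p x0 G \<Omega> \<le> condenser_cap M p x0 E \<Omega> + ennreal \<epsilon>"
      using condenser_cap_outer[OF assms, of x0 \<epsilon>] by auto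
    then show "(INF G\<in>{G. open G \<and> E \<subseteq> G \<and> G \<subseteq> \<Omega>}. condenser_cap M p x0 G \<Omega>) \<le> condenser_cap M p x0 E \<Omega> + ennreal \<epsilon>"
      by (intro INF_lower2[of G]) auto
  qed
qed

lemma condenser_cap_compact_decseq:
  assumes "open \<Omega>" "decseq K" "\<And>i. compact (K i)" "\<And>i. K i \<subseteq> \<Omega>"
  shows "(\<lambda>i. condenser_cap M p x0 (K i) \<Omega>) \<longlonglongrightarrow> condenser_cap M p x0 (\<Inter>i. K i) \<Omega>"
proof (rule order_tendstoI)
  fix y assume "y < condenser_cap M p x0 (\<Inter>i. K i) \<Omega>"
  also have "\<dots> \<le> condenser_cap M p x0 (K i) \<Omega>" for i by (intro condenser_cap_mono) auto
  finally show "eventually (\<lambda>i. y < condenser_cap M p x0 (K i) \<Omega>) sequentially" by simp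
next
  fix y assume y: "condenser_cap M p x0 (\<Inter>i. K i) \<Omega> < y"
  have "(\<Inter>i. K i) \<subseteq> \<Omega>" using assms(4) by blast
  from y obtain G where G: "open G" "(\<Inter>i. K i) \<subseteq> G" "condenser_cap M p x0 G \<Omega> < y"
    unfolding condenser_cap_eq_INF_open[OF assms(1) \<open>(\<Inter>i. K i) \<subseteq> \<Omega>\<close>] INF_less_iff by auto
  \<comment> \<open>A point of \<open>K 0\<close> outside \<open>G\<close> is missed by some
    \<open>K i\<close>; compactness of \<open>K 0\<close> leaves finitely many indices, and an upper
    bound of them works for all points.\<close>
  have "K 0 \<subseteq> (\<Union>i\<in>UNIV. G \<union> - K i)" using G(2) by blast
  moreover have "open (G \<union> - K i)" for i using G(1) assms(3) by (auto intro: compact_imp_closed)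
  ultimately obtain J where J: "finite J" "K 0 \<subseteq> (\<Union>i\<in>J. G \<union> - K i)"
    using compactE_image[OF assms(3)[of 0], of UNIV "\<lambda>i. G \<union> - K i"] by metis
  obtain n where n: "\<And>i. i \<in> J \<Longrightarrow> i \<le> n" using J(1) unfolding finite_nat_set_iff_bounded_le by blast
  have "K n \<subseteq> K i" if "i \<in> insert 0 J" for i using n assms(2) that by (auto simp: decseq_def)
  then have n: "K n \<subseteq> G" using J(2) by blast
  have "condenser_cap M p x0 (K i) \<Omega> < y" if "n \<le> i" for i
  proof -
    have "K i \<subseteq> G" using assms(2) that n by (auto simp: decseq_def)
    then show ?thesis using condenser_cap_mono G(3) by (meson le_less_trans)
  qed
  then show "eventually (\<lambda>i. condenser_cap M p x0 (K i) \<Omega> < y) sequentially"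
    by (auto simp: eventually_sequentially)
qed

end

theorem theorem1p5:
  fixes M :: "'a::metric_space measure" and p :: real and \<Omega> :: "'a set" and x0 :: 'a
  assumes "1 \<le> p"
    and locally_complete: "\<And>x::'a. \<exists>S. x \<in> interior S \<and> complete S"
    and "complete_borel_measure M"
    and "\<And>x r. 0 < r \<Longrightarrow> 0 < emeasure M (ball x r) \<and> emeasure M (ball x r) < \<infinity>"
    and "open \<Omega>"
  shows
    "(\<forall>E. E \<subseteq> \<Omega> \<longrightarrow>
        condenser_cap M p x0 E \<Omega> =
          (INF G\<in>{G. open G \<and> E \<subseteq> G \<and> G \<subseteq> \<Omega>}. condenser_cap M p x0 G \<Omega>)) \<and>
     (\<forall>K :: nat \<Rightarrow> 'a set. decseq K \<longrightarrow> (\<forall>i. compact (K i) \<and> K i \<subseteq> \<Omega>) \<longrightarrow>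
        (\<lambda>i. condenser_cap M p x0 (K i) \<Omega>) \<longlonglongrightarrow> condenser_cap M p x0 (\<Inter>i. K i) \<Omega>)"
proof -
  interpret capacity_space M p
    using assms(1-4) by unfold_locales
  show ?thesis
    using condenser_cap_eq_INF_open[OF \<open>open \<Omega>\<close>, of _ x0] condenser_cap_compact_decseq[OF \<open>open \<Omega>\<close>, of _ x0] by blast
qed

end
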